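(* Let $(X(t),\Lambda(t))$ be the regime-switching jump diffusion on $\mathbb{R}^d\times\mathcal{M}$ with generator $\mathcal{G}$ described in the context, under the standing assumptions listed there. Suppose that $\mathcal{G}$ is strictly irreducible on every bounded domain of $\mathbb{R}^d$. Let $D,E\subset\mathbb{R}^d$ be bounded domains and $l\in\mathcal{M}$. Then: (i) $(X(t),\Lambda(t))$ is recurrent with respect to $D\times\mathcal{M}$ if and only if it is recurrent with respect to $E\times\mathcal{M}$; and $(X(t),\Lambda(t))$ is recurrent with respect to $E\times\mathcal{M}$ if and only if it is recurrent with respect to $E\times\{l\}$. (ii) Suppose in addition that for each $i\in\mathcal{M}$ there exists a nonnegative function $V(\cdot,i)\in C^2(\mathbb{R}^d)$ such that $\mathcal{G}V(x,i)\le-1$ for all $(x,i)\in D^c\times\mathcal{M}$. Then $(X(t),\Lambda(t))$ is positive recurrent with respect to $D\times\mathcal{M}$ if and only if it is positive recurrent with respect to $E\times\mathcal{M}$; and $(X(t),\Lambda(t))$ is positive recurrent with respect to $E\times\mathcal{M}$ if and only if it is positive recurrent with respect to $E\times\{l\}$.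
   Context: A domain in $\mathbb{R}^d$ is a nonempty connected open set. $B(x,r)$ is the open ball of radius $r$ centered at $x$; $D^c=\mathbb{R}^d\setminus D$. $\mathcal{M}=\{1,\dots,m\}$ is a finite set. $C^2_b(\mathbb{R}^d)$ is the class of $C^2$ functions whose partial derivatives up to order 2 (including order 0) are bounded. Data: $b:\mathbb{R}^d\times\mathcal{M}\to\mathbb{R}^d$; $\sigma$ on $\mathbb{R}^d\times\mathcal{M}$ with values in $d\times d$ real matrices; $a(x,i)=\sigma(x,i)\sigma(x,i)'$; for each $(x,i)$ a $\sigma$-finite measure $\pi_i(x,dz)$ on $\mathbb{R}^d$ with $\int(1\wedge|z|^2)\pi_i(x,dz)<\infty$; and an $m\times m$ matrix $Q(x)=(q_{ij}(x))$ with $q_{ij}(x)\ge0$ for $i\ne j$ and $\sum_{j}q_{ij}(x)=0$. For $f:\mathbb{R}^d\times\mathcal{M}\to\mathbb{R}$ with each $f(\cdot,i)\in C^2(\mathbb{R}^d)$, the generator is $$\mathcal{G}f(x,i)=\tfrac12\sum_{k,l=1}^d a_{kl}(x,i)\tfrac{\partial^2 f(x,i)}{\partial x_k\partial x_l}+\sum_{k=1}^d b_k(x,i)\tfrac{\partial f(x,i)}{\partial x_k}+\int_{\mathbb{R}^d}\big(f(x+z,i)-f(x,i)-\nabla f(x,i)\cdot z\,\mathbf{1}_{\{|z|<1\}}\big)\pi_i(x,dz)+\sum_{j\in\mathcal{M}}q_{ij}(x)f(x,j).$$ Standing assumptions: (1) For each $i$, $\sigma(\cdot,i)$ and $b(\cdot,i)$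 are continuous, and $\sum_{k,l}|\sigma_{kl}(x,i)|+\sum_k|b_k(x,i)|\le c(1+|x|)$ on $\mathbb{R}^d$ for some $c>0$; each $q_{ij}$ is bounded and Borel measurable on $\mathbb{R}^d$. (2) For every bounded domain $D\subset\mathbb{R}^d$ there is $\kappa_0=\kappa_0(D)\in(0,1]$ with $\kappa_0|\xi|^2\le\xi'a(x,i)\xi\le\kappa_0^{-1}|\xi|^2$ for all $\xi\in\mathbb{R}^d$, $x\in D$, $i\in\mathcal{M}$. (3) $\sup_{x\in\mathbb{R}^d,i\in\mathcal{M}}\pi_i(x,B(0,1)^c)<\infty$, and for some $c>0$, $\sup_{i\in\mathcal{M}}\int_{B(0,1)}|z|^2\pi_i(x,dz)\le c(1+|x|^2)$ for all $x$. For every $n\ge1$ there is a $\sigma$-finite measure $\Pi_n(dz)$ with $\int(1\wedge|z|^2)\Pi_n(dz)<\infty$ and $\pi_i(x,dz)\le\Pi_n(dz)$ for all $x\in B(0,n)$, $i\in\mathcal{M}$. (4) $\pi_i(x,dz)=\widetilde\pi_i(x,z)\,dz$ for all $i,x$. For any $r\in(0,1)$, any $x_0\in\mathbb{R}^d$, any $x,y\in B(x_0,r/2)$ and $z\in B(x_0,r)^c$, $\widetilde\pi_i(x,z-x)\le\alpha_r\widetilde\pi_i(y,z-y)$, where $1<\alpha_r<\kappa_2r^{-\beta}$ with $\kappa_2,\beta$ positive constants. The process: $\mathbb{P}_{x,i}$ is the law, on the Skorohod space of right-continuous paths with left limits in $\mathbb{R}^d\times\mathcal{M}$, of the solution of the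 martingale problem for $(\mathcal{G},C^2_b(\mathbb{R}^d))$ started at $(x,i)$: $\mathbb{P}_{x,i}(X(0)=x,\Lambda(0)=i)=1$, and for every $f$ with $f(\cdot,j)\in C_b^2(\mathbb{R}^d)$ for all $j$, $f(X(t),\Lambda(t))-f(X(0),\Lambda(0))-\int_0^t\mathcal{G}f(X(s),\Lambda(s))ds$ is a $\mathbb{P}_{x,i}$-martingale. Under the standing assumptions this solution is known to exist and be unique for each $(x,i)$, and $(X(t),\Lambda(t))$ is a strong Markov process with infinite lifetime (no explosion). $\mathbb{E}_{x,i}$ is expectation under $\mathbb{P}_{x,i}$. Strict irreducibility: $\mathcal{G}$ is strictly irreducible on $D\subset\mathbb{R}^d$ if for all $i\ne j$ in $\mathcal{M}$ there is $q^0_{ij}>0$ with $\inf_{x\in D}q_{ij}(x)\ge q^0_{ij}$. Recurrence: for $U=D\times J$ with $D\subset\mathbb{R}^d$ a bounded domain and $J\subset\mathcal{M}$, let $\sigma_U=\inf\{t\ge0:(X(t),\Lambda(t))\in U\}$. The process is recurrent with respect to $U$ if $\mathbb{P}_{x,i}(\sigma_U<\infty)=1$ for all $(x,i)\in U^c$; it is positive recurrent with respect to $U$ if in addition $\mathbb{E}_{x,i}\sigma_U<\infty$ for all $(x,i)\in U^c$. *)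

theory Defs
  imports "HOL-Probability.Probability"
begin

section \<open>Functions of class C2 and the generator\<close>

definition partial_deriv :: "'d::finite \<Rightarrow> (real^'d \<Rightarrow> real) \<Rightarrow> real^'d \<Rightarrow> real" where
  "partial_deriv k f x = frechet_derivative f (at x) (axis k 1)"

definition grad :: "(real^'d::finite \<Rightarrow> real) \<Rightarrow> real^'d \<Rightarrow> real^'d" where
  "grad f x = (\<chi> k. partial_deriv k f x)"

text \<open>Differentiability of the first partials makes them continuous, so this is the usual class
  of functions all of whose partial derivatives up to order 2 exist and are continuous.\<close>

definition C2 :: "(real^'d::finite \<Rightarrow> real) \<Rightarrow> bool" where
  "C2 f \<longleftrightarrow> (\<forall>x. f differentiable (at x)) \<and>
     (\<forall>k x. partial_deriv k f differentiable (at x)) \<and>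
     (\<forall>k l. continuous_on UNIV (partial_deriv k (partial_deriv l f)))"

definition C2b :: "(real^'d::finite \<Rightarrow> real) \<Rightarrow> bool" where
  "C2b f \<longleftrightarrow> C2 f \<and> bounded (range f) \<and>
     (\<forall>k. bounded (range (partial_deriv k f))) \<and>
     (\<forall>k l. bounded (range (partial_deriv k (partial_deriv l f))))"

text \<open>The switching component lives in a finite type \<open>'m\<close>. Functions on the state space are
  curried as \<open>f i x\<close>, so that \<open>f i\<close> is the function usually written \<open>f(\<cdot>, i)\<close>.
  The coefficients keep the order \<open>(x, i)\<close>, except for \<open>\<pi> i x\<close>.\<close>

definition diff_matrix :: "(real^'d \<Rightarrow> 'm \<Rightarrow> real^'d^'d) \<Rightarrow> real^'d::finite \<Rightarrow> 'm \<Rightarrow> real^'d^'d" where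
  "diff_matrix \<sigma> x i = \<sigma> x i ** transpose (\<sigma> x i)"

definition jump_increment :: "(real^'d::finite \<Rightarrow> real) \<Rightarrow> real^'d \<Rightarrow> real^'d \<Rightarrow> real" where
  "jump_increment g x z = g (x + z) - g x - (grad g x \<bullet> z) * indicator {z. norm z < 1} z"

definition generator ::
  "(real^'d \<Rightarrow> 'm \<Rightarrow> real^'d) \<Rightarrow> (real^'d \<Rightarrow> 'm \<Rightarrow> real^'d^'d) \<Rightarrow> ('m \<Rightarrow> real^'d \<Rightarrow> (real^'d) measure) \<Rightarrow>
   (real^'d \<Rightarrow> real^'m^'m) \<Rightarrow> ('m \<Rightarrow> real^'d \<Rightarrow> real) \<Rightarrow> real^'d::finite \<Rightarrow> 'm::finite \<Rightarrow> real" where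
  "generator b \<sigma> \<pi> Q f x i =
     1/2 * (\<Sum>k\<in>UNIV. \<Sum>l\<in>UNIV. diff_matrix \<sigma> x i $ k $ l * partial_deriv k (partial_deriv l (f i)) x)
     + (\<Sum>k\<in>UNIV. b x i $ k * partial_deriv k (f i) x)
     + (LINT z|\<pi> i x. jump_increment (f i) x z)
     + (\<Sum>j\<in>UNIV. Q x $ i $ j * f j x)"

section \<open>Coefficients and standing assumptions\<close>

definition bounded_domain :: "(real^'d::finite) set \<Rightarrow> bool" where
  "bounded_domain D \<longleftrightarrow> D \<noteq> {} \<and> open D \<and> connected D \<and> bounded D"

text \<open>A sigma-finite Borel measure integrating \<open>1 \<and> |z|\<^sup>2\<close>. No condition at the origin is imposed.\<close>

definition jump_measure :: "(real^'d::finite) measure \<Rightarrow> bool" where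
  "jump_measure \<mu> \<longleftrightarrow> sets \<mu> = sets borel \<and> sigma_finite_measure \<mu> \<and>
     (\<integral>\<^sup>+z. ennreal (min 1 ((norm z)\<^sup>2)) \<partial>\<mu>) < \<infinity>"

locale regime_switching_jump_diffusion =
  fixes b :: "real^'d::finite \<Rightarrow> 'm::finite \<Rightarrow> real^'d"
    and \<sigma> :: "real^'d \<Rightarrow> 'm \<Rightarrow> real^'d^'d"
    and \<pi> :: "'m \<Rightarrow> real^'d \<Rightarrow> (real^'d) measure"
    and Q :: "real^'d \<Rightarrow> real^'m^'m"
  assumes jump_measure: "\<And>i x. jump_measure (\<pi> i x)"
    and Q_offdiag: "\<And>x i j. i \<noteq> j \<Longrightarrow> Q x $ i $ j \<ge> 0"
    and Q_row_sum: "\<And>x i. (\<Sum>j\<in>UNIV. Q x $ i $ j) = 0"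
    and sigma_continuous: "\<And>i. continuous_on UNIV (\<lambda>x. \<sigma> x i)"
    and b_continuous: "\<And>i. continuous_on UNIV (\<lambda>x. b x i)"
    and linear_growth: "\<And>i. \<exists>c>0. \<forall>x.
        (\<Sum>k\<in>UNIV. \<Sum>l\<in>UNIV. \<bar>\<sigma> x i $ k $ l\<bar>) + (\<Sum>k\<in>UNIV. \<bar>b x i $ k\<bar>) \<le> c * (1 + norm x)"
    and Q_bounded: "\<And>i j. bounded (range (\<lambda>x. Q x $ i $ j))"
    and Q_measurable: "\<And>i j. (\<lambda>x. Q x $ i $ j) \<in> borel_measurable borel"
    and ellipticity: "\<And>D. bounded_domain D \<Longrightarrow> \<exists>\<kappa>\<^sub>0. 0 < \<kappa>\<^sub>0 \<and> \<kappa>\<^sub>0 \<le> 1 \<and> (\<forall>\<xi>. \<forall>x\<in>D. \<forall>i.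
        \<kappa>\<^sub>0 * (norm \<xi>)\<^sup>2 \<le> \<xi> \<bullet> (diff_matrix \<sigma> x i *v \<xi>) \<and>
        \<xi> \<bullet> (diff_matrix \<sigma> x i *v \<xi>) \<le> inverse \<kappa>\<^sub>0 * (norm \<xi>)\<^sup>2)"
    and big_jumps: "(SUP x. SUP i. emeasure (\<pi> i x) (- ball 0 1)) < \<infinity>"
    and small_jumps: "\<exists>c>0. \<forall>x.
        (SUP i. \<integral>\<^sup>+z\<in>ball 0 1. ennreal ((norm z)\<^sup>2) \<partial>\<pi> i x) \<le> ennreal (c * (1 + (norm x)\<^sup>2))"
    and local_domination: "\<And>n::nat. n \<ge> 1 \<Longrightarrow> \<exists>\<nu>. jump_measure \<nu> \<and>
        (\<forall>x\<in>ball 0 (real n). \<forall>i. \<forall>A\<in>sets borel. emeasure (\<pi> i x) A \<le> emeasure \<nu> A)"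
    and jump_density: "\<exists>p :: 'm \<Rightarrow> real^'d \<Rightarrow> real^'d \<Rightarrow> real.
        (\<forall>i x. p i x \<in> borel_measurable borel \<and> (\<forall>z. p i x z \<ge> 0) \<and>
               \<pi> i x = density lborel (\<lambda>z. ennreal (p i x z))) \<and>
        (\<exists>\<kappa>\<^sub>2>0. \<exists>\<beta>>0. \<forall>r. 0 < r \<and> r < 1 \<longrightarrow>
          (\<exists>\<alpha>. 1 < \<alpha> \<and> \<alpha> < \<kappa>\<^sub>2 * r powr (-\<beta>) \<and>
            (\<forall>i x\<^sub>0. \<forall>x\<in>ball x\<^sub>0 (r/2). \<forall>y\<in>ball x\<^sub>0 (r/2). \<forall>z\<in>- ball x\<^sub>0 r.
               p i x (z - x) \<le> \<alpha> * p i y (z - y))))"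

definition strictly_irreducible :: "(real^'d \<Rightarrow> real^'m^'m) \<Rightarrow> (real^'d::finite) set \<Rightarrow> bool" where
  "strictly_irreducible Q D \<longleftrightarrow> (\<forall>i j::'m::finite. i \<noteq> j \<longrightarrow> (\<exists>q0>0. \<forall>x\<in>D. q0 \<le> Q x $ i $ j))"

section \<open>The canonical path space\<close>

definition state_algebra :: "((real^'d::finite) \<times> 'm::finite) measure" where
  "state_algebra = borel \<Otimes>\<^sub>M count_space UNIV"

text \<open>Right-continuous paths with left limits, the second component carrying the discrete topology.
  Paths have infinite lifetime; the value at negative times is fixed by \<open>extensional\<close>.\<close>

definition skorohod_paths :: "(real \<Rightarrow> (real^'d::finite) \<times> 'm::finite) set" where
  "skorohod_paths = {\<omega> \<in> extensional {0..}.
     (\<forall>t\<ge>0. ((\<lambda>s. fst (\<omega> s)) \<longlongrightarrow> fst (\<omega> t)) (at_right t) \<and>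
            (\<forall>\<^sub>F s in at_right t. snd (\<omega> s) = snd (\<omega> t))) \<and>
     (\<forall>t>0. (\<exists>l. ((\<lambda>s. fst (\<omega> s)) \<longlongrightarrow> l) (at_left t)) \<and>
            (\<exists>j. \<forall>\<^sub>F s in at_left t. snd (\<omega> s) = j))}"

text \<open>The sigma-algebra generated by the coordinates, which is the Borel sigma-algebra of the
  Skorohod topology.\<close>

definition path_algebra :: "(real \<Rightarrow> (real^'d::finite) \<times> 'm::finite) measure" where
  "path_algebra = restrict_space (Pi\<^sub>M {0..} (\<lambda>_. state_algebra)) skorohod_paths"

definition history :: "real \<Rightarrow> (real \<Rightarrow> (real^'d::finite) \<times> 'm::finite) measure" where
  "history t = vimage_algebra skorohod_paths (\<lambda>\<omega>. restrict \<omega> {0..t}) (Pi\<^sub>M {0..t} (\<lambda>_. state_algebra))"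

definition shift_path :: "real \<Rightarrow> (real \<Rightarrow> (real^'d::finite) \<times> 'm::finite) \<Rightarrow> real \<Rightarrow> (real^'d) \<times> 'm" where
  "shift_path s \<omega> = restrict (\<lambda>t. \<omega> (s + t)) {0..}"

definition martingale :: "'a measure \<Rightarrow> (real \<Rightarrow> 'a measure) \<Rightarrow> (real \<Rightarrow> 'a \<Rightarrow> real) \<Rightarrow> bool" where
  "martingale M F N \<longleftrightarrow>
     (\<forall>t\<ge>0. N t \<in> borel_measurable (F t) \<and> integrable M (N t)) \<and>
     (\<forall>s\<ge>0. \<forall>t\<ge>s. AE \<omega> in M. real_cond_exp M (F s) (N t) \<omega> = N s \<omega>)"

section \<open>The martingale problem and the strong Markov property\<close>

text \<open>The integrability clause says that the time integral is meaningful; it excludes the default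
  value that the library gives to the integral of a non-integrable function.\<close>

definition martingale_problem_solution ::
  "(real^'d \<Rightarrow> 'm \<Rightarrow> real^'d) \<Rightarrow> (real^'d \<Rightarrow> 'm \<Rightarrow> real^'d^'d) \<Rightarrow> ('m \<Rightarrow> real^'d \<Rightarrow> (real^'d) measure) \<Rightarrow>
   (real^'d \<Rightarrow> real^'m^'m) \<Rightarrow> (real^'d::finite) \<times> 'm::finite \<Rightarrow> (real \<Rightarrow> (real^'d) \<times> 'm) measure \<Rightarrow> bool" where
  "martingale_problem_solution b \<sigma> \<pi> Q start P \<longleftrightarrow>
     prob_space P \<and> sets P = sets path_algebra \<and>
     measure P {\<omega> \<in> space P. \<omega> 0 = start} = 1 \<and>
     (\<forall>f. (\<forall>j. C2b (f j)) \<longrightarrow>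
        (AE \<omega> in P. \<forall>t\<ge>0. set_integrable lborel {0..t}
           (\<lambda>s. generator b \<sigma> \<pi> Q f (fst (\<omega> s)) (snd (\<omega> s)))) \<and>
        martingale P history (\<lambda>t \<omega>.
           f (snd (\<omega> t)) (fst (\<omega> t)) - f (snd (\<omega> 0)) (fst (\<omega> 0))
           - (LINT s:{0..t}|lborel. generator b \<sigma> \<pi> Q f (fst (\<omega> s)) (snd (\<omega> s)))))"

text \<open>Stopping times of the right-continuous filtration \<open>t \<mapsto> \<Inter>s>t. history s\<close>, and the
  sigma-algebra of the events prior to such a time. Hitting times of open sets are of this kind.\<close>

definition optional_time :: "((real \<Rightarrow> (real^'d::finite) \<times> 'm::finite) \<Rightarrow> ennreal) \<Rightarrow> bool" where
  "optional_time \<tau> \<longleftrightarrow> (\<forall>t\<ge>0. {\<omega> \<in> skorohod_paths. \<tau> \<omega> < ennreal t} \<in> sets (history t))"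

definition events_before ::
  "((real \<Rightarrow> (real^'d::finite) \<times> 'm::finite) \<Rightarrow> ennreal) \<Rightarrow> (real \<Rightarrow> (real^'d) \<times> 'm) set set" where
  "events_before \<tau> = {A \<in> sets path_algebra. \<forall>t\<ge>0. {\<omega> \<in> A. \<tau> \<omega> < ennreal t} \<in> sets (history t)}"

text \<open>On \<open>{\<tau> < \<infinity>}\<close>, the conditional law of the shifted path given the events prior to \<open>\<tau>\<close> is
  the law started at the state at time \<open>\<tau>\<close>.\<close>

definition strong_markov ::
  "((real^'d::finite) \<times> 'm::finite \<Rightarrow> (real \<Rightarrow> (real^'d) \<times> 'm) measure) \<Rightarrow> bool" where
  "strong_markov P \<longleftrightarrow>
     P \<in> state_algebra \<rightarrow>\<^sub>M prob_algebra path_algebra \<and>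
     (\<forall>start \<tau>. optional_time \<tau> \<longrightarrow> (\<forall>A\<in>events_before \<tau>. \<forall>B\<in>sets path_algebra.
        emeasure (P start) {\<omega> \<in> A. \<tau> \<omega> < \<infinity> \<and> shift_path (enn2real (\<tau> \<omega>)) \<omega> \<in> B} =
        (\<integral>\<^sup>+\<omega>\<in>{\<omega> \<in> A. \<tau> \<omega> < \<infinity>}. emeasure (P (\<omega> (enn2real (\<tau> \<omega>)))) B \<partial>P start)))"

section \<open>Recurrence\<close>

definition hitting_time ::
  "((real^'d::finite) \<times> 'm::finite) set \<Rightarrow> (real \<Rightarrow> (real^'d) \<times> 'm) \<Rightarrow> ennreal" where
  "hitting_time U \<omega> = (INF t\<in>{t. 0 \<le> t \<and> \<omega> t \<in> U}. ennreal t)"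

definition recurrent ::
  "((real^'d::finite) \<times> 'm::finite \<Rightarrow> (real \<Rightarrow> (real^'d) \<times> 'm) measure) \<Rightarrow> ((real^'d) \<times> 'm) set \<Rightarrow> bool" where
  "recurrent P U \<longleftrightarrow>
     (\<forall>start\<in>- U. measure (P start) {\<omega> \<in> space (P start). hitting_time U \<omega> < \<infinity>} = 1)"

definition positive_recurrent ::
  "((real^'d::finite) \<times> 'm::finite \<Rightarrow> (real \<Rightarrow> (real^'d) \<times> 'm) measure) \<Rightarrow> ((real^'d) \<times> 'm) set \<Rightarrow> bool" where
  "positive_recurrent P U \<longleftrightarrow> recurrent P U \<and>
     (\<forall>start\<in>- U. (\<integral>\<^sup>+\<omega>. hitting_time U \<omega> \<partial>P start) < \<infinity>)"

text \<open>The integrability clause makes the jump part of \<open>generator V\<close> an actual integral. For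
  nonnegative \<open>V\<close> it only excludes the value \<open>\<infinity>\<close>, which the inequality excludes anyway.\<close>

definition lyapunov_function ::
  "(real^'d \<Rightarrow> 'm \<Rightarrow> real^'d) \<Rightarrow> (real^'d \<Rightarrow> 'm \<Rightarrow> real^'d^'d) \<Rightarrow> ('m \<Rightarrow> real^'d \<Rightarrow> (real^'d) measure) \<Rightarrow>
   (real^'d \<Rightarrow> real^'m^'m) \<Rightarrow> (real^'d::finite) set \<Rightarrow> ('m::finite \<Rightarrow> real^'d \<Rightarrow> real) \<Rightarrow> bool" where
  "lyapunov_function b \<sigma> \<pi> Q D V \<longleftrightarrow>
     (\<forall>i. C2 (V i) \<and> (\<forall>x. V i x \<ge> 0)) \<and>
     (\<forall>x\<in>- D. \<forall>i. integrable (\<pi> i x) (jump_increment (V i) x) \<and> generator b \<sigma> \<pi> Q V x i \<le> -1)"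

end

theory Submission
  imports Defs
begin

text \<open>
  Let \<open>U = E \<times> {l}\<close> and take a ball around \<open>y\<close> inside \<open>E\<close>. A convex cut-off of
  \<open>exp (- \<mu> |x - y|\<^sup>2)\<close>, plus a multiple of a narrower such bump in the regime \<open>l\<close> only, is a compactly
  supported \<open>f \<ge> 0\<close> with \<open>G f \<ge> f\<close> off \<open>U\<close>, positive on any prescribed ball. Ellipticity gives the
  inequality away from \<open>y\<close>, strict irreducibility near \<open>y\<close>. As this holds on the whole complement of \<open>U\<close>,
  Dynkin's formula at deterministic times suffices to bound from below, uniformly on bounded sets, the
  probability of hitting \<open>U\<close> before some time \<open>T\<close>. Recurrence with respect to \<open>D \<times> UNIV\<close> and the strong
  Markov property extend the lower bound for the hitting probability to all starting points, and a hitting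
  probability bounded away from \<open>0\<close> is \<open>1\<close>.

  For positive recurrence, \<open>V - A f\<close> with \<open>A\<close> large satisfies \<open>G (V - A f) \<le> -1\<close> on the whole complement
  of \<open>U\<close>, because \<open>G V\<close> is bounded above on \<open>D\<close>: the comparison of the jump densities bounds the integral
  of \<open>V\<close> over the large jumps. Cutting \<open>V\<close> off outside large balls only lowers \<open>G V\<close> inside, so the mean
  hitting time of \<open>U\<close> is finite from every starting point.
\<close>

subsection \<open>Calculus of twice continuously differentiable functions\<close>

text \<open>The obstacle is the jump part: \<open>generator\<close> at one point sees the test
  function everywhere, while the martingale problem admits only bounded functions, so a cut-off is
  felt at every point. Convexity removes the difficulty. For convex \<psi> of class C2, the
  second-order term and every single jump increment of \<psi>(w) are at least \<psi>'(w) times those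
  of w, so a lower bound for w survives the cut-off; where \<psi>'(w) = 0 the local and jump parts
  are nonnegative. For w = exp (- \<mu> |x - y|^2) this lower bound is w (2 \<mu>^2 \<kappa> |x -
  y|^2 - O(\<mu>)). Trace, drift and jumps all cost only O(\<mu>), in proportion to w(x), so a large
  \<mu> wins at any fixed distance from y. At y the gradient of w vanishes and no choice of \<mu>
  helps; the regimes other than l must gain there by switching. A subsolution on the whole
  complement can be integrated up to a fixed time without stopping the path at the boundary of a
  ball.\<close>

lemma partial_deriv_eq:
  assumes "(f has_derivative f') (at x)"
  shows "partial_deriv k f x = f' (axis k 1)"
  using frechet_derivative_at[OF assms] by (simp add: partial_deriv_def)

lemma linear_sum_axis:
  fixes f' :: "real^'d::finite \<Rightarrow> real"
  assumes "linear f'"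
  shows "f' h = (\<Sum>k\<in>UNIV. f' (axis k 1) * h $ k)"
proof -
  have "f' h = f' (\<Sum>k\<in>UNIV. (h $ k) *\<^sub>R axis k 1)"
    using basis_expansion[of h] by (simp only: scalar_mult_eq_scaleR)
  also have "\<dots> = (\<Sum>k\<in>UNIV. f' (axis k 1) * h $ k)"
    by (simp add: linear_sum[OF assms] linear_cmul[OF assms] mult.commute)
  finally show ?thesis .
qed

lemma has_derivative_partial_deriv:
  fixes f :: "real^'d::finite \<Rightarrow> real"
  assumes "f differentiable (at x)"
  shows "(f has_derivative (\<lambda>h. \<Sum>k\<in>UNIV. partial_deriv k f x * h $ k)) (at x)"
proof -
  obtain f' where f': "(f has_derivative f') (at x)"
    using assms differentiable_def by blast
  have "f' = (\<lambda>h. \<Sum>k\<in>UNIV. partial_deriv k f x * h $ k)"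
    unfolding partial_deriv_eq[OF f'] by (rule ext, rule linear_sum_axis[OF has_derivative_linear[OF f']])
  with f' show ?thesis by simp
qed

lemma C2_has_derivative:
  assumes "C2 f"
  shows "(f has_derivative (\<lambda>h. \<Sum>k\<in>UNIV. partial_deriv k f x * h $ k)) (at x)"
  using assms by (auto simp: C2_def intro: has_derivative_partial_deriv)

lemma C2_has_derivative2:
  assumes "C2 f"
  shows "(partial_deriv l f has_derivative
    (\<lambda>h. \<Sum>k\<in>UNIV. partial_deriv k (partial_deriv l f) x * h $ k)) (at x)"
  using assms by (auto simp: C2_def intro: has_derivative_partial_deriv)

lemma C2_continuous2: "C2 f \<Longrightarrow> continuous_on UNIV (partial_deriv k (partial_deriv l f))"
  by (simp add: C2_def)

lemma C2_continuous1: "C2 f \<Longrightarrow> continuous_on UNIV (partial_deriv k f)"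
  unfolding C2_def by (intro differentiable_imp_continuous_on) (auto simp: differentiable_on_def)

lemma C2_continuous: "C2 f \<Longrightarrow> continuous_on UNIV f"
  unfolding C2_def by (intro differentiable_imp_continuous_on) (auto simp: differentiable_on_def)

lemma sum_mult_axis: "(\<Sum>k\<in>UNIV. (c k :: real) * axis l 1 $ k) = c (l::'d::finite)"
  by (simp add: axis_def if_distrib cong: if_cong)

text \<open>Candidates \<open>D\<close> and \<open>H\<close> enter as coefficients of total
  derivatives, and evaluation at \<open>axis k 1\<close> identifies them with iterated
  \<open>partial_deriv\<close>. The closure properties below reduce to this criterion, so they use
  only the differentiation rules.\<close>

lemma C2I:
  fixes f :: "real^'d::finite \<Rightarrow> real"
  assumes D: "\<And>x. (f has_derivative (\<lambda>h. \<Sum>k\<in>UNIV. D k x * h $ k)) (at x)"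
    and H: "\<And>k x. (D k has_derivative (\<lambda>h. \<Sum>l\<in>UNIV. H l k x * h $ l)) (at x)"
    and cont: "\<And>k l. continuous_on UNIV (H l k)"
  shows C2I_C2: "C2 f" and C2I_partial: "partial_deriv k f = D k"
    and C2I_partial2: "partial_deriv l (partial_deriv k f) = H l k"
proof -
  have p: "partial_deriv k f = D k" for k
    by (rule ext) (simp add: partial_deriv_eq[OF D] sum_mult_axis)
  have p2: "partial_deriv l (D k) = H l k" for k l
    by (rule ext) (simp add: partial_deriv_eq[OF H] sum_mult_axis)
  show "C2 f" unfolding C2_def p p2 using D H cont by (auto simp: differentiable_def)
  show "partial_deriv k f = D k" "partial_deriv l (partial_deriv k f) = H l k"
    by (simp_all add: p p2)
qed

lemma C2_lincomb:
  fixes f g :: "real^'d::finite \<Rightarrow> real" and c d :: real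
  assumes "C2 f" "C2 g"
  shows "C2 (\<lambda>x. c * f x + d * g x)"
    and "partial_deriv k (\<lambda>x. c * f x + d * g x) = (\<lambda>x. c * partial_deriv k f x + d * partial_deriv k g x)"
    and "partial_deriv l (partial_deriv k (\<lambda>x. c * f x + d * g x)) =
      (\<lambda>x. c * partial_deriv l (partial_deriv k f) x + d * partial_deriv l (partial_deriv k g) x)"
proof -
  let ?D = "\<lambda>k x. c * partial_deriv k f x + d * partial_deriv k g x"
  let ?H = "\<lambda>l k x. c * partial_deriv l (partial_deriv k f) x + d * partial_deriv l (partial_deriv k g) x"
  have 1: "((\<lambda>x. c * f x + d * g x) has_derivative (\<lambda>h. \<Sum>k\<in>UNIV. ?D k x * h $ k)) (at x)" for x
    by (rule has_derivative_eq_rhs, rule has_derivative_add[OF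
        has_derivative_mult_right[OF C2_has_derivative[OF assms(1)]]
        has_derivative_mult_right[OF C2_has_derivative[OF assms(2)]]])
       (auto simp: fun_eq_iff algebra_simps sum.distrib sum_distrib_left)
  have 2: "(?D k has_derivative (\<lambda>h. \<Sum>l\<in>UNIV. ?H l k x * h $ l)) (at x)" for k x
    by (rule has_derivative_eq_rhs, rule has_derivative_add[OF
        has_derivative_mult_right[OF C2_has_derivative2[OF assms(1)]]
        has_derivative_mult_right[OF C2_has_derivative2[OF assms(2)]]])
       (auto simp: fun_eq_iff algebra_simps sum.distrib sum_distrib_left)
  have 3: "continuous_on UNIV (?H l k)" for k l
    by (intro continuous_intros C2_continuous2 assms)
  note * = C2I[of _ ?D ?H, OF 1 2 3]
  show "C2 (\<lambda>x. c * f x + d * g x)" by (rule *)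
  show "partial_deriv k (\<lambda>x. c * f x + d * g x) = (\<lambda>x. c * partial_deriv k f x + d * partial_deriv k g x)"
    by (rule *)
  show "partial_deriv l (partial_deriv k (\<lambda>x. c * f x + d * g x)) =
      (\<lambda>x. c * partial_deriv l (partial_deriv k f) x + d * partial_deriv l (partial_deriv k g) x)"
    by (rule *)
qed

lemma C2_mult:
  fixes f g :: "real^'d::finite \<Rightarrow> real"
  assumes "C2 f" "C2 g"
  shows "C2 (\<lambda>x. f x * g x)"
proof -
  let ?D = "\<lambda>k x. f x * partial_deriv k g x + partial_deriv k f x * g x"
  let ?H = "\<lambda>l k x. f x * partial_deriv l (partial_deriv k g) x + partial_deriv l f x * partial_deriv k g x
     + (partial_deriv k f x * partial_deriv l g x + partial_deriv l (partial_deriv k f) x * g x)"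
  have 1: "((\<lambda>x. f x * g x) has_derivative (\<lambda>h. \<Sum>k\<in>UNIV. ?D k x * h $ k)) (at x)" for x
    by (rule has_derivative_eq_rhs, rule has_derivative_mult[OF
        C2_has_derivative[OF assms(1)] C2_has_derivative[OF assms(2)]])
       (auto simp: fun_eq_iff algebra_simps sum.distrib sum_distrib_left)
  have 2: "(?D k has_derivative (\<lambda>h. \<Sum>l\<in>UNIV. ?H l k x * h $ l)) (at x)" for k x
    by (rule has_derivative_eq_rhs, rule has_derivative_add[OF
        has_derivative_mult[OF C2_has_derivative[OF assms(1)] C2_has_derivative2[OF assms(2)]]
        has_derivative_mult[OF C2_has_derivative2[OF assms(1)] C2_has_derivative[OF assms(2)]]])
       (auto simp: fun_eq_iff algebra_simps sum.distrib sum_distrib_left)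
  have 3: "continuous_on UNIV (?H l k)" for k l
    by (intro continuous_intros C2_continuous2 C2_continuous1 C2_continuous assms)
  show ?thesis by (rule C2I[of _ ?D ?H, OF 1 2 3])
qed

lemma C2_compose:
  fixes g :: "real^'d::finite \<Rightarrow> real" and \<psi> \<psi>' \<psi>'' :: "real \<Rightarrow> real"
  assumes g: "C2 g"
    and d1: "\<And>s. (\<psi> has_real_derivative \<psi>' s) (at s)"
    and d2: "\<And>s. (\<psi>' has_real_derivative \<psi>'' s) (at s)"
    and c: "continuous_on UNIV \<psi>''"
  shows "C2 (\<lambda>x. \<psi> (g x))"
    and "partial_deriv k (\<lambda>x. \<psi> (g x)) = (\<lambda>x. \<psi>' (g x) * partial_deriv k g x)"
    and "partial_deriv l (partial_deriv k (\<lambda>x. \<psi> (g x))) =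
      (\<lambda>x. \<psi>'' (g x) * (partial_deriv l g x * partial_deriv k g x)
         + \<psi>' (g x) * partial_deriv l (partial_deriv k g) x)"
proof -
  let ?D = "\<lambda>k x. \<psi>' (g x) * partial_deriv k g x"
  let ?H = "\<lambda>l k x. \<psi>'' (g x) * (partial_deriv l g x * partial_deriv k g x)
         + \<psi>' (g x) * partial_deriv l (partial_deriv k g) x"
  have comp: "((\<lambda>x. \<phi> (g x)) has_derivative (\<lambda>h. \<phi>' (g x) * (\<Sum>k\<in>UNIV. partial_deriv k g x * h $ k))) (at x)"
    if "\<And>s. (\<phi> has_real_derivative \<phi>' s) (at s)" for \<phi> \<phi>' x
    using has_derivative_compose[OF C2_has_derivative[OF g] that[unfolded has_field_derivative_def]]
    by simp
  have 1: "((\<lambda>x. \<psi> (g x)) has_derivative (\<lambda>h. \<Sum>k\<in>UNIV. ?D k x * h $ k)) (at x)" for x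
    by (rule has_derivative_eq_rhs, rule comp[OF d1]) (simp add: sum_distrib_left mult.assoc)
  have 2: "(?D k has_derivative (\<lambda>h. \<Sum>l\<in>UNIV. ?H l k x * h $ l)) (at x)" for k x
    by (rule has_derivative_eq_rhs, rule has_derivative_mult[OF comp[OF d2] C2_has_derivative2[OF g]])
       (auto simp: fun_eq_iff algebra_simps sum.distrib sum_distrib_left)
  have cc: "continuous_on UNIV (\<lambda>x. \<phi> (g x))" if "continuous_on UNIV \<phi>" for \<phi> :: "real \<Rightarrow> real"
    by (rule continuous_on_compose2[OF that C2_continuous[OF g]]) simp
  have 3: "continuous_on UNIV (?H l k)" for k l
    by (intro continuous_intros C2_continuous2 C2_continuous1 g cc c DERIV_continuous_on[OF d2])
  note * = C2I[of _ ?D ?H, OF 1 2 3]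
  show "C2 (\<lambda>x. \<psi> (g x))" by (rule *)
  show "partial_deriv k (\<lambda>x. \<psi> (g x)) = (\<lambda>x. \<psi>' (g x) * partial_deriv k g x)" by (rule *)
  show "partial_deriv l (partial_deriv k (\<lambda>x. \<psi> (g x))) =
      (\<lambda>x. \<psi>'' (g x) * (partial_deriv l g x * partial_deriv k g x)
         + \<psi>' (g x) * partial_deriv l (partial_deriv k g) x)" by (rule *)
qed

lemma C2_sqdist:
  fixes y :: "real^'d::finite"
  shows "C2 (\<lambda>x. (norm (x - y))\<^sup>2)"
    and "partial_deriv k (\<lambda>x. (norm (x - y))\<^sup>2) = (\<lambda>x. 2 * (x $ k - y $ k))"
    and "partial_deriv l (partial_deriv k (\<lambda>x. (norm (x - y))\<^sup>2)) = (\<lambda>x. if l = k then 2 else 0)"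
proof -
  let ?D = "\<lambda>k (x::real^'d). 2 * (x $ k - y $ k)"
  let ?H = "\<lambda>l k (x::real^'d). if l = k then 2 else 0 :: real"
  have 1: "((\<lambda>x. (norm (x - y))\<^sup>2) has_derivative (\<lambda>h. \<Sum>k\<in>UNIV. ?D k x * h $ k)) (at x)" for x
    unfolding power2_norm_eq_inner
    by (rule has_derivative_eq_rhs, (rule derivative_intros)+)
       (auto simp: fun_eq_iff inner_vec_def sum_distrib_left algebra_simps sum.distrib sum_negf sum_subtractf)
  have 2: "(?D k has_derivative (\<lambda>h. \<Sum>l\<in>UNIV. ?H l k x * h $ l)) (at x)" for k x
    by (rule has_derivative_eq_rhs,
        (rule derivative_intros bounded_linear.has_derivative[OF bounded_linear_vec_nth])+)
       (auto simp: fun_eq_iff if_distrib[of "\<lambda>c. c * _"] cong: if_cong)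
  have 3: "continuous_on UNIV (?H l k)" for k l
    by (intro continuous_intros)
  note * = C2I[of _ ?D ?H, OF 1 2 3]
  show "C2 (\<lambda>x. (norm (x - y))\<^sup>2)" by (rule *)
  show "partial_deriv k (\<lambda>x. (norm (x - y))\<^sup>2) = (\<lambda>x. 2 * (x $ k - y $ k))" by (rule *)
  show "partial_deriv l (partial_deriv k (\<lambda>x. (norm (x - y))\<^sup>2)) = (\<lambda>x. if l = k then 2 else 0)" by (rule *)
qed

section \<open>Locality of derivatives and compact support\<close>

lemma partial_deriv_cong_open:
  fixes f g :: "real^'d::finite \<Rightarrow> real"
  assumes "open S" "x \<in> S" "\<And>y. y \<in> S \<Longrightarrow> f y = g y"
  shows "partial_deriv k f x = partial_deriv k g x"
proof -
  have "(f has_derivative f') (at x) \<longleftrightarrow> (g has_derivative f') (at x)" for f'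
    using has_derivative_transform_within_open[of f f' x UNIV S g]
      has_derivative_transform_within_open[of g f' x UNIV S f] assms by auto
  then show ?thesis by (simp add: partial_deriv_def frechet_derivative_def)
qed

lemma partial_deriv2_cong_open:
  fixes f g :: "real^'d::finite \<Rightarrow> real"
  assumes "open S" "x \<in> S" "\<And>y. y \<in> S \<Longrightarrow> f y = g y"
  shows "partial_deriv l (partial_deriv k f) x = partial_deriv l (partial_deriv k g) x"
  by (rule partial_deriv_cong_open[OF assms(1,2)]) (rule partial_deriv_cong_open[OF assms(1) _ assms(3)])

lemma grad_inner: "grad f x \<bullet> z = (\<Sum>k\<in>UNIV. partial_deriv k f x * z $ k)"
  by (simp add: grad_def inner_vec_def)

text \<open>On \<open>C2b\<close> functions the generator may be unbounded, since
  \<open>diff_matrix\<close> may grow quadratically; on compactly supported ones it is bounded. All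
  test functions for the martingale problem are taken from this subclass of
  \<open>C2b\<close>.\<close>

definition C2c :: "(real^'d::finite \<Rightarrow> real) \<Rightarrow> bool" where
  "C2c f \<longleftrightarrow> C2 f \<and> (\<exists>R. \<forall>x. R \<le> norm x \<longrightarrow> f x = 0)"

lemma bounded_range_continuous_support:
  fixes g :: "real^'d::finite \<Rightarrow> real"
  assumes "continuous_on UNIV g" "\<And>x. R < norm x \<Longrightarrow> g x = 0"
  shows "bounded (range g)"
proof -
  have "compact (g ` cball 0 R)"
    by (intro compact_continuous_image continuous_on_subset[OF assms(1)]) auto
  then have "bounded (insert 0 (g ` cball 0 R))"
    using compact_imp_bounded by auto
  then show ?thesis
    by (rule bounded_subset) (use assms(2) in \<open>force simp: not_less dist_norm\<close>)
qed

lemma partial_deriv_zero: "partial_deriv k (\<lambda>x. 0) = (\<lambda>x::real^'d::finite. 0)"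
  by (rule ext) (simp add: partial_deriv_eq[OF has_derivative_const])

lemma partial_deriv_support:
  fixes f :: "real^'d::finite \<Rightarrow> real"
  assumes "\<And>x. R \<le> norm x \<Longrightarrow> f x = 0" "R < norm x"
  shows "partial_deriv k f x = 0" "partial_deriv l (partial_deriv k f) x = 0"
proof -
  have o: "open {x::real^'d. R < norm x}" "x \<in> {x. R < norm x}" 
    using assms by (auto intro!: open_Collect_less continuous_intros)
  show "partial_deriv k f x = 0" "partial_deriv l (partial_deriv k f) x = 0"
    using partial_deriv_cong_open[OF o, of f "\<lambda>x. 0"] partial_deriv2_cong_open[OF o, of f "\<lambda>x. 0"] assms(1)
    by (auto simp: partial_deriv_zero)
qed

lemma C2c_imp_C2b:
  assumes "C2c f" shows "C2b f"
proof -
  obtain R where C: "C2 f" and R: "\<And>x. R \<le> norm x \<Longrightarrow> f x = 0"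
    using assms by (auto simp: C2c_def)
  show ?thesis unfolding C2b_def
    using C by (intro conjI allI bounded_range_continuous_support[where R=R] C2_continuous C2_continuous1
        C2_continuous2 partial_deriv_support[OF R] R) auto
qed

lemma C2c_lincomb: "C2c f \<Longrightarrow> C2c g \<Longrightarrow> C2c (\<lambda>x. c * f x + d * g x)"
  unfolding C2c_def
proof safe
  fix R R' assume "\<forall>x. R \<le> norm x \<longrightarrow> f x = 0" "\<forall>x. R' \<le> norm x \<longrightarrow> g x = 0"
  then show "\<exists>R. \<forall>x. R \<le> norm x \<longrightarrow> c * f x + d * g x = 0"
    by (intro exI[of _ "max R R'"]) auto
qed (rule C2_lincomb)

lemma C2c_mult: "C2 f \<Longrightarrow> C2c g \<Longrightarrow> C2c (\<lambda>x. f x * g x)"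
  unfolding C2c_def by (auto intro: C2_mult)

text \<open>Two mean value steps along the segment from \<open>x\<close> to \<open>x + z\<close>,
  with \<open>g1\<close> and \<open>g2\<close> the first and second derivatives in direction
  \<open>z\<close>. Bounding the intermediate \<open>s\<close> by 1 loses the usual factor 1/2,
  which is immaterial.\<close>

lemma C2_taylor:
  fixes f :: "real^'d::finite \<Rightarrow> real" and B :: real
  assumes C: "C2 f" and B: "\<And>k l x. \<bar>partial_deriv k (partial_deriv l f) x\<bar> \<le> B"
  shows "\<bar>f (x + z) - f x - grad f x \<bullet> z\<bar> \<le> (CARD('d))\<^sup>2 * B * (norm z)\<^sup>2"
proof -
  define g1 where "g1 t = (\<Sum>k\<in>UNIV. partial_deriv k f (x + t *\<^sub>R z) * z $ k)" for t
  define g2 where "g2 t = (\<Sum>k\<in>UNIV. (\<Sum>l\<in>UNIV. partial_deriv l (partial_deriv k f) (x + t *\<^sub>R z) * z $ l) * z $ k)" for t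
  have aff: "((\<lambda>t. x + t *\<^sub>R z) has_derivative (\<lambda>h. h *\<^sub>R z)) (at t)" for t
    by (auto intro!: derivative_eq_intros)
  have 1: "((\<lambda>t. f (x + t *\<^sub>R z)) has_real_derivative g1 t) (at t)" for t
    unfolding has_field_derivative_def
    by (rule has_derivative_eq_rhs, rule has_derivative_compose[OF aff C2_has_derivative[OF C]])
       (auto simp: g1_def sum_distrib_left fun_eq_iff algebra_simps)
  have 2: "(g1 has_real_derivative g2 t) (at t)" for t
    unfolding g1_def g2_def
  proof (intro DERIV_sum DERIV_cmult_right)
    fix k
    show "((\<lambda>t. partial_deriv k f (x + t *\<^sub>R z)) has_real_derivative
      (\<Sum>l\<in>UNIV. partial_deriv l (partial_deriv k f) (x + t *\<^sub>R z) * z $ l)) (at t)"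
      unfolding has_field_derivative_def
      by (rule has_derivative_eq_rhs, rule has_derivative_compose[OF aff C2_has_derivative2[OF C]])
         (auto simp: sum_distrib_left fun_eq_iff algebra_simps)
  qed
  have B0: "0 \<le> B" using B[of undefined undefined undefined] by linarith
  have g2: "\<bar>g2 t\<bar> \<le> (CARD('d))\<^sup>2 * B * (norm z)\<^sup>2" for t
  proof -
    have "\<bar>g2 t\<bar> \<le> (\<Sum>k\<in>(UNIV::'d set). \<Sum>l\<in>(UNIV::'d set). B * norm z * norm z)"
      unfolding g2_def sum_distrib_right
    proof (intro order_trans[OF sum_abs] sum_mono)
      fix k l
      show "\<bar>partial_deriv l (partial_deriv k f) (x + t *\<^sub>R z) * z $ l * z $ k\<bar> \<le> B * norm z * norm z"
        unfolding abs_mult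
        using B component_le_norm_cart[of z l] component_le_norm_cart[of z k] B0
        by (intro mult_mono) auto
    qed
    then show ?thesis by (simp add: power2_eq_square mult.assoc)
  qed
  obtain s where s: "0 < s" "s < 1" "f (x + 1 *\<^sub>R z) - f (x + 0 *\<^sub>R z) = (1 - 0) * g1 s"
    using MVT2[of 0 1 "\<lambda>t. f (x + t *\<^sub>R z)" g1] 1 by auto
  obtain r where r: "g1 s - g1 0 = (s - 0) * g2 r"
    using MVT2[of 0 s g1 g2] 2 s by auto
  have "\<bar>f (x + z) - f x - grad f x \<bullet> z\<bar> = s * \<bar>g2 r\<bar>"
    using s r by (simp add: grad_inner g1_def abs_mult)
  also have "\<dots> \<le> 1 * ((CARD('d))\<^sup>2 * B * (norm z)\<^sup>2)"
    using s g2[of r] by (intro mult_mono) auto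
  finally show ?thesis by simp
qed

section \<open>Convex cut-offs of class C2\<close>

definition cube_pos :: "real \<Rightarrow> real" where "cube_pos s = (max 0 s) ^ 3"

text \<open>The cube is the lowest integer power of the positive part that is of class C2. Only the
  point 0 needs an argument: there the difference quotient is dominated by a lower power, which
  tends to 0.\<close>

lemma cube_pos_deriv: "(cube_pos has_real_derivative 3 * (max 0 s)\<^sup>2) (at s)"
  and sq_pos_deriv: "((\<lambda>s. 3 * (max 0 s)\<^sup>2) has_real_derivative 6 * max 0 s) (at s)"
proof -
  \<comment> \<open>Exponents of at least 2 make the positive part differentiable at 0;
    \<open>n = 1\<close> serves the cube and \<open>n = 0\<close> its derivative.\<close>
  have *: "((\<lambda>s. (max 0 s) ^ Suc (Suc n)) has_real_derivative real (Suc (Suc n)) * (max 0 s) ^ Suc n) (at s)" for n s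
  proof (cases "s = 0")
    case False
    have "((\<lambda>s. if 0 < s then s ^ Suc (Suc n) else 0) has_real_derivative real (Suc (Suc n)) * (max 0 s) ^ Suc n) (at s)"
    proof (cases "s > 0")
      case True
      have "((\<lambda>s. s ^ Suc (Suc n)) has_real_derivative real (Suc (Suc n)) * (max 0 s) ^ Suc n) (at s)"
        using DERIV_pow[of "Suc (Suc n)" s UNIV] True by simp
      then show ?thesis
        by (rule has_field_derivative_transform_within_open[where S="{0<..}"]) (use True in auto)
    next
      case F: False
      have "((\<lambda>s. 0) has_real_derivative real (Suc (Suc n)) * (max 0 s) ^ Suc n) (at s)"
        using F by (auto intro!: derivative_eq_intros)
      then show ?thesis
        by (rule has_field_derivative_transform_within_open[where S="{..<0}"]) (use F False in auto)
    qed
    moreover have "(\<lambda>s::real. if 0 < s then s ^ Suc (Suc n) else 0) = (\<lambda>s. (max 0 s) ^ Suc (Suc n))"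
      by (auto simp: max_def)
    ultimately show ?thesis by simp
  next
    case True
    have "((\<lambda>h. (max 0 h) ^ Suc (Suc n) / h) \<longlongrightarrow> 0) (at (0::real))"
    proof (rule Lim_null_comparison)
      show "\<forall>\<^sub>F h in at (0::real). norm ((max 0 h) ^ Suc (Suc n) / h) \<le> (max 0 h) ^ Suc n"
        by (rule always_eventually) (auto simp: max_def)
      have "((\<lambda>h. (max 0 h) ^ Suc n) \<longlongrightarrow> (max 0 0) ^ Suc n) (at (0::real))"
        by (intro tendsto_intros)
      then show "((\<lambda>h. (max 0 h) ^ Suc n) \<longlongrightarrow> 0) (at (0::real))" by simp
    qed
    then show ?thesis using True by (simp add: DERIV_def)
  qed
  show "(cube_pos has_real_derivative 3 * (max 0 s)\<^sup>2) (at s)"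
    using *[of 1 s] by (simp add: cube_pos_def[abs_def] numeral_eq_Suc)
  show "((\<lambda>s. 3 * (max 0 s)\<^sup>2) has_real_derivative 6 * max 0 s) (at s)"
    using DERIV_cmult[OF *[of 0 s], of 3] by (simp add: numeral_eq_Suc)
qed

lemma cube_pos_nonneg [simp]: "0 \<le> cube_pos s" by (simp add: cube_pos_def)

lemma cube_pos_eq_0: "s \<le> 0 \<Longrightarrow> cube_pos s = 0" by (simp add: cube_pos_def)

lemma cube_pos_mono: "s \<le> t \<Longrightarrow> cube_pos s \<le> cube_pos t"
  unfolding cube_pos_def by (intro power_mono) auto

text \<open>Convexity in tangent form compares two arbitrary points, so it applies to jumps of any
  size. For \<open>s \<le> 0\<close> the slope is 0; otherwise replacing \<open>t\<close> by its
  positive part only enlarges the left side, and the remaining gap is a square times a nonnegative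
  factor.\<close>

lemma cube_pos_convex: "3 * (max 0 s)\<^sup>2 * (t - s) \<le> cube_pos t - cube_pos s"
proof -
  define p q where "p = max 0 s" and "q = max 0 t"
  have pq: "0 \<le> p" "0 \<le> q" by (auto simp: p_def q_def)
  have "3 * p\<^sup>2 * (t - s) \<le> 3 * p\<^sup>2 * (q - p)"
  proof (cases "s \<le> 0")
    case False
    then show ?thesis by (intro mult_left_mono) (auto simp: p_def q_def)
  qed (simp add: p_def)
  also have "\<dots> \<le> q^3 - p^3"
  proof -
    have "q^3 - p^3 - 3 * p\<^sup>2 * (q - p) = (q - p)\<^sup>2 * (q + 2 * p)" by algebra
    moreover have "\<dots> \<ge> 0" using pq by simp
    ultimately show ?thesis by linarith
  qed
  finally show ?thesis by (simp add: p_def q_def cube_pos_def)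
qed

lemma C2_cube_pos:
  fixes g :: "real^'d::finite \<Rightarrow> real"
  assumes g: "C2 g"
  shows "C2 (\<lambda>x. cube_pos (g x))"
    and "partial_deriv k (\<lambda>x. cube_pos (g x)) = (\<lambda>x. 3 * (max 0 (g x))\<^sup>2 * partial_deriv k g x)"
    and "partial_deriv l (partial_deriv k (\<lambda>x. cube_pos (g x))) =
      (\<lambda>x. 6 * max 0 (g x) * (partial_deriv l g x * partial_deriv k g x)
         + 3 * (max 0 (g x))\<^sup>2 * partial_deriv l (partial_deriv k g) x)"
proof -
  have c: "continuous_on UNIV (\<lambda>s::real. 6 * max 0 s)" by (intro continuous_intros)
  note * = C2_compose[OF g cube_pos_deriv sq_pos_deriv c]
  show "C2 (\<lambda>x. cube_pos (g x))" by (rule *)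
  show "partial_deriv k (\<lambda>x. cube_pos (g x)) = (\<lambda>x. 3 * (max 0 (g x))\<^sup>2 * partial_deriv k g x)"
    by (rule *)
  show "partial_deriv l (partial_deriv k (\<lambda>x. cube_pos (g x))) =
      (\<lambda>x. 6 * max 0 (g x) * (partial_deriv l g x * partial_deriv k g x)
         + 3 * (max 0 (g x))\<^sup>2 * partial_deriv l (partial_deriv k g) x)" by (rule *)
qed

lemma C2_const: "C2 (\<lambda>x::real^'d::finite. c)"
  by (rule C2I_C2[of _ "\<lambda>_ _. 0" "\<lambda>_ _ _. 0"]) auto

text \<open>The squared norm avoids a kink at the origin. For \<open>0 \<le> r\<close> the inner
  \<open>cube_pos\<close> is 0 up to radius \<open>r\<close> and at least 1 from radius
  \<open>r + 1\<close> on, because (r + 1)^2 - r^2 \<ge> 1; the outer one turns this into the values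
  1 and 0.\<close>

definition cutoff :: "real \<Rightarrow> real^'d::finite \<Rightarrow> real" where
  "cutoff r x = cube_pos (1 - cube_pos ((norm x)\<^sup>2 - r\<^sup>2))"

lemma cutoff_C2: "C2 (cutoff r)"
proof -
  have "C2 (\<lambda>x::real^'d. 1 * (norm (x - 0))\<^sup>2 + (- r\<^sup>2) * 1)"
    by (intro C2_lincomb C2_sqdist C2_const)
  then have "C2 (\<lambda>x::real^'d. cube_pos ((norm x)\<^sup>2 - r\<^sup>2))"
    using C2_cube_pos(1) by force
  then have "C2 (\<lambda>x::real^'d. 1 * 1 + (-1) * cube_pos ((norm x)\<^sup>2 - r\<^sup>2))"
    by (intro C2_lincomb C2_const)
  then show ?thesis
    using C2_cube_pos(1) unfolding cutoff_def[abs_def] by force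
qed

lemma cutoff_one: "norm x \<le> r \<Longrightarrow> cutoff r x = 1"
  by (simp add: cutoff_def cube_pos_eq_0 power_mono) (simp add: cube_pos_def)

lemma cutoff_zero:
  assumes "0 \<le> r" "r + 1 \<le> norm x" shows "cutoff r x = 0"
proof -
  have "(r + 1)\<^sup>2 \<le> (norm x)\<^sup>2" using assms by (intro power_mono) auto
  then have "1 \<le> (norm x)\<^sup>2 - r\<^sup>2" using assms by (simp add: power2_eq_square algebra_simps)
  then have "1 \<le> cube_pos ((norm x)\<^sup>2 - r\<^sup>2)" by (simp add: cube_pos_def)
  then show ?thesis by (simp add: cutoff_def cube_pos_eq_0)
qed

lemma cutoff_C2c: "0 \<le> r \<Longrightarrow> C2c (cutoff r)"
  unfolding C2c_def using cutoff_C2 cutoff_zero by blast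

lemma cutoff_nonneg: "0 \<le> cutoff r x" by (simp add: cutoff_def)

lemma cutoff_le_1: "cutoff r x \<le> 1"
  using cube_pos_mono[of "1 - cube_pos ((norm x)\<^sup>2 - r\<^sup>2)" 1] by (simp add: cutoff_def) (simp add: cube_pos_def)

text \<open>Makes the difference of two truncations of a nonnegative \<open>V\<close>
  nonnegative.\<close>

lemma cutoff_mono: "0 \<le> r \<Longrightarrow> r \<le> s \<Longrightarrow> cutoff r x \<le> cutoff s x"
  unfolding cutoff_def by (intro cube_pos_mono diff_left_mono diff_left_mono power_mono) (auto intro: power_mono)

subsection \<open>Bounds for the generator\<close>

context regime_switching_jump_diffusion
begin

definition local_op :: "(real^'d \<Rightarrow> real) \<Rightarrow> real^'d \<Rightarrow> 'm \<Rightarrow> real" where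
  "local_op g x i =
     1/2 * (\<Sum>k\<in>UNIV. \<Sum>l\<in>UNIV. diff_matrix \<sigma> x i $ k $ l * partial_deriv k (partial_deriv l g) x)
     + (\<Sum>k\<in>UNIV. b x i $ k * partial_deriv k g x)"

lemma generator_split:
  "generator b \<sigma> \<pi> Q f x i =
     local_op (f i) x i + (LINT z|\<pi> i x. jump_increment (f i) x z) + (\<Sum>j\<in>UNIV. Q x $ i $ j * f j x)"
  by (simp add: generator_def local_op_def)

section \<open>Jump integrals and the switching term\<close>

lemma sets_\<pi> [measurable_cong, simp]: "sets (\<pi> i x) = sets borel"
  using jump_measure[of i x] by (simp add: jump_measure_def)

lemma space_\<pi> [simp]: "space (\<pi> i x) = UNIV"
  using sets_eq_imp_space_eq[OF sets_\<pi>] by simp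

text \<open>On a ball all \<open>\<pi> i x\<close> lie below one measure from
  \<open>local_domination\<close>, and the integral is monotone in the measure. The weight
  \<open>min 1 ((norm z)\<^sup>2)\<close> is the yardstick for the jump estimates that
  follow.\<close>

lemma jump_mass_bounded:
  obtains J where "0 \<le> J" "\<And>x i. norm x < r \<Longrightarrow> integrable (\<pi> i x) (\<lambda>z. min 1 ((norm z)\<^sup>2))"
    "\<And>x i. norm x < r \<Longrightarrow> (LINT z|\<pi> i x. min 1 ((norm z)\<^sup>2)) \<le> J"
proof -
  obtain n0 :: nat where "max 1 r \<le> real n0"
    using real_arch_simple by blast
  then have n: "n0 \<ge> 1" "r \<le> real n0" by auto
  obtain \<nu> where \<nu>: "jump_measure \<nu>"
    and dom: "\<And>x i A. x \<in> ball 0 (real n0) \<Longrightarrow> A \<in> sets borel \<Longrightarrow> emeasure (\<pi> i x) A \<le> emeasure \<nu> A"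
    using local_domination[OF n(1)] by blast
  define J where "J = (\<integral>\<^sup>+z. ennreal (min 1 ((norm z)\<^sup>2)) \<partial>\<nu>)"
  have J: "J < \<infinity>" using \<nu> by (simp add: jump_measure_def J_def)
  have le: "(\<integral>\<^sup>+z. ennreal (min 1 ((norm z)\<^sup>2)) \<partial>\<pi> i x) \<le> J" if "norm x < r" for x i
    unfolding J_def
  proof (rule nn_integral_mono_measure)
    show s: "sets (\<pi> i x) = sets \<nu>" using \<nu> by (simp add: jump_measure_def)
    show "\<pi> i x \<le> \<nu>"
      unfolding le_measure[OF s]
      using dom[of x] that n by auto
  qed
  have int: "integrable (\<pi> i x) (\<lambda>z. min 1 ((norm z)\<^sup>2))" if "norm x < r" for x i
    using le[OF that, of i] J by (intro integrableI_nonneg) auto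
  show thesis
  proof (rule that[of "enn2real J"])
    show "(LINT z|\<pi> i x. min 1 ((norm z)\<^sup>2)) \<le> enn2real J" if "norm x < r" for x i
    proof -
      have "ennreal (LINT z|\<pi> i x. min 1 ((norm z)\<^sup>2)) \<le> J"
        using le[OF that, of i] nn_integral_eq_integral[OF int[OF that, of i]] by simp
      then have "enn2real (ennreal (LINT z|\<pi> i x. min 1 ((norm z)\<^sup>2))) \<le> enn2real J"
        using J by (intro enn2real_mono) auto
      moreover have "0 \<le> (LINT z|\<pi> i x. min 1 ((norm z)\<^sup>2))"
        by (rule integral_nonneg_AE) auto
      ultimately show ?thesis by simp
    qed
  qed (use int in auto)
qed

lemma min_sq_integrable: "integrable (\<pi> i x) (\<lambda>z. min 1 ((norm z)\<^sup>2))"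
  by (rule jump_mass_bounded[of "norm x + 1"]) simp

text \<open>If the increment is not integrable, the integral has the default value 0, which still
  respects a nonpositive lower bound. Hence lower estimates can be made without a separate proof of
  integrability.\<close>

lemma jump_integral_lower:
  assumes "0 \<le> c" "\<And>z. - c * min 1 ((norm z)\<^sup>2) \<le> jump_increment g x z"
  shows "- c * (LINT z|\<pi> i x. min 1 ((norm z)\<^sup>2)) \<le> (LINT z|\<pi> i x. jump_increment g x z)"
proof (cases "integrable (\<pi> i x) (jump_increment g x)")
  case True
  have "(LINT z|\<pi> i x. - c * min 1 ((norm z)\<^sup>2)) \<le> (LINT z|\<pi> i x. jump_increment g x z)"
    by (intro integral_mono True integrable_mult_right min_sq_integrable assms)
  then show ?thesis by simp
next
  case False
  then have "(LINT z|\<pi> i x. jump_increment g x z) = 0"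
    by (rule not_integrable_integral_eq)
  moreover have "0 \<le> (LINT z|\<pi> i x. min 1 ((norm z)\<^sup>2))"
    by (rule integral_nonneg_AE) auto
  ultimately show ?thesis using assms(1) by simp
qed

text \<open>Since rows of \<open>Q x\<close> sum to 0, a part \<open>c\<close> common to all regimes
  is invisible to switching; only the bump in the regime \<open>l\<close> is felt.\<close>

lemma switching_sum_bump:
  "(\<Sum>j\<in>UNIV. Q x $ i $ j * (c + M * (if j = l then g else 0))) = Q x $ i $ l * (M * g)" for l :: 'm
proof -
  have "(\<Sum>j\<in>UNIV. Q x $ i $ j * (c + M * (if j = l then g else 0))) =
     (\<Sum>j\<in>UNIV. Q x $ i $ j) * c + (\<Sum>j\<in>UNIV. if j = l then Q x $ i $ j * (M * g) else 0)"
    unfolding sum_distrib_right sum.distrib[symmetric] by (rule sum.cong) (auto simp: algebra_simps)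
  then show ?thesis by (simp add: Q_row_sum)
qed

section \<open>Gaussian bumps and composition with the convex cut-off\<close>

definition gauss :: "real \<Rightarrow> real^'d \<Rightarrow> real^'d \<Rightarrow> real" where
  "gauss \<mu> y x = exp (- \<mu> * (norm (x - y))\<^sup>2)"

lemma gauss_deriv:
  shows gauss_C2: "C2 (gauss \<mu> y)"
    and "partial_deriv k (gauss \<mu> y) = (\<lambda>x. gauss \<mu> y x * (- 2 * \<mu> * (x $ k - y $ k)))"
    and "partial_deriv m (partial_deriv k (gauss \<mu> y)) =
      (\<lambda>x. gauss \<mu> y x * (4 * \<mu>\<^sup>2 * ((x $ m - y $ m) * (x $ k - y $ k)) - (if m = k then 2 * \<mu> else 0)))"
proof -
  have 1: "((\<lambda>s. exp (- \<mu> * s)) has_real_derivative - \<mu> * exp (- \<mu> * s)) (at s)" for s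
    by (auto intro!: derivative_eq_intros)
  have 2: "((\<lambda>s. - \<mu> * exp (- \<mu> * s)) has_real_derivative \<mu>\<^sup>2 * exp (- \<mu> * s)) (at s)" for s
    by (auto intro!: derivative_eq_intros simp: power2_eq_square)
  have 3: "continuous_on UNIV (\<lambda>s. \<mu>\<^sup>2 * exp (- \<mu> * s))" by (intro continuous_intros)
  note * = C2_compose[OF C2_sqdist(1)[of y] 1 2 3]
  have g: "gauss \<mu> y = (\<lambda>x. exp (- \<mu> * (norm (x - y))\<^sup>2))" by (simp add: gauss_def[abs_def])
  show "C2 (gauss \<mu> y)" unfolding g by (rule *)
  show "partial_deriv k (gauss \<mu> y) = (\<lambda>x. gauss \<mu> y x * (- 2 * \<mu> * (x $ k - y $ k)))"
    unfolding g *(2) C2_sqdist by (simp add: fun_eq_iff)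
  show "partial_deriv m (partial_deriv k (gauss \<mu> y)) =
      (\<lambda>x. gauss \<mu> y x * (4 * \<mu>\<^sup>2 * ((x $ m - y $ m) * (x $ k - y $ k)) - (if m = k then 2 * \<mu> else 0)))"
    unfolding g unfolding *(3) unfolding C2_sqdist(3) unfolding C2_sqdist(2) by (auto simp: fun_eq_iff algebra_simps)
qed

lemma gauss_pos: "0 < gauss \<mu> y x" by (simp add: gauss_def)

lemma gauss_le_1: "0 \<le> \<mu> \<Longrightarrow> gauss \<mu> y x \<le> 1" by (simp add: gauss_def)

text \<open>A level of the bump corresponds to a radius; this is how thresholds become support radii
  of the cut-off bumps.\<close>

lemma gauss_le_iff: "0 < \<mu> \<Longrightarrow> 0 \<le> r \<Longrightarrow> gauss \<mu> y x \<le> exp (- \<mu> * r\<^sup>2) \<longleftrightarrow> r \<le> norm (x - y)"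
  by (simp add: gauss_def abs_le_square_iff[symmetric])

text \<open>Only \<open>exp s \<ge> 1 + s\<close> is used, so no second-order Taylor expansion is needed.\<close>

lemma gauss_jump:
  assumes "0 \<le> \<mu>"
  shows "- (gauss \<mu> y x * (\<mu> + 1)) * min 1 ((norm z)\<^sup>2) \<le> jump_increment (gauss \<mu> y) x z"
proof -
  let ?w = "gauss \<mu> y"
  have gr: "grad ?w x \<bullet> z = ?w x * (- 2 * \<mu> * ((x - y) \<bullet> z))"
    unfolding grad_inner gauss_deriv by (simp add: inner_vec_def sum_distrib_left algebra_simps)
  show ?thesis
  proof (cases "norm z < 1")
    case True
    then have m: "min 1 ((norm z)\<^sup>2) = (norm z)\<^sup>2" by (simp add: abs_square_le_1 min_absorb2)
    have "(norm (x + z - y))\<^sup>2 = (norm (x - y))\<^sup>2 + 2 * ((x - y) \<bullet> z) + (norm z)\<^sup>2"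
      by (simp add: power2_norm_eq_inner algebra_simps inner_commute)
    then have "- \<mu> * (norm (x + z - y))\<^sup>2 =
        - \<mu> * (norm (x - y))\<^sup>2 + (- 2 * \<mu> * ((x - y) \<bullet> z) - \<mu> * (norm z)\<^sup>2)"
      by (simp only:) (simp add: algebra_simps)
    then have "?w (x + z) = ?w x * exp (- 2 * \<mu> * ((x - y) \<bullet> z) - \<mu> * (norm z)\<^sup>2)"
      by (simp only: gauss_def exp_add)
    \<comment> \<open>The term linear in \<open>z\<close> in this bound cancels against the gradient
      compensator, which leaves a loss of \<mu> |z|^2 times \<open>?w x\<close>.\<close>
    also have "\<dots> \<ge> ?w x * (1 + (- 2 * \<mu> * ((x - y) \<bullet> z) - \<mu> * (norm z)\<^sup>2))"
      using gauss_pos[of \<mu> y x] by (intro mult_left_mono exp_ge_add_one_self) auto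
    finally have *: "?w x * (1 + (- 2 * \<mu> * ((x - y) \<bullet> z) - \<mu> * (norm z)\<^sup>2)) \<le> ?w (x + z)" .
    have "0 \<le> ?w x * (norm z)\<^sup>2" using gauss_pos[of \<mu> y x] by simp
    with * True show ?thesis
      by (simp add: jump_increment_def gr m algebra_simps)
  next
    \<comment> \<open>Long jumps have no compensator and land where the bump is nonnegative, so at
      most the value \<open>?w x\<close> is lost. The constant \<mu> + 1 covers both cases.\<close>
    case False
    then have "1 \<le> (norm z)\<^sup>2" by (simp add: one_le_power)
    then have m: "min 1 ((norm z)\<^sup>2) = 1" by (simp add: min_absorb1)
    have "0 \<le> ?w x * \<mu>" using gauss_pos[of \<mu> y x] assms by simp
    then show ?thesis
      using False gauss_pos[of \<mu> y "x + z"] by (simp add: jump_increment_def m algebra_simps)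
  qed
qed

text \<open>As a = \<sigma>\<sigma>', the form is a sum of squares. It gives the sign of the
  second-order term created by composing with a convex function.\<close>

lemma diff_matrix_psd: "0 \<le> (\<Sum>k\<in>UNIV. \<Sum>l\<in>UNIV. diff_matrix \<sigma> x i $ k $ l * (v $ k * v $ l))"
proof -
  have "(\<Sum>k\<in>UNIV. \<Sum>l\<in>UNIV. diff_matrix \<sigma> x i $ k $ l * (v $ k * v $ l)) =
     (\<Sum>k\<in>UNIV. \<Sum>l\<in>UNIV. \<Sum>m\<in>UNIV. (\<sigma> x i $ k $ m * v $ k) * (\<sigma> x i $ l $ m * v $ l))"
    by (simp add: diff_matrix_def matrix_matrix_mult_def transpose_def sum_distrib_right sum_distrib_left algebra_simps)
  also have "\<dots> = (\<Sum>m\<in>UNIV. \<Sum>k\<in>UNIV. \<Sum>l\<in>UNIV. (\<sigma> x i $ k $ m * v $ k) * (\<sigma> x i $ l $ m * v $ l))"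
    by (subst sum.swap[of _ _ "UNIV::'d set"], subst sum.swap) (rule refl)
  also have "\<dots> = (\<Sum>m\<in>UNIV. (\<Sum>k\<in>UNIV. \<sigma> x i $ k $ m * v $ k)\<^sup>2)"
    by (simp add: power2_eq_square sum_product)
  also have "\<dots> \<ge> 0" by (intro sum_nonneg) auto
  finally show ?thesis .
qed

lemma quadratic_form:
  "v \<bullet> (diff_matrix \<sigma> x i *v v) = (\<Sum>k\<in>UNIV. \<Sum>l\<in>UNIV. diff_matrix \<sigma> x i $ k $ l * (v $ k * v $ l))"
  by (simp add: inner_vec_def matrix_vector_mult_def sum_distrib_left algebra_simps)

text \<open>Only the quadratic form in \<open>x - y\<close> carries \<mu>^2; trace and drift are
  linear in \<mu>. With ellipticity, a large \<mu> therefore makes the local part positive away from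
  \<open>y\<close>.\<close>

lemma local_op_gauss:
  "local_op (gauss \<mu> y) x i = gauss \<mu> y x * (2 * \<mu>\<^sup>2 * ((x - y) \<bullet> (diff_matrix \<sigma> x i *v (x - y)))
     - \<mu> * (\<Sum>k\<in>UNIV. diff_matrix \<sigma> x i $ k $ k) - 2 * \<mu> * (b x i \<bullet> (x - y)))"
proof -
  have *: "(\<Sum>k\<in>UNIV. \<Sum>l\<in>UNIV. diff_matrix \<sigma> x i $ k $ l * (if k = l then 2 * \<mu> else 0)) =
    2 * \<mu> * (\<Sum>k\<in>UNIV. diff_matrix \<sigma> x i $ k $ k)"
    by (simp add: if_distrib sum_distrib_left algebra_simps cong: if_cong)
  have "(\<Sum>k\<in>UNIV. \<Sum>l\<in>UNIV. diff_matrix \<sigma> x i $ k $ l * partial_deriv k (partial_deriv l (gauss \<mu> y)) x) =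
    gauss \<mu> y x * (4 * \<mu>\<^sup>2 * (\<Sum>k\<in>UNIV. \<Sum>l\<in>UNIV. diff_matrix \<sigma> x i $ k $ l * ((x-y) $ k * (x-y) $ l))
      - (\<Sum>k\<in>UNIV. \<Sum>l\<in>UNIV. diff_matrix \<sigma> x i $ k $ l * (if k = l then 2 * \<mu> else 0)))"
    unfolding gauss_deriv(3) sum_distrib_left sum_subtractf[symmetric]
    by (intro sum.cong refl) (auto simp: algebra_simps)
  moreover have "(\<Sum>k\<in>UNIV. b x i $ k * partial_deriv k (gauss \<mu> y) x) =
    gauss \<mu> y x * (- 2 * \<mu> * (b x i \<bullet> (x - y)))"
    unfolding gauss_deriv inner_vec_def sum_distrib_left
    by (intro sum.cong refl) (auto simp: algebra_simps)
  ultimately show ?thesis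
    unfolding local_op_def * quadratic_form by (simp add: algebra_simps)
qed

lemma local_op_lincomb:
  assumes "C2 f" "C2 g"
  shows "local_op (\<lambda>x. c * f x + d * g x) x i = c * local_op f x i + d * local_op g x i"
  unfolding local_op_def unfolding C2_lincomb(3)[OF assms] unfolding C2_lincomb(2)[OF assms]
  by (simp add: sum.distrib sum_distrib_left algebra_simps)

lemma jump_increment_lincomb:
  assumes "C2 f" "C2 g"
  shows "jump_increment (\<lambda>x. c * f x + d * g x) x z = c * jump_increment f x z + d * jump_increment g x z"
  unfolding jump_increment_def grad_inner C2_lincomb[OF assms]
  by (simp add: sum.distrib sum_distrib_left algebra_simps)

text \<open>In the chain rule the second derivative of the convex function multiplies the quadratic
  form of the gradient of \<open>g\<close>; this nonnegative term is dropped, and the slope times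
  \<open>local_op g\<close> remains.\<close>

lemma local_op_cube_pos:
  assumes "C2 g"
  shows "3 * (max 0 (g x - K))\<^sup>2 * local_op g x i \<le> local_op (\<lambda>x. cube_pos (g x - K)) x i"
proof -
  have "C2 (\<lambda>x. 1 * g x + (-K) * 1)" by (intro C2_lincomb assms C2_const)
  then have u: "C2 (\<lambda>x. g x - K)" by simp
  have p: "partial_deriv k (\<lambda>x. g x - K) = partial_deriv k g" for k
    using C2_lincomb(2)[OF assms C2_const[of 1], of k 1 "-K"]
    by (simp add: fun_eq_iff partial_deriv_eq[OF has_derivative_const])
  have q: "0 \<le> 6 * max 0 (g x - K) * 
     (\<Sum>k\<in>UNIV. \<Sum>l\<in>UNIV. diff_matrix \<sigma> x i $ k $ l * (partial_deriv k g x * partial_deriv l g x))"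
    using diff_matrix_psd[of x i "\<chi> k. partial_deriv k g x"] by simp
  have s1: "(\<Sum>k\<in>UNIV. \<Sum>l\<in>UNIV. diff_matrix \<sigma> x i $ k $ l *
      (6 * max 0 (g x - K) * (partial_deriv k g x * partial_deriv l g x) + c * partial_deriv k (partial_deriv l g) x)) =
     6 * max 0 (g x - K) *
     (\<Sum>k\<in>UNIV. \<Sum>l\<in>UNIV. diff_matrix \<sigma> x i $ k $ l * (partial_deriv k g x * partial_deriv l g x))
     + c * (\<Sum>k\<in>UNIV. \<Sum>l\<in>UNIV. diff_matrix \<sigma> x i $ k $ l * partial_deriv k (partial_deriv l g) x)" for c
    unfolding sum_distrib_left sum.distrib[symmetric] by (intro sum.cong refl) (simp add: algebra_simps)
  have s2: "(\<Sum>k\<in>UNIV. b x i $ k * (c * partial_deriv k g x)) =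
      c * (\<Sum>k\<in>UNIV. b x i $ k * partial_deriv k g x)" for c
    unfolding sum_distrib_left by (intro sum.cong refl) simp
  have "local_op (\<lambda>x. cube_pos (g x - K)) x i = 1/2 * (6 * max 0 (g x - K) *
     (\<Sum>k\<in>UNIV. \<Sum>l\<in>UNIV. diff_matrix \<sigma> x i $ k $ l * (partial_deriv k g x * partial_deriv l g x)))
     + 3 * (max 0 (g x - K))\<^sup>2 * local_op g x i"
    unfolding local_op_def unfolding C2_cube_pos(3)[OF u] unfolding C2_cube_pos(2)[OF u] unfolding p
    unfolding s1 s2 by (simp only: distrib_left mult.assoc mult.left_commute[of "1/2"] add.assoc)
  with q show ?thesis by linarith
qed

text \<open>The tangent inequality pointwise in \<open>z\<close>: the compensator scales exactly by
  the slope, so the nonlocal part obeys the same comparison as the local one.\<close>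

lemma jump_increment_cube_pos:
  assumes "C2 g"
  shows "3 * (max 0 (g x - K))\<^sup>2 * jump_increment g x z \<le> jump_increment (\<lambda>x. cube_pos (g x - K)) x z"
proof -
  have "C2 (\<lambda>x. 1 * g x + (-K) * 1)" by (intro C2_lincomb assms C2_const)
  then have u: "C2 (\<lambda>x. g x - K)" by simp
  have p: "partial_deriv k (\<lambda>x. g x - K) = partial_deriv k g" for k
    using C2_lincomb(2)[OF assms C2_const[of 1], of k 1 "-K"]
    by (simp add: fun_eq_iff partial_deriv_eq[OF has_derivative_const])
  have "grad (\<lambda>x. cube_pos (g x - K)) x \<bullet> z = 3 * (max 0 (g x - K))\<^sup>2 * (grad g x \<bullet> z)"
    unfolding grad_inner C2_cube_pos[OF u] p by (simp add: sum_distrib_left algebra_simps)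
  then show ?thesis
    using cube_pos_convex[of "g x - K" "g (x + z) - K"]
    by (simp add: jump_increment_def algebra_simps)
qed

section \<open>Local bounds for the coefficients\<close>

lemma Q_uniformly_bounded:
  obtains q where "0 \<le> q" "\<And>x i j. \<bar>Q x $ i $ j\<bar> \<le> q"
proof -
  have "\<exists>c. \<forall>x. \<bar>Q x $ i $ j\<bar> \<le> c" for i j
    using Q_bounded[of i j] by (auto simp: bounded_iff)
  then obtain c where c: "\<And>i j x. \<bar>Q x $ i $ j\<bar> \<le> c i j" by metis
  have c0: "0 \<le> c i j" for i j using c[of undefined i j] by linarith
  show thesis
  proof (rule that[of "\<Sum>i\<in>UNIV. \<Sum>j\<in>UNIV. c i j"])
    show "0 \<le> (\<Sum>i\<in>UNIV. \<Sum>j\<in>UNIV. c i j)" by (intro sum_nonneg c0)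
    fix x i j
    have "c i j \<le> (\<Sum>j\<in>UNIV. c i j)" by (rule member_le_sum) (auto intro: c0)
    also have "\<dots> \<le> (\<Sum>i\<in>UNIV. \<Sum>j\<in>UNIV. c i j)"
      by (rule member_le_sum[of i UNIV "\<lambda>i. \<Sum>j\<in>UNIV. c i j"]) (auto intro: c0 sum_nonneg)
    finally show "\<bar>Q x $ i $ j\<bar> \<le> (\<Sum>i\<in>UNIV. \<Sum>j\<in>UNIV. c i j)" using c[where i=i and j=j and x=x] by linarith
  qed
qed

lemma drift_locally_bounded:
  obtains B where "0 \<le> B" "\<And>x i. norm x < r \<Longrightarrow> norm (b x i) \<le> B"
proof -
  have "\<exists>c. \<forall>x\<in>cball (0::real^'d) r. norm (b x i) \<le> c" for i
  proof -
    have "compact ((\<lambda>x. b x i) ` cball (0::real^'d) r)"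
      by (intro compact_continuous_image continuous_on_subset[OF b_continuous]) auto
    then show ?thesis using compact_imp_bounded by (fastforce simp: bounded_iff)
  qed
  then obtain c where c: "\<And>i x. x \<in> cball 0 r \<Longrightarrow> norm (b x i) \<le> c i" by metis
  show thesis
  proof (rule that[of "\<Sum>i\<in>UNIV. \<bar>c i\<bar>"])
    fix x :: "real^'d" and i :: 'm assume "norm x < r"
    then have "norm (b x i) \<le> \<bar>c i\<bar>" using c[of x i] by auto
    also have "\<dots> \<le> (\<Sum>i\<in>UNIV. \<bar>c i\<bar>)" by (rule member_le_sum) auto
    finally show "norm (b x i) \<le> (\<Sum>i\<in>UNIV. \<bar>c i\<bar>)" .
  qed (auto intro: sum_nonneg)
qed

lemma coefficient_bounds:
  assumes "0 < \<rho>"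
  obtains \<kappa> B where "0 < \<kappa>" "0 \<le> B"
    "\<And>x i v. x \<in> ball y \<rho> \<Longrightarrow> \<kappa> * (norm v)\<^sup>2 \<le> v \<bullet> (diff_matrix \<sigma> x i *v v)"
    "\<And>x i. x \<in> ball y \<rho> \<Longrightarrow> (\<Sum>k\<in>UNIV. diff_matrix \<sigma> x i $ k $ k) \<le> B"
    "\<And>x i. x \<in> ball y \<rho> \<Longrightarrow> \<bar>b x i \<bullet> (x - y)\<bar> \<le> B"
    "\<And>x i. x \<in> ball y \<rho> \<Longrightarrow> (LINT z|\<pi> i x. min 1 ((norm z)\<^sup>2)) \<le> B"
proof -
  have "bounded_domain (ball y \<rho>)" using assms by (auto simp: bounded_domain_def)
  from ellipticity[OF this] obtain \<kappa> where \<kappa>: "0 < \<kappa>"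
    and k: "\<forall>\<xi>. \<forall>x\<in>ball y \<rho>. \<forall>i. \<kappa> * (norm \<xi>)\<^sup>2 \<le> \<xi> \<bullet> (diff_matrix \<sigma> x i *v \<xi>) \<and>
        \<xi> \<bullet> (diff_matrix \<sigma> x i *v \<xi>) \<le> inverse \<kappa> * (norm \<xi>)\<^sup>2" by blast
  from k have lo: "\<And>\<xi> x i. x \<in> ball y \<rho> \<Longrightarrow> \<kappa> * (norm \<xi>)\<^sup>2 \<le> \<xi> \<bullet> (diff_matrix \<sigma> x i *v \<xi>)"
    and up: "\<And>\<xi> x i. x \<in> ball y \<rho> \<Longrightarrow> \<xi> \<bullet> (diff_matrix \<sigma> x i *v \<xi>) \<le> inverse \<kappa> * (norm \<xi>)\<^sup>2"
    by blast+
  have n: "norm x < norm y + \<rho>" if "x \<in> ball y \<rho>" for x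
    using that norm_triangle_sub[of x y] by (simp add: dist_norm norm_minus_commute)
  obtain B1 where B1: "0 \<le> B1" "\<And>x i. norm x < norm y + \<rho> \<Longrightarrow> norm (b x i) \<le> B1"
    by (rule drift_locally_bounded[of "norm y + \<rho>"]) (rule that)
  obtain J where J: "0 \<le> J" "\<And>x i. norm x < norm y + \<rho> \<Longrightarrow> (LINT z|\<pi> i x. min 1 ((norm z)\<^sup>2)) \<le> J"
    by (rule jump_mass_bounded[of "norm y + \<rho>"]) (rule that)
  define B where "B = CARD('d) * inverse \<kappa> + B1 * \<rho> + J"
  have p: "0 \<le> B1 * \<rho>" "0 \<le> CARD('d) * inverse \<kappa>" using B1 \<kappa> assms by auto
  show thesis
  proof (rule that[OF \<kappa> _ lo, of B])
    show "0 \<le> B" using p J by (simp add: B_def)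
    fix x i assume x: "x \<in> ball y \<rho>"
    \<comment> \<open>Testing the upper ellipticity bound on unit vectors bounds the diagonal
      entries, hence the trace.\<close>
    have "axis k 1 \<bullet> (diff_matrix \<sigma> x i *v axis k 1) = diff_matrix \<sigma> x i $ k $ k" for k
      by (simp add: inner_axis_axis matrix_vector_mult_basis column_def inner_axis')
    then have "diff_matrix \<sigma> x i $ k $ k \<le> inverse \<kappa>" for k
      using up[OF x, of "axis k 1" i] by simp
    then have "(\<Sum>k\<in>UNIV. diff_matrix \<sigma> x i $ k $ k) \<le> (\<Sum>k\<in>(UNIV::'d set). inverse \<kappa>)"
      by (rule sum_mono)
    then show "(\<Sum>k\<in>UNIV. diff_matrix \<sigma> x i $ k $ k) \<le> B" using p J by (simp add: B_def)
    have "\<bar>b x i \<bullet> (x - y)\<bar> \<le> norm (b x i) * norm (x - y)" by (rule Cauchy_Schwarz_ineq2)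
    also have "\<dots> \<le> B1 * \<rho>"
      using x by (intro mult_mono B1 n) (auto simp: dist_norm norm_minus_commute B1)
    finally show "\<bar>b x i \<bullet> (x - y)\<bar> \<le> B" using p J by (simp add: B_def)
    show "(LINT z|\<pi> i x. min 1 ((norm z)\<^sup>2)) \<le> B" using J(2)[OF n[OF x], of i] p by (simp add: B_def)
  qed
qed

text \<open>\<open>F\<close> is a convex function of \<open>w\<close>, and \<open>c x\<close> is its
  slope at \<open>w x\<close>. Where the slope vanishes both parts are nonnegative. In general they
  are at least \<open>c x\<close> times the lower bound for the plain bump; the factor 4 \<mu> + 1
  adds \<mu> from the trace, 2 \<mu> from the drift and \<mu> + 1 from the jumps.\<close>

lemma gauss_bump_lower:
  fixes K1 K2 \<beta> \<mu> y
  defines "w \<equiv> gauss \<mu> y"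
  defines "F \<equiv> \<lambda>x. 1 * cube_pos (w x - K1) + \<beta> * cube_pos (w x - K2)"
  defines "c \<equiv> \<lambda>x. 3 * (max 0 (w x - K1))\<^sup>2 + \<beta> * (3 * (max 0 (w x - K2))\<^sup>2)"
  assumes "0 \<le> \<beta>" "0 \<le> \<mu>"
  shows gauss_bump_C2: "C2 F"
    and gauss_bump_lower0: "c x = 0 \<Longrightarrow> 0 \<le> local_op F x i + (LINT z|\<pi> i x. jump_increment F x z)"
    and gauss_bump_lower1: "\<kappa> * (norm (x - y))\<^sup>2 \<le> (x - y) \<bullet> (diff_matrix \<sigma> x i *v (x - y)) \<Longrightarrow>
       (\<Sum>k\<in>UNIV. diff_matrix \<sigma> x i $ k $ k) \<le> B \<Longrightarrow> \<bar>b x i \<bullet> (x - y)\<bar> \<le> B \<Longrightarrow>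
       (LINT z|\<pi> i x. min 1 ((norm z)\<^sup>2)) \<le> B \<Longrightarrow>
       c x * w x * (2 * \<mu>\<^sup>2 * (\<kappa> * (norm (x - y))\<^sup>2) - B * (4 * \<mu> + 1))
         \<le> local_op F x i + (LINT z|\<pi> i x. jump_increment F x z)"
proof -
  have w: "C2 w" unfolding w_def by (rule gauss_C2)
  have u: "C2 (\<lambda>x. cube_pos (w x - K))" for K
  proof -
    have "C2 (\<lambda>x. 1 * w x + (-K) * 1)" by (intro C2_lincomb w C2_const)
    then show ?thesis using C2_cube_pos(1)[of "\<lambda>x. w x - K"] by simp
  qed
  show "C2 F" unfolding F_def by (intro C2_lincomb u)
  have c0: "0 \<le> c x" for x unfolding c_def using assms by simp
  have L: "c x * local_op w x i \<le> local_op F x i" for x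
  proof -
    have "local_op F x i = 1 * local_op (\<lambda>x. cube_pos (w x - K1)) x i + \<beta> * local_op (\<lambda>x. cube_pos (w x - K2)) x i"
      unfolding F_def by (rule local_op_lincomb[OF u u])
    then show ?thesis
      using local_op_cube_pos[OF w, of x K1] mult_left_mono[OF local_op_cube_pos[OF w, of x K2] \<open>0 \<le> \<beta>\<close>]
      by (simp add: c_def distrib_right add_mono mult.assoc)
  qed
  have Jz: "c x * jump_increment w x z \<le> jump_increment F x z" for x z
  proof -
    have "jump_increment F x z = 1 * jump_increment (\<lambda>x. cube_pos (w x - K1)) x z + \<beta> * jump_increment (\<lambda>x. cube_pos (w x - K2)) x z"
      unfolding F_def by (rule jump_increment_lincomb[OF u u])
    then show ?thesis
      using jump_increment_cube_pos[OF w, of x K1] mult_left_mono[OF jump_increment_cube_pos[OF w, of x K2] \<open>0 \<le> \<beta>\<close>]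
      by (simp add: c_def distrib_right add_mono mult.assoc)
  qed
  show "0 \<le> local_op F x i + (LINT z|\<pi> i x. jump_increment F x z)" if "c x = 0"
    using L[of x] Jz[of x] that by (auto intro!: add_nonneg_nonneg integral_nonneg_AE)
  have w0: "0 \<le> w x" using gauss_pos[of \<mu> y x] by (simp add: w_def)
  have J: "- (c x * w x * (\<mu> + 1)) * (LINT z|\<pi> i x. min 1 ((norm z)\<^sup>2)) \<le> (LINT z|\<pi> i x. jump_increment F x z)"
  proof (rule jump_integral_lower)
    show "0 \<le> c x * w x * (\<mu> + 1)" using c0 w0 assms by simp
    fix z
    have "c x * (- (w x * (\<mu> + 1)) * min 1 ((norm z)\<^sup>2)) \<le> c x * jump_increment w x z"
      unfolding w_def by (intro mult_left_mono gauss_jump c0 assms)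
    also have "\<dots> \<le> jump_increment F x z" by (rule Jz)
    finally show "- (c x * w x * (\<mu> + 1)) * min 1 ((norm z)\<^sup>2) \<le> jump_increment F x z"
      by (simp add: algebra_simps)
  qed
  show "c x * w x * (2 * \<mu>\<^sup>2 * (\<kappa> * (norm (x - y))\<^sup>2) - B * (4 * \<mu> + 1))
         \<le> local_op F x i + (LINT z|\<pi> i x. jump_increment F x z)"
    if a: "\<kappa> * (norm (x - y))\<^sup>2 \<le> (x - y) \<bullet> (diff_matrix \<sigma> x i *v (x - y))"
      "(\<Sum>k\<in>UNIV. diff_matrix \<sigma> x i $ k $ k) \<le> B" "\<bar>b x i \<bullet> (x - y)\<bar> \<le> B"
      "(LINT z|\<pi> i x. min 1 ((norm z)\<^sup>2)) \<le> B"
  proof -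
    let ?A = "(x - y) \<bullet> (diff_matrix \<sigma> x i *v (x - y))" and ?T = "\<Sum>k\<in>UNIV. diff_matrix \<sigma> x i $ k $ k"
      and ?J = "LINT z|\<pi> i x. min 1 ((norm z)\<^sup>2)"
    have 1: "2 * \<mu>\<^sup>2 * (\<kappa> * (norm (x - y))\<^sup>2) \<le> 2 * \<mu>\<^sup>2 * ?A" using a(1) by (intro mult_left_mono) auto
    have 2: "\<mu> * ?T \<le> \<mu> * B" using a(2) assms by (intro mult_left_mono) auto
    have 3: "2 * \<mu> * (b x i \<bullet> (x - y)) \<le> 2 * \<mu> * B" using a(3) assms by (intro mult_left_mono) auto
    have 4: "(\<mu> + 1) * ?J \<le> (\<mu> + 1) * B" using a(4) assms by (intro mult_left_mono) auto
    have "c x * w x * (2 * \<mu>\<^sup>2 * (\<kappa> * (norm (x - y))\<^sup>2) - B * (4 * \<mu> + 1)) \<le>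
      c x * w x * (2 * \<mu>\<^sup>2 * ?A - \<mu> * ?T - 2 * \<mu> * (b x i \<bullet> (x - y)) - (\<mu> + 1) * ?J)"
      using 1 2 3 4 c0 w0 by (intro mult_left_mono) (auto simp: algebra_simps)
    also have "\<dots> = c x * local_op w x i + - (c x * w x * (\<mu> + 1)) * ?J"
      unfolding w_def local_op_gauss by (simp add: algebra_simps)
    also have "\<dots> \<le> local_op F x i + (LINT z|\<pi> i x. jump_increment F x z)"
      by (intro add_mono L J)
    finally show ?thesis .
  qed
qed

text \<open>\<open>f\<close> is a strict subsolution off \<open>ball y r \<times> {l}\<close>: the first bump of \<open>exp (- \<mu> |x - y|\<^sup>2)\<close> is a
  subsolution away from \<open>y\<close> when \<open>\<mu>\<close> is large, and near \<open>y\<close> the switching rate into \<open>l\<close> acts on the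
  second bump, which lives in the regime \<open>l\<close> only.\<close>

lemma test_function:
  assumes irr: "\<And>G. bounded_domain G \<Longrightarrow> strictly_irreducible Q G"
    and r: "0 < r"
  obtains f :: "'m \<Rightarrow> real^'d \<Rightarrow> real" and K m0
  where "\<And>j. C2c (f j)" "\<And>j x. 0 \<le> f j x" "0 \<le> K"
    "\<And>x i. f i x - K \<le> generator b \<sigma> \<pi> Q f x i"
    "\<And>x i. (x, i) \<notin> ball y r \<times> {l} \<Longrightarrow> f i x \<le> generator b \<sigma> \<pi> Q f x i"
    "0 < m0" "\<And>x i. x \<in> cball y R \<Longrightarrow> m0 \<le> f i x"
proof -
  \<comment> \<open>The radius of the support, beyond both the prescribed ball and the
    target.\<close>
  define \<rho> where "\<rho> = max R r + 1"
  have \<rho>: "0 < \<rho>" "R < \<rho>" "r < \<rho>" using r by (auto simp: \<rho>_def)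
  obtain \<kappa> B where \<kappa>: "0 < \<kappa>" and B: "0 \<le> B"
    and ell: "\<And>x i v. x \<in> ball y \<rho> \<Longrightarrow> \<kappa> * (norm v)\<^sup>2 \<le> v \<bullet> (diff_matrix \<sigma> x i *v v)"
    and tr: "\<And>x i. x \<in> ball y \<rho> \<Longrightarrow> (\<Sum>k\<in>UNIV. diff_matrix \<sigma> x i $ k $ k) \<le> B"
    and dr: "\<And>x i. x \<in> ball y \<rho> \<Longrightarrow> \<bar>b x i \<bullet> (x - y)\<bar> \<le> B"
    and ju: "\<And>x i. x \<in> ball y \<rho> \<Longrightarrow> (LINT z|\<pi> i x. min 1 ((norm z)\<^sup>2)) \<le> B"
    by (rule coefficient_bounds[OF \<rho>(1), of y]) (rule that)
  obtain q where q: "0 \<le> q" "\<And>x i j. \<bar>Q x $ i $ j\<bar> \<le> q"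
    by (rule Q_uniformly_bounded) (rule that)
  have "bounded_domain (ball y \<rho>)" using \<rho> by (auto simp: bounded_domain_def)
  \<comment> \<open>For \<open>i = l\<close> the claim is vacuous and 1 serves. Finiteness of the
    set of regimes then permits a common rate \<open>q0\<close>.\<close>
  from irr[OF this] have "\<exists>q0>0. \<forall>x\<in>ball y \<rho>. i \<noteq> l \<longrightarrow> q0 \<le> Q x $ i $ l" for i
    by (cases "i = l") (auto simp: strictly_irreducible_def intro: exI[of _ 1])
  then obtain q1 where q1: "\<And>i. 0 < q1 i" "\<And>i x. x \<in> ball y \<rho> \<Longrightarrow> i \<noteq> l \<Longrightarrow> q1 i \<le> Q x $ i $ l"
    by metis
  define q0 where "q0 = Min (range q1)"
  have "q0 \<le> q1 i" for i unfolding q0_def by (rule Min_le) auto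
  then have q0: "0 < q0" "\<And>i x. x \<in> ball y \<rho> \<Longrightarrow> i \<noteq> l \<Longrightarrow> q0 \<le> Q x $ i $ l"
    using q1 by (simp add: q0_def) (meson \<open>\<And>i. q0 \<le> q1 i\<close> order_trans q1(2))
  \<comment> \<open>The second bump lives in the ball of radius \<open>r\<close>; on the smaller
    ball of radius \<open>r0\<close> it is bounded below by \<open>\<chi>0\<close>, so that
    switching into \<open>l\<close> has a guaranteed gain there.\<close>
  define r0 where "r0 = r / 2"
  \<comment> \<open>Chosen so that from distance \<open>r0\<close> on the bracket of the lower bound
    is at least 1: with \<mu> \<ge> 1, the cost satisfies B (4 \<mu> + 1) + 1 \<le> \<mu> (5 B +
    1).\<close>
  define \<mu> where "\<mu> = max 1 ((5 * B + 1) / (2 * \<kappa> * r0\<^sup>2))"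
  have r0: "0 < r0" "r0 < r" using r by (auto simp: r0_def)
  have \<mu>: "1 \<le> \<mu>" "0 \<le> \<mu>" "0 < \<mu>" by (auto simp: \<mu>_def)
  have \<mu>_big: "1 \<le> 2 * \<mu>\<^sup>2 * (\<kappa> * r0\<^sup>2) - B * (4 * \<mu> + 1)"
  proof -
    have "(5 * B + 1) / (2 * \<kappa> * r0\<^sup>2) \<le> \<mu>" by (simp add: \<mu>_def)
    then have "5 * B + 1 \<le> \<mu> * (2 * \<kappa> * r0\<^sup>2)" using \<kappa> r0 by (simp add: pos_divide_le_eq)
    then have "\<mu> * (5 * B + 1) \<le> \<mu> * (\<mu> * (2 * \<kappa> * r0\<^sup>2))" using \<mu> by (intro mult_left_mono) auto
    moreover have "1 * (B + 1) \<le> \<mu> * (B + 1)" using \<mu> B by (intro mult_right_mono) auto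
    ultimately show ?thesis by (simp add: power2_eq_square algebra_simps)
  qed
  define w where "w = gauss \<mu> y"
  define K1 where "K1 = exp (- \<mu> * \<rho>\<^sup>2)"
  define K2 where "K2 = exp (- \<mu> * r\<^sup>2)"
  have K1: "w x \<le> K1 \<longleftrightarrow> \<rho> \<le> norm (x - y)" for x
    unfolding w_def K1_def using \<mu> \<rho> by (intro gauss_le_iff) auto
  have K2: "w x \<le> K2 \<longleftrightarrow> r \<le> norm (x - y)" for x
    unfolding w_def K2_def using \<mu> r by (intro gauss_le_iff) auto
  have w1: "0 < w x" "w x \<le> 1" for x using \<mu> by (auto simp: w_def gauss_pos gauss_le_1)
  have Kpos: "0 < K1" "0 < K2" by (auto simp: K1_def K2_def)
  define \<chi>0 where "\<chi>0 = cube_pos (exp (- \<mu> * r0\<^sup>2) - K2)"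
  have "r0\<^sup>2 < r\<^sup>2" using r0 by (intro power_strict_mono) auto
  then have \<chi>0: "0 < \<chi>0" using \<mu> by (auto simp: \<chi>0_def cube_pos_def K2_def)
  define A where "A = B * (4 * \<mu> + 1)"
  have A: "0 \<le> A" using B \<mu> by (simp add: A_def)
  \<comment> \<open>Near \<open>y\<close> the first bump loses at most 3 A, its slope and
    \<open>w\<close> being bounded by 3 and 1, and its value is at most 1. The switching gain q0 M
    \<chi>0 is tuned to cover both.\<close>
  define M where "M = (3 * A + 1) / (q0 * \<chi>0)"
  have M: "0 \<le> M" "q0 * (M * \<chi>0) = 3 * A + 1" using A q0 \<chi>0 by (auto simp: M_def)
  define f where "f = (\<lambda>i x. 1 * cube_pos (w x - K1) + (if i = l then M else 0) * cube_pos (w x - K2))"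
  define c where "c = (\<lambda>i x. 3 * (max 0 (w x - K1))\<^sup>2 + (if i = l then M else 0) * (3 * (max 0 (w x - K2))\<^sup>2))"
  have M': "0 \<le> (if i = l then M else 0)" for i using M by simp
  have C2: "C2 (f i)" for i
    unfolding f_def w_def by (rule gauss_bump_C2[OF M' \<mu>(2)])
  have low0: "0 \<le> local_op (f i) x i + (LINT z|\<pi> i x. jump_increment (f i) x z)" if "c i x = 0" for x i
    unfolding f_def w_def by (rule gauss_bump_lower0[OF M' \<mu>(2)]) (use that in \<open>simp add: c_def w_def\<close>)
  have low1: "c i x * w x * (2 * \<mu>\<^sup>2 * (\<kappa> * (norm (x - y))\<^sup>2) - A)
         \<le> local_op (f i) x i + (LINT z|\<pi> i x. jump_increment (f i) x z)" if "x \<in> ball y \<rho>" for x i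
    unfolding f_def w_def c_def A_def
    by (rule gauss_bump_lower1[OF M' \<mu>(2) ell[OF that] tr[OF that] dr[OF that] ju[OF that]])
  have sw: "(\<Sum>j\<in>UNIV. Q x $ i $ j * f j x) = Q x $ i $ l * (M * cube_pos (w x - K2))" for x i
    using switching_sum_bump[of x i "cube_pos (w x - K1)" M l "cube_pos (w x - K2)"]
    unfolding f_def by (simp add: if_distrib[of "\<lambda>c. c * _"] if_distrib[of "\<lambda>c. _ * c"] cong: if_cong)
  have gen: "generator b \<sigma> \<pi> Q f x i = local_op (f i) x i + (LINT z|\<pi> i x. jump_increment (f i) x z)
     + Q x $ i $ l * (M * cube_pos (w x - K2))" for x i
    unfolding generator_split sw ..
  have c0: "0 \<le> c i x" for i x using M by (simp add: c_def)
  have f0: "0 \<le> f i x" for i x using M by (simp add: f_def)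
  have cube1: "cube_pos (w x - K) \<le> 1" if "0 < K" for x K
    using cube_pos_mono[of "w x - K" 1] w1[of x] that by (simp add: cube_pos_def)
  have sq1: "(max 0 (w x - K))\<^sup>2 \<le> 1" if "0 < K" for x K
    using power_mono[of "max 0 (w x - K)" 1 2] w1[of x] that by simp
  have annulus: "c i x * w x \<le> local_op (f i) x i + (LINT z|\<pi> i x. jump_increment (f i) x z)"
    if x: "x \<in> ball y \<rho>" "r0 \<le> norm (x - y)" for x i
  proof -
    have "r0\<^sup>2 \<le> (norm (x - y))\<^sup>2" using x r0 by (intro power_mono) auto
    then have "2 * \<mu>\<^sup>2 * (\<kappa> * r0\<^sup>2) \<le> 2 * \<mu>\<^sup>2 * (\<kappa> * (norm (x - y))\<^sup>2)"
      using \<kappa> by (intro mult_left_mono) auto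
    then have "1 \<le> 2 * \<mu>\<^sup>2 * (\<kappa> * (norm (x - y))\<^sup>2) - A" using \<mu>_big unfolding A_def by linarith
    then have "c i x * w x * 1 \<le> c i x * w x * (2 * \<mu>\<^sup>2 * (\<kappa> * (norm (x - y))\<^sup>2) - A)"
      using c0 w1[of x] by (intro mult_left_mono) (auto simp: less_imp_le)
    then show ?thesis using low1[OF x(1), of i] by simp
  qed
  have everywhere: "- (3 + 3 * M) * A \<le> local_op (f i) x i + (LINT z|\<pi> i x. jump_increment (f i) x z)"
    if x: "x \<in> ball y \<rho>" for x i
  proof -
    have "c i x \<le> 3 * 1 + M * (3 * 1)"
      unfolding c_def using sq1 Kpos M by (intro add_mono mult_mono mult_left_mono) auto
    then have "c i x * w x \<le> (3 + 3 * M) * 1"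
      using w1[of x] M by (intro mult_mono) (auto simp: less_imp_le)
    then have "(c i x * w x) * A \<le> (3 + 3 * M) * 1 * A" using A by (rule mult_right_mono)
    moreover have "c i x * w x * (- A) \<le> c i x * w x * (2 * \<mu>\<^sup>2 * (\<kappa> * (norm (x - y))\<^sup>2) - A)"
      using c0 w1[of x] \<kappa> by (intro mult_left_mono) (auto simp: less_imp_le)
    ultimately show ?thesis using low1[OF x, of i] by (simp add: algebra_simps)
  qed
  \<comment> \<open>Since (w - K)^+ \<le> w, the bump is at most its slope times \<open>w\<close>.
    This turns the bound on the annulus into \<open>generator\<close> \<ge> \<open>f\<close> itself,
    not merely \<ge> 0.\<close>
  have cube_le: "cube_pos (w x - K) \<le> 3 * (max 0 (w x - K))\<^sup>2 * w x" if "0 < K" for x K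
  proof -
    have "cube_pos (w x - K) = (max 0 (w x - K))\<^sup>2 * max 0 (w x - K)"
      by (simp add: cube_pos_def numeral_eq_Suc mult.commute mult.left_commute)
    also have "\<dots> \<le> (3 * (max 0 (w x - K))\<^sup>2) * w x"
      using that w1[of x] by (intro mult_mono) auto
    finally show ?thesis .
  qed
  \<comment> \<open>Worst case inside the target: slope at most 3 + 3 M times the loss A, switching
    at most M q, and the value of \<open>f\<close> at most 1 + M.\<close>
  define K where "K = (3 + 3 * M) * A + M * q + (1 + M)"
  have K: "0 \<le> K" using A M q by (simp add: K_def)
  have off: "f i x \<le> generator b \<sigma> \<pi> Q f x i" if xi: "(x, i) \<notin> ball y r \<times> {l}" for x i
  proof (cases "x \<in> ball y \<rho>")
    case False
    then have "w x \<le> K1" by (simp add: K1 dist_norm norm_minus_commute)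
    moreover have "w x \<le> K2" using False \<rho> by (simp add: K2 dist_norm norm_minus_commute)
    ultimately have "f i x = 0" "c i x = 0" "cube_pos (w x - K2) = 0"
      by (auto simp: f_def c_def cube_pos_eq_0)
    then show ?thesis using low0 gen by simp
  next
    case True
    show ?thesis
    proof (cases "i = l")
      case l: True
      then have "r \<le> norm (x - y)" using xi by (simp add: dist_norm norm_minus_commute)
      then have *: "w x \<le> K2" "r0 \<le> norm (x - y)" using r0 by (simp_all add: K2)
      then have "f i x = cube_pos (w x - K1)" "cube_pos (w x - K2) = 0" "c i x = 3 * (max 0 (w x - K1))\<^sup>2"
        by (auto simp: f_def c_def cube_pos_eq_0)
      then show ?thesis using annulus[OF True *(2), of i] cube_le[OF Kpos(1), of x] gen by simp
    next
      \<comment> \<open>In the other regimes the second bump acts only through switching into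
        \<open>l\<close>, at a nonnegative rate. It can be discarded on the annulus and has to carry
        the estimate only near \<open>y\<close>.\<close>
      case nl: False
      then have fc: "f i x = cube_pos (w x - K1)" "c i x = 3 * (max 0 (w x - K1))\<^sup>2"
        by (auto simp: f_def c_def)
      have qn: "0 \<le> Q x $ i $ l" using Q_offdiag nl by simp
      show ?thesis
      proof (cases "r0 \<le> norm (x - y)")
        case r0: True
        have "0 \<le> Q x $ i $ l * (M * cube_pos (w x - K2))" using qn M by simp
        then show ?thesis using annulus[OF True r0, of i] cube_le[OF Kpos(1), of x] gen fc by simp
      next
        case near: False
        have "norm (x - y) < r0 \<Longrightarrow> exp (- \<mu> * r0\<^sup>2) \<le> w x"
          using gauss_le_iff[of \<mu> r0 y x] \<mu> r0 by (simp add: w_def)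
        then have "\<chi>0 \<le> cube_pos (w x - K2)"
          unfolding \<chi>0_def using near by (intro cube_pos_mono) auto
        then have "q0 * (M * \<chi>0) \<le> Q x $ i $ l * (M * cube_pos (w x - K2))"
          using q0 True nl M \<chi>0 qn by (intro mult_mono) auto
        moreover have "- (3 * A) \<le> local_op (f i) x i + (LINT z|\<pi> i x. jump_increment (f i) x z)"
        proof -
          have "c i x * w x \<le> 3 * 1"
            unfolding fc using sq1[OF Kpos(1), of x] w1[of x] by (intro mult_mono) auto
          then have "(c i x * w x) * A \<le> 3 * A" using A by (intro mult_right_mono) auto
          moreover have "c i x * w x * (- A) \<le> c i x * w x * (2 * \<mu>\<^sup>2 * (\<kappa> * (norm (x - y))\<^sup>2) - A)"
            using c0 w1[of x] \<kappa> by (intro mult_left_mono) (auto simp: less_imp_le)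
          ultimately show ?thesis using low1[OF True, of i] by simp
        qed
        ultimately show ?thesis
          using gen[of x i] M(2) fc(1) cube1[OF Kpos(1), of x] by linarith
      qed
    qed
  qed
  have on: "f i x - K \<le> generator b \<sigma> \<pi> Q f x i" for x i
  proof (cases "(x, i) \<in> ball y r \<times> {l}")
    case True
    then have x: "x \<in> ball y \<rho>" using \<rho> by auto
    have "\<bar>Q x $ i $ l * (M * cube_pos (w x - K2))\<bar> \<le> q * (M * 1)"
      unfolding abs_mult using q M cube1[OF Kpos(2), of x] by (intro mult_mono) auto
    moreover have "f i x \<le> 1 + M * 1"
      unfolding f_def using cube1 Kpos M by (intro add_mono mult_mono) auto
    ultimately show ?thesis using everywhere[OF x, of i] gen[of x i] by (simp add: K_def algebra_simps)
  next
    case False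
    then show ?thesis using off[OF False] K by simp
  qed
  \<comment> \<open>The value of the first bump at the edge of the prescribed ball;
    \<open>max 0 R\<close> keeps the definition sound for negative \<open>R\<close>.\<close>
  define m0 where "m0 = cube_pos (exp (- \<mu> * (max 0 R)\<^sup>2) - K1)"
  have "(max 0 R)\<^sup>2 < \<rho>\<^sup>2" using \<rho> by (intro power_strict_mono) auto
  then have m0: "0 < m0" using \<mu> by (auto simp: m0_def cube_pos_def K1_def)
  have m0_le: "m0 \<le> f i x" if "x \<in> cball y R" for x i
  proof -
    have "(norm (x - y))\<^sup>2 \<le> (max 0 R)\<^sup>2" using that by (intro power_mono) (auto simp: dist_norm norm_minus_commute)
    then have "exp (- \<mu> * (max 0 R)\<^sup>2) \<le> w x" using \<mu> by (simp add: w_def gauss_def)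
    then have "m0 \<le> cube_pos (w x - K1)" unfolding m0_def by (intro cube_pos_mono) auto
    then show ?thesis using M by (simp add: f_def add_increasing2)
  qed
  have C2c: "C2c (f i)" for i
    unfolding C2c_def
  proof (intro conjI C2 exI[of _ "norm y + \<rho>"] allI impI)
    fix x :: "real^'d" assume "norm y + \<rho> \<le> norm x"
    then have "\<rho> \<le> norm (x - y)" using norm_triangle_sub[of x y] by linarith
    then show "f i x = 0" using K1[of x] K2[of x] \<rho> by (simp add: f_def cube_pos_eq_0)
  qed
  show thesis by (rule that[OF C2c f0 K on off m0 m0_le])
qed

section \<open>Linearity and boundedness of the generator on compactly supported functions\<close>

lemma C2c_jump_bounds:
  fixes f :: "real^'d \<Rightarrow> real"
  assumes "C2c f"
  obtains C where "0 \<le> C" "\<And>x z. \<bar>jump_increment f x z\<bar> \<le> C * min 1 ((norm z)\<^sup>2)"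
proof -
  have b: "C2b f" using C2c_imp_C2b[OF assms] .
  then have C: "C2 f" by (simp add: C2b_def)
  obtain S where S: "\<And>x. \<bar>f x\<bar> \<le> S" using b by (auto simp: C2b_def bounded_iff)
  have "\<exists>B. \<forall>x. \<bar>partial_deriv k (partial_deriv l f) x\<bar> \<le> B" for k l
    using b by (auto simp: C2b_def bounded_iff)
  then obtain B where B: "\<And>k l x. \<bar>partial_deriv k (partial_deriv l f) x\<bar> \<le> B k l" by metis
  define B' where "B' = (\<Sum>k\<in>UNIV. \<Sum>l\<in>UNIV. B k l)"
  have B0: "0 \<le> B k l" for k l using B[where k=k and l=l and x=0] by linarith
  have B': "\<bar>partial_deriv k (partial_deriv l f) x\<bar> \<le> B'" for k l x
  proof -
    have "B k l \<le> (\<Sum>l\<in>UNIV. B k l)" by (rule member_le_sum) (auto intro: B0)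
    also have "\<dots> \<le> B'" unfolding B'_def
      by (rule member_le_sum[of k UNIV "\<lambda>k. \<Sum>l\<in>UNIV. B k l"]) (auto intro: B0 sum_nonneg)
    finally show ?thesis using B[where k=k and l=l and x=x] by linarith
  qed
  define C where "C = max (2 * S) ((CARD('d))\<^sup>2 * B')"
  have S0: "0 \<le> S" using S[of 0] by linarith
  show thesis
  proof (rule that[of C])
    show "0 \<le> C" using S0 by (simp add: C_def)
    fix x z
    show "\<bar>jump_increment f x z\<bar> \<le> C * min 1 ((norm z)\<^sup>2)"
    proof (cases "norm z < 1")
      case True
      then have m: "min 1 ((norm z)\<^sup>2) = (norm z)\<^sup>2" by (simp add: abs_square_le_1 min_absorb2)
      have "\<bar>jump_increment f x z\<bar> \<le> (CARD('d))\<^sup>2 * B' * (norm z)\<^sup>2"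
        using C2_taylor[OF C B', of x z] True by (simp add: jump_increment_def)
      also have "\<dots> \<le> C * (norm z)\<^sup>2" by (intro mult_right_mono) (auto simp: C_def)
      finally show ?thesis by (simp add: m)
    next
      case False
      then have "1 \<le> (norm z)\<^sup>2" by (simp add: one_le_power)
      then have m: "min 1 ((norm z)\<^sup>2) = 1" by (simp add: min_absorb1)
      show ?thesis using S[of x] S[of "x + z"] False by (auto simp: jump_increment_def m C_def)
    qed
  qed
qed

lemma jump_increment_measurable [measurable]:
  assumes "C2 f" shows "jump_increment f x \<in> borel_measurable borel"
proof -
  have [measurable]: "f \<in> borel_measurable borel"
    using C2_continuous[OF assms] by (rule borel_measurable_continuous_onI)
  have [measurable]: "open {z::real^'d. norm z < 1}"
    by (intro open_Collect_less continuous_intros)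
  then have [measurable]: "{z::real^'d. norm z < 1} \<in> sets borel" by simp
  show ?thesis unfolding jump_increment_def[abs_def] by measurable
qed

lemma C2c_jump_integrable:
  assumes "C2c f" shows "integrable (\<pi> i x) (jump_increment f x)"
proof -
  obtain C where C: "\<And>x z. \<bar>jump_increment f x z\<bar> \<le> C * min 1 ((norm z)\<^sup>2)"
    by (rule C2c_jump_bounds[OF assms]) (rule that)
  have "integrable (\<pi> i x) (\<lambda>z. C * min 1 ((norm z)\<^sup>2))"
    by (intro integrable_mult_right min_sq_integrable)
  then show ?thesis
  proof (rule Bochner_Integration.integrable_bound)
    show "AE z in \<pi> i x. norm (jump_increment f x z) \<le> norm (C * min 1 ((norm z)\<^sup>2))"
      unfolding real_norm_def by (intro AE_I2 order_trans[OF C abs_ge_self])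
    show "jump_increment f x \<in> borel_measurable (\<pi> i x)"
      using jump_increment_measurable[of f x] assms by (simp add: C2c_def cong: measurable_cong_sets)
  qed
qed

text \<open>Splitting the jump integral requires both increments to be integrable, which compact
  support provides.\<close>

lemma generator_lincomb:
  assumes f: "\<And>j. C2c (f j)" and g: "\<And>j. C2c (g j)"
  shows "generator b \<sigma> \<pi> Q (\<lambda>j x. c * f j x + d * g j x) x i =
     c * generator b \<sigma> \<pi> Q f x i + d * generator b \<sigma> \<pi> Q g x i"
proof -
  have C: "C2 (f i)" "C2 (g i)" using f g by (auto simp: C2c_def)
  have "(LINT z|\<pi> i x. jump_increment (\<lambda>x. c * f i x + d * g i x) x z) =
     c * (LINT z|\<pi> i x. jump_increment (f i) x z) + d * (LINT z|\<pi> i x. jump_increment (g i) x z)"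
    unfolding jump_increment_lincomb[OF C] using C2c_jump_integrable[OF f] C2c_jump_integrable[OF g]
    by simp
  then show ?thesis
    unfolding generator_split local_op_lincomb[OF C]
    by (simp add: sum.distrib sum_distrib_left algebra_simps)
qed

lemma local_op_continuous:
  assumes "C2 f" shows "continuous_on UNIV (\<lambda>x. local_op f x i)"
proof -
  have s: "continuous_on UNIV (\<lambda>x. \<sigma> x i $ k $ m)" for k m
    by (intro continuous_on_component sigma_continuous)
  have "continuous_on UNIV (\<lambda>x. diff_matrix \<sigma> x i $ k $ l)" for k l
    unfolding diff_matrix_def matrix_matrix_mult_def transpose_def
    by (auto intro!: continuous_intros s)
  moreover have "continuous_on UNIV (\<lambda>x. b x i $ k)" for k
    by (intro continuous_on_component b_continuous)
  ultimately show ?thesis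
    unfolding local_op_def
    by (intro continuous_on_add continuous_on_mult continuous_on_sum continuous_on_const
        C2_continuous2[OF assms] C2_continuous1[OF assms])
qed

text \<open>The local part has compact support and is continuous. For the jump part two regions are
  needed, because small jumps are controlled uniformly only on bounded sets: near the support the
  dominating measure applies, and far from it only jumps of length at least 1 can reach the support,
  whose mass \<open>big_jumps\<close> bounds globally.\<close>

lemma C2c_generator_bounded:
  assumes "\<And>j. C2c (f j)"
  obtains C where "\<And>x i. \<bar>generator b \<sigma> \<pi> Q f x i\<bar> \<le> C"
proof -
  have "\<exists>C. \<forall>x. \<bar>local_op (f i) x i\<bar> \<le> C" for i
  proof -
    obtain R where C: "C2 (f i)" and R: "\<And>x. R \<le> norm x \<Longrightarrow> f i x = 0"
      using assms[of i] by (auto simp: C2c_def)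
    have "bounded (range (\<lambda>x. local_op (f i) x i))"
      by (rule bounded_range_continuous_support[OF local_op_continuous[OF C], of R])
         (simp add: local_op_def partial_deriv_support[OF R])
    then show ?thesis by (auto simp: bounded_iff)
  qed
  moreover have "\<exists>C. \<forall>x. \<bar>LINT z|\<pi> i x. jump_increment (f i) x z\<bar> \<le> C" for i
  proof -
    obtain R where C: "C2 (f i)" and R: "\<And>x. R \<le> norm x \<Longrightarrow> f i x = 0"
      using assms[of i] by (auto simp: C2c_def)
    obtain C where C: "0 \<le> C" "\<And>x z. \<bar>jump_increment (f i) x z\<bar> \<le> C * min 1 ((norm z)\<^sup>2)"
      by (rule C2c_jump_bounds[OF assms]) (rule that)
    obtain J where J: "0 \<le> J" "\<And>x. norm x < R + 2 \<Longrightarrow> (LINT z|\<pi> i x. min 1 ((norm z)\<^sup>2)) \<le> J"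
      by (rule jump_mass_bounded[of "R + 2"]) (rule that)
    obtain S where S: "\<And>x. \<bar>f i x\<bar> \<le> S"
      using C2c_imp_C2b[OF assms, of i] by (auto simp: C2b_def bounded_iff)
    have S0: "0 \<le> S" using S[of 0] by linarith
    define T where "T = (SUP x. SUP i. emeasure (\<pi> i x) (- ball 0 1))"
    have T: "T < \<infinity>" using big_jumps by (simp add: T_def)
    have Tx: "emeasure (\<pi> i x) (- ball 0 1) \<le> T" for x
      unfolding T_def by (rule SUP_upper2[OF UNIV_I], rule SUP_upper2[OF UNIV_I]) (rule order_refl)
    have near: "\<bar>LINT z|\<pi> i x. jump_increment (f i) x z\<bar> \<le> C * J" if "norm x < R + 2" for x
    proof -
      have "\<bar>LINT z|\<pi> i x. jump_increment (f i) x z\<bar> \<le> (LINT z|\<pi> i x. C * min 1 ((norm z)\<^sup>2))"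
        by (rule integral_abs_bound_integral)
           (use C in \<open>auto intro!: C2c_jump_integrable[OF assms] min_sq_integrable\<close>)
      also have "\<dots> = C * (LINT z|\<pi> i x. min 1 ((norm z)\<^sup>2))" by simp
      also have "\<dots> \<le> C * J" using J(2)[OF that] C by (intro mult_left_mono) auto
      finally show ?thesis .
    qed
    \<comment> \<open>Beyond \<open>R + 1\<close> function and gradient vanish at \<open>x\<close>,
      and a jump shorter than 1 stays outside the support.\<close>
    have far: "\<bar>LINT z|\<pi> i x. jump_increment (f i) x z\<bar> \<le> S * enn2real T" if x: "R + 1 < norm x" for x
    proof -
      have e: "\<bar>jump_increment (f i) x z\<bar> \<le> S * indicator (- ball 0 1) z" for z
      proof -
        have "R < norm x" using x by simp
        then have g: "grad (f i) x \<bullet> z = 0" by (simp add: grad_inner partial_deriv_support[OF R])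
        have fx: "f i x = 0" using x by (intro R) simp
        show ?thesis
        proof (cases "norm z < 1")
          case True
          have "norm x \<le> norm (x + z) + norm z" using norm_triangle_ineq4[of "x + z" z] by simp
          then have "f i (x + z) = 0" using x True by (intro R) simp
          then show ?thesis using True by (simp add: jump_increment_def g fx)
        next
          case False
          then show ?thesis using S by (simp add: jump_increment_def g fx)
        qed
      qed
      have m: "emeasure (\<pi> i x) (- ball 0 1) < \<infinity>" using Tx[of x] T by (rule order.strict_trans1)
      have "\<bar>LINT z|\<pi> i x. jump_increment (f i) x z\<bar> \<le> (LINT z|\<pi> i x. S * indicator (- ball 0 1) z)"
        by (rule integral_abs_bound_integral)
           (use e m in \<open>auto intro!: C2c_jump_integrable[OF assms] integrable_mult_right integrable_real_indicator\<close>)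
      also have "\<dots> = S * measure (\<pi> i x) (- ball 0 1)" by simp
      also have "\<dots> \<le> S * enn2real T"
        unfolding measure_def using Tx[of x] T S0 by (intro mult_left_mono enn2real_mono) auto
      finally show ?thesis .
    qed
    show ?thesis
    proof (intro exI allI)
      fix x
      show "\<bar>LINT z|\<pi> i x. jump_increment (f i) x z\<bar> \<le> max (C * J) (S * enn2real T)"
        using near[of x] far[of x] by (cases "norm x < R + 2") auto
    qed
  qed
  moreover obtain q where q: "0 \<le> q" "\<And>x i j. \<bar>Q x $ i $ j\<bar> \<le> q"
    by (rule Q_uniformly_bounded) (rule that)
  moreover have "\<exists>S. \<forall>x. \<bar>f i x\<bar> \<le> S" for i
    using C2c_imp_C2b[OF assms, of i] by (auto simp: C2b_def bounded_iff)
  ultimately obtain C1 C2 S where C1: "\<And>i x. \<bar>local_op (f i) x i\<bar> \<le> C1 i"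
    and C2: "\<And>i x. \<bar>LINT z|\<pi> i x. jump_increment (f i) x z\<bar> \<le> C2 i"
    and S: "\<And>i x. \<bar>f i x\<bar> \<le> S i" by metis
  define C where "C = (\<lambda>i. C1 i + C2 i + (\<Sum>j\<in>UNIV. q * S j))"
  have le: "\<bar>generator b \<sigma> \<pi> Q f x i\<bar> \<le> C i" for x i
  proof -
    have "\<bar>\<Sum>j\<in>UNIV. Q x $ i $ j * f j x\<bar> \<le> (\<Sum>j\<in>UNIV. q * S j)"
      using q S by (intro order_trans[OF sum_abs] sum_mono) (auto simp: abs_mult intro!: mult_mono)
    then show ?thesis
      unfolding generator_split C_def using C1[of i x] C2[of i x] by linarith
  qed
  have C0: "0 \<le> C i" for i using le[of 0 i] by linarith
  show thesis
  proof (rule that[of "\<Sum>i\<in>UNIV. C i"])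
    fix x i
    have "C i \<le> (\<Sum>i\<in>UNIV. C i)" by (rule member_le_sum) (auto intro: C0)
    then show "\<bar>generator b \<sigma> \<pi> Q f x i\<bar> \<le> (\<Sum>i\<in>UNIV. C i)" using le[of x i] by linarith
  qed
qed

end

subsection \<open>The path space and hitting times\<close>

lemma space_state_algebra [simp]: "space state_algebra = UNIV"
  by (simp add: state_algebra_def space_pair_measure)

lemma space_path_algebra [simp]: "space path_algebra = skorohod_paths"
  by (auto simp: path_algebra_def space_restrict_space space_PiM PiE_def skorohod_paths_def)

lemma space_history [simp]: "space (history t) = skorohod_paths"
  by (simp add: history_def)

lemma coordinate_measurable_path:
  assumes "0 \<le> t" shows "(\<lambda>\<omega>. \<omega> t) \<in> path_algebra \<rightarrow>\<^sub>M state_algebra"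
  unfolding path_algebra_def
  by (rule measurable_restrict_space1, rule measurable_component_singleton) (use assms in simp)

lemma coordinate_measurable_history:
  assumes "0 \<le> s" "s \<le> t" shows "(\<lambda>\<omega>. \<omega> s) \<in> history t \<rightarrow>\<^sub>M state_algebra"
proof -
  have "(\<lambda>\<omega>. restrict \<omega> {0..t}) \<in> history t \<rightarrow>\<^sub>M Pi\<^sub>M {0..t} (\<lambda>_. state_algebra)"
    unfolding history_def by (rule measurable_vimage_algebra1) (auto simp: space_PiM)
  moreover have "(\<lambda>\<omega>. \<omega> s) \<in> Pi\<^sub>M {0..t} (\<lambda>_. state_algebra) \<rightarrow>\<^sub>M state_algebra"
    by (rule measurable_component_singleton) (use assms in simp)
  ultimately have "(\<lambda>\<omega>. restrict \<omega> {0..t} s) \<in> history t \<rightarrow>\<^sub>M state_algebra"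
    by (rule measurable_compose)
  then show ?thesis using assms by simp
qed

lemma history_subset_path_algebra: "sets (history t) \<subseteq> sets path_algebra"
  unfolding history_def
proof (rule sets_image_in_sets)
  show "(\<lambda>\<omega>. restrict \<omega> {0..t}) \<in> path_algebra \<rightarrow>\<^sub>M Pi\<^sub>M {0..t} (\<lambda>_. state_algebra)"
    by (rule measurable_restrict) (rule coordinate_measurable_path, simp)
qed simp

text \<open>Openness in the product with a discrete second factor, expressed slice by slice so that
  the second factor needs no topology.\<close>

definition slice_open :: "('a::topological_space \<times> 'b) set \<Rightarrow> bool" where
  "slice_open U \<longleftrightarrow> (\<forall>j. open {x. (x, j) \<in> U})"

lemma slice_open_Times: "open G \<Longrightarrow> slice_open (G \<times> J)"
  unfolding slice_open_def
proof
  fix j assume "open G"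
  then show "open {x. (x, j) \<in> G \<times> J}" by (cases "j \<in> J") auto
qed

lemma slice_open_Un: "slice_open U \<Longrightarrow> slice_open V \<Longrightarrow> slice_open (U \<union> V)"
  by (auto simp: slice_open_def Collect_disj_eq)

lemma slice_open_measurable:
  fixes U :: "((real^'d::finite) \<times> 'm::finite) set"
  assumes "slice_open U" shows "U \<in> sets state_algebra"
proof -
  have "U = (\<Union>j. {x. (x, j) \<in> U} \<times> {j})" by auto
  moreover have "{x. (x, j) \<in> U} \<times> {j} \<in> sets state_algebra" for j
    unfolding state_algebra_def using assms by (intro pair_measureI) (auto simp: slice_open_def)
  ultimately show ?thesis by (metis (no_types, lifting) countable_finite finite sets.countable_UN'')
qed

lemma eventually_right_in_open:
  assumes \<omega>: "\<omega> \<in> skorohod_paths" and "0 \<le> s" "slice_open U" "\<omega> s \<in> U"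
  shows "\<forall>\<^sub>F u in at_right s. \<omega> u \<in> U"
proof -
  have t: "((\<lambda>u. fst (\<omega> u)) \<longlongrightarrow> fst (\<omega> s)) (at_right s)"
    and e: "\<forall>\<^sub>F u in at_right s. snd (\<omega> u) = snd (\<omega> s)"
    using \<omega> assms(2) by (auto simp: skorohod_paths_def)
  have "\<forall>\<^sub>F u in at_right s. fst (\<omega> u) \<in> {x. (x, snd (\<omega> s)) \<in> U}"
    by (rule topological_tendstoD[OF t]) (use assms in \<open>auto simp: slice_open_def\<close>)
  with e show ?thesis
  proof eventually_elim
    case (elim u)
    then show ?case by (cases "\<omega> u") auto
  qed
qed

text \<open>Right-continuity keeps the path in an open set for a while after a visit, so a visit
  strictly before \<open>t\<close> has a rational witness before \<open>t\<close>. Events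
  \<open>hitting_time U \<omega> < ennreal t\<close> thus become countable unions, adapted to the
  history up to \<open>t\<close>.\<close>

lemma hit_rational:
  assumes \<omega>: "\<omega> \<in> skorohod_paths" and "0 \<le> s" "slice_open U" "\<omega> s \<in> U" "s < t"
  obtains q where "q \<in> \<rat>" "s < q" "q < t" "\<omega> q \<in> U"
proof -
  obtain c where c: "s < c" "\<And>u. s < u \<Longrightarrow> u < c \<Longrightarrow> \<omega> u \<in> U"
    using eventually_right_in_open[OF assms(1-4)] by (auto simp: eventually_at_right_field)
  obtain q where "q \<in> \<rat>" "s < q" "q < min c t"
    using Rats_dense_in_real[of s "min c t"] c assms by auto
  then show thesis using c that by auto
qed

lemma hitting_time_less_iff:
  "hitting_time U \<omega> < c \<longleftrightarrow> (\<exists>s\<ge>0. ennreal s < c \<and> \<omega> s \<in> U)"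
  by (auto simp: hitting_time_def INF_less_iff)

lemma hitting_time_less_ennreal:
  "hitting_time U \<omega> < ennreal t \<longleftrightarrow> (\<exists>s\<ge>0. s < t \<and> \<omega> s \<in> U)"
  unfolding hitting_time_less_iff by (auto simp: ennreal_less_iff)

lemma hitting_time_finite:
  "hitting_time U \<omega> < \<infinity> \<longleftrightarrow> (\<exists>s\<ge>0. \<omega> s \<in> U)"
  "hitting_time U \<omega> < \<top> \<longleftrightarrow> (\<exists>s\<ge>0. \<omega> s \<in> U)"
  unfolding hitting_time_less_iff by auto

lemma hitting_time_antimono: "U \<subseteq> V \<Longrightarrow> hitting_time V \<omega> \<le> hitting_time U \<omega>"
  unfolding hitting_time_def by (rule INF_superset_mono) auto

lemma hit_before_measurable:
  fixes U :: "((real^'d::finite) \<times> 'm::finite) set"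
  assumes U: "slice_open U" and "s \<le> t"
  shows "{\<omega> \<in> skorohod_paths. hitting_time U \<omega> < ennreal s} \<in> sets (history t)"
proof -
  have "{\<omega> \<in> skorohod_paths. hitting_time U \<omega> < ennreal s} =
     (\<Union>q\<in>{q \<in> \<rat>. 0 \<le> q \<and> q < s}. {\<omega> \<in> skorohod_paths. \<omega> q \<in> U})" (is "?L = ?R")
  proof
    show "?L \<subseteq> ?R"
    proof
      fix \<omega> assume "\<omega> \<in> ?L"
      then obtain u where u: "\<omega> \<in> skorohod_paths" "0 \<le> u" "u < s" "\<omega> u \<in> U"
        by (auto simp: hitting_time_less_ennreal)
      obtain q where "q \<in> \<rat>" "u < q" "q < s" "\<omega> q \<in> U"
        by (rule hit_rational[OF u(1,2) U u(4,3)]) (rule that)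
      then show "\<omega> \<in> ?R" using u by auto
    qed
  qed (auto simp: hitting_time_less_ennreal)
  moreover have "?R \<in> sets (history t)"
  proof (rule sets.countable_UN'')
    show "countable {q \<in> \<rat>. 0 \<le> q \<and> q < s}" by (rule countable_subset[OF _ countable_rat]) auto
    fix q assume "q \<in> {q \<in> \<rat>. 0 \<le> q \<and> q < s}"
    then have "(\<lambda>\<omega>. \<omega> q) \<in> history t \<rightarrow>\<^sub>M (state_algebra :: ((real^'d) \<times> 'm) measure)"
      using assms by (intro coordinate_measurable_history) auto
    from measurable_sets[OF this slice_open_measurable[OF U]]
    show "{\<omega> \<in> skorohod_paths. \<omega> q \<in> U} \<in> sets (history t)"
      by (simp add: vimage_def Int_def conj_commute)
  qed
  ultimately show ?thesis by simp
qed

lemma hit_before_path_measurable: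
  fixes U :: "((real^'d::finite) \<times> 'm::finite) set"
  assumes U: "slice_open U"
  shows "{\<omega> \<in> skorohod_paths. hitting_time U \<omega> < ennreal s} \<in> sets path_algebra"
  using hit_before_measurable[OF U order_refl] history_subset_path_algebra by blast

lemma hitting_time_measurable:
  fixes U :: "((real^'d::finite) \<times> 'm::finite) set"
  assumes U: "slice_open U"
  shows "hitting_time U \<in> borel_measurable path_algebra"
proof (rule borel_measurableI_less)
  fix y
  show "{\<omega> \<in> space path_algebra. hitting_time U \<omega> < y} \<in> sets path_algebra"
  proof (cases y)
    case (real r)
    then show ?thesis using hit_before_path_measurable[OF U, of r] by simp
  next
    case top
    have "{\<omega> \<in> skorohod_paths. hitting_time U \<omega> < \<infinity>} =
       (\<Union>n::nat. {\<omega> \<in> skorohod_paths. hitting_time U \<omega> < ennreal n})"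
      unfolding hitting_time_finite hitting_time_less_ennreal using reals_Archimedean2 by blast
    moreover have "\<dots> \<in> sets path_algebra"
      by (intro sets.countable_UN) (use hit_before_path_measurable[OF U] in auto)
    ultimately show ?thesis using top by simp
  qed
qed

section \<open>Path regularity and time integrals\<close>

lemma measurable_state_function:
  fixes f :: "'m::finite \<Rightarrow> real^'d::finite \<Rightarrow> real"
  assumes "\<And>j. continuous_on UNIV (f j)"
  shows "(\<lambda>p. f (snd p) (fst p)) \<in> borel_measurable state_algebra"
  unfolding state_algebra_def
proof (rule measurable_compose_countable[where g=snd])
  show "(\<lambda>p. f j (fst p)) \<in> borel_measurable (borel \<Otimes>\<^sub>M count_space UNIV)" for j
    using borel_measurable_continuous_onI[OF assms[of j]] by measurable
qed simp

lemma state_function_right_continuous: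
  fixes f :: "'m::finite \<Rightarrow> real^'d::finite \<Rightarrow> real"
  assumes \<omega>: "\<omega> \<in> skorohod_paths" and "0 \<le> s" and f: "\<And>j. continuous_on UNIV (f j)"
  shows "((\<lambda>u. f (snd (\<omega> u)) (fst (\<omega> u))) \<longlongrightarrow> f (snd (\<omega> s)) (fst (\<omega> s))) (at_right s)"
proof -
  have t: "((\<lambda>u. fst (\<omega> u)) \<longlongrightarrow> fst (\<omega> s)) (at_right s)"
    and e: "\<forall>\<^sub>F u in at_right s. snd (\<omega> u) = snd (\<omega> s)"
    using \<omega> assms(2) by (auto simp: skorohod_paths_def)
  have "isCont (f (snd (\<omega> s))) (fst (\<omega> s))"
    using f[of "snd (\<omega> s)"] by (simp add: continuous_on_eq_continuous_at)
  then have "((\<lambda>u. f (snd (\<omega> s)) (fst (\<omega> u))) \<longlongrightarrow> f (snd (\<omega> s)) (fst (\<omega> s))) (at_right s)"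
    by (rule isCont_tendsto_compose[OF _ t])
  moreover have "\<forall>\<^sub>F u in at_right s. f (snd (\<omega> s)) (fst (\<omega> u)) = f (snd (\<omega> u)) (fst (\<omega> u))"
    using e by eventually_elim simp
  ultimately show ?thesis by (rule Lim_transform_eventually)
qed

text \<open>One-sided limits bound the path near each time, and compactness of the interval leaves
  finitely many local bounds.\<close>

lemma path_bounded:
  fixes \<omega> :: "real \<Rightarrow> (real^'d::finite) \<times> 'm::finite"
  assumes \<omega>: "\<omega> \<in> skorohod_paths"
  obtains B where "\<And>s. 0 \<le> s \<Longrightarrow> s \<le> t \<Longrightarrow> norm (fst (\<omega> s)) \<le> B"
proof -
  \<comment> \<open>Constant continuation to negative times gives one-sided limits at every real
    number, so time 0 needs no special treatment.\<close>
  define X where "X = (\<lambda>s. fst (\<omega> (max 0 s)))"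
  have local: "\<exists>e>0. \<exists>B. \<forall>u\<in>ball s e. norm (X u) \<le> B" for s
  proof -
    have bd: "\<exists>B. \<forall>\<^sub>F u in F. norm (g u) \<le> B" if "(g \<longlongrightarrow> c) F" for g :: "real \<Rightarrow> real^'d" and c F
    proof -
      have "\<forall>\<^sub>F u in F. dist (g u) c < 1" using that by (rule tendstoD) simp
      then have "\<forall>\<^sub>F u in F. norm (g u) \<le> norm c + 1"
      proof eventually_elim
        case (elim u)
        then show ?case using norm_triangle_sub[of "g u" c] by (simp add: dist_norm)
      qed
      then show ?thesis ..
    qed
    have "\<exists>c. (X \<longlongrightarrow> c) (at_right s)"
    proof (cases "0 \<le> s")
      case True
      have "((\<lambda>u. fst (\<omega> u)) \<longlongrightarrow> fst (\<omega> s)) (at_right s)"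
        using \<omega> True by (auto simp: skorohod_paths_def)
      moreover have "\<forall>\<^sub>F u in at_right s. fst (\<omega> u) = X u"
        unfolding eventually_at_right_field by (rule exI[of _ "s + 1"]) (use True in \<open>auto simp: X_def\<close>)
      ultimately show ?thesis using Lim_transform_eventually by blast
    next
      case False
      have "\<forall>\<^sub>F u in at_right s. fst (\<omega> 0) = X u"
        unfolding eventually_at_right_field by (rule exI[of _ 0]) (use False in \<open>auto simp: X_def\<close>)
      then show ?thesis using Lim_transform_eventually[OF tendsto_const] by blast
    qed
    then obtain B1 where B1: "\<forall>\<^sub>F u in at_right s. norm (X u) \<le> B1" using bd by blast
    have "\<exists>c. (X \<longlongrightarrow> c) (at_left s)"
    proof (cases "0 < s")
      case True
      then obtain c where "((\<lambda>u. fst (\<omega> u)) \<longlongrightarrow> c) (at_left s)"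
        using \<omega> by (auto simp: skorohod_paths_def)
      moreover have "\<forall>\<^sub>F u in at_left s. fst (\<omega> u) = X u"
        unfolding eventually_at_left_field by (rule exI[of _ 0]) (use True in \<open>auto simp: X_def\<close>)
      ultimately show ?thesis using Lim_transform_eventually by blast
    next
      case False
      have "\<forall>\<^sub>F u in at_left s. fst (\<omega> 0) = X u"
        unfolding eventually_at_left_field by (rule exI[of _ "s - 1"]) (use False in \<open>auto simp: X_def\<close>)
      then show ?thesis using Lim_transform_eventually[OF tendsto_const] by blast
    qed
    then obtain B2 where B2: "\<forall>\<^sub>F u in at_left s. norm (X u) \<le> B2" using bd by blast
    obtain c1 where c1: "s < c1" "\<And>u. s < u \<Longrightarrow> u < c1 \<Longrightarrow> norm (X u) \<le> B1"
      using B1 by (auto simp: eventually_at_right_field)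
    obtain c2 where c2: "c2 < s" "\<And>u. c2 < u \<Longrightarrow> u < s \<Longrightarrow> norm (X u) \<le> B2"
      using B2 by (auto simp: eventually_at_left_field)
    have "norm (X u) \<le> max (norm (X s)) (max B1 B2)" if "u \<in> ball s (min (c1 - s) (s - c2))" for u
    proof (cases u s rule: linorder_cases)
      case less
      then have "norm (X u) \<le> B2" using that by (intro c2) (auto simp: dist_real_def)
      then show ?thesis by simp
    next
      case greater
      then have "norm (X u) \<le> B1" using that by (intro c1) (auto simp: dist_real_def)
      then show ?thesis by simp
    qed simp
    then show ?thesis using c1(1) c2(1)
      by (intro exI[of _ "min (c1 - s) (s - c2)"] conjI exI[of _ "max (norm (X s)) (max B1 B2)"]) auto
  qed
  then obtain e B where e: "\<And>s. 0 < e s" and B: "\<And>s u. u \<in> ball s (e s) \<Longrightarrow> norm (X u) \<le> B s"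
    by metis
  have "{0..t} \<subseteq> (\<Union>s\<in>{0..t}. ball s (e s))" using e by force
  then obtain T where T: "T \<subseteq> {0..t}" "finite T" "{0..t} \<subseteq> (\<Union>s\<in>T. ball s (e s))"
    by (rule compactE_image[OF compact_Icc open_ball]) (rule that)
  show thesis
  proof (rule that[of "\<Sum>s\<in>T. \<bar>B s\<bar>"])
    fix s assume s: "0 \<le> s" "s \<le> t"
    then obtain r where r: "r \<in> T" "s \<in> ball r (e r)" using T by force
    have "norm (fst (\<omega> s)) = norm (X s)" using s by (simp add: X_def)
    also have "\<dots> \<le> \<bar>B r\<bar>" using B[OF r(2)] by simp
    also have "\<dots> \<le> (\<Sum>s\<in>T. \<bar>B s\<bar>)" by (rule member_le_sum) (use r T in auto)
    finally show "norm (fst (\<omega> s)) \<le> (\<Sum>s\<in>T. \<bar>B s\<bar>)" .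
  qed
qed

text \<open>The bound is asked only for times before \<open>t\<close>: a path that has not hit
  before \<open>t\<close> may be in the target at \<open>t\<close> itself, and that one instant is a
  null set.\<close>

lemma time_integral_increment_le:
  fixes G :: "real \<Rightarrow> real"
  assumes int: "set_integrable lborel {0..t} G" and st: "0 \<le> s" "s \<le> t"
    and le: "\<And>u. s \<le> u \<Longrightarrow> u < t \<Longrightarrow> G u \<le> c"
  shows "(LINT u:{0..t}|lborel. G u) - (LINT u:{0..s}|lborel. G u) \<le> c * (t - s)"
proof -
  have i: "set_integrable lborel {0..s} G" "set_integrable lborel {s<..t} G"
    using int st by (auto intro: set_integrable_subset)
  have disj: "{0..s} \<inter> {s<..t} = {}" by auto
  have "{0..t} = {0..s} \<union> {s<..t}" using st by auto
  then have "(LINT u:{0..t}|lborel. G u) = (LINT u:{0..s}|lborel. G u) + (LINT u:{s<..t}|lborel. G u)"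
    using set_integral_Un[OF disj i] by simp
  moreover have "(LINT u:{s<..t}|lborel. G u) \<le> (LINT u:{s<..t}|lborel. c)"
    unfolding set_lebesgue_integral_def
  proof (rule integral_mono_AE)
    show "AE u in lborel. indicat_real {s<..t} u *\<^sub>R G u \<le> indicat_real {s<..t} u *\<^sub>R c"
      using AE_lborel_singleton[of t] by eventually_elim (auto simp: indicator_def intro: le)
    show "integrable lborel (\<lambda>u. indicat_real {s<..t} u *\<^sub>R G u)"
      using i(2) by (simp add: set_integrable_def)
    show "integrable lborel (\<lambda>u. indicat_real {s<..t} u *\<^sub>R c)"
      by (intro integrable_scaleR_left integrable_real_indicator) (use st in \<open>auto simp: emeasure_lborel_Ioc\<close>)
  qed
  moreover have "(LINT u:{s<..t}|lborel. c) = c * (t - s)"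
    using st by (simp add: set_lebesgue_integral_def)
  ultimately show ?thesis by simp
qed

text \<open>Joint measurability in path and time, as Fubini requires. Time is approximated from the
  right by grid points; each approximation depends on countably many coordinates, and
  right-continuity gives the limit.\<close>

lemma path_function_jointly_measurable:
  fixes f :: "'m::finite \<Rightarrow> real^'d::finite \<Rightarrow> real"
  assumes f: "\<And>j. continuous_on UNIV (f j)"
  shows "(\<lambda>p. f (snd (fst p (max 0 (snd p)))) (fst (fst p (max 0 (snd p)))))
    \<in> borel_measurable ((path_algebra :: (real \<Rightarrow> (real^'d) \<times> 'm) measure) \<Otimes>\<^sub>M borel)"
proof -
  let ?Z = "\<lambda>t (\<omega> :: real \<Rightarrow> (real^'d) \<times> 'm). f (snd (\<omega> t)) (fst (\<omega> t))"
  \<comment> \<open>The \<open>+ 1\<close> places the grid point strictly after the time. For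
    negative \<open>u\<close> the \<open>nat\<close> yields the grid point 1 / (n + 1), which tends
    to 0 in agreement with \<open>max 0 u\<close>.\<close>
  define d where "d n u = (real (nat \<lfloor>real (Suc n) * u\<rfloor>) + 1) / real (Suc n)" for n u
  have Z: "?Z t \<in> borel_measurable path_algebra" if "0 \<le> t" for t
    using measurable_compose[OF coordinate_measurable_path[OF that] measurable_state_function[OF f]] .
  have appr: "(\<lambda>p. ?Z (d n (snd p)) (fst p)) \<in> borel_measurable (path_algebra \<Otimes>\<^sub>M borel)" for n
  proof -
    have "(\<lambda>p. ?Z ((real i + 1) / real (Suc n)) (fst p))
       \<in> borel_measurable ((path_algebra :: (real \<Rightarrow> (real^'d) \<times> 'm) measure) \<Otimes>\<^sub>M (borel :: real measure))" for i :: nat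
      by (rule measurable_compose[OF measurable_fst Z]) simp
    moreover have "(\<lambda>p. nat \<lfloor>real (Suc n) * snd p\<rfloor>) \<in>
      ((path_algebra :: (real \<Rightarrow> (real^'d) \<times> 'm) measure) \<Otimes>\<^sub>M borel) \<rightarrow>\<^sub>M count_space UNIV"
      by measurable
    ultimately show ?thesis unfolding d_def by (rule measurable_compose_countable)
  qed
  have d: "max 0 u < d n u" "d n u \<le> max 0 u + 1 / real (Suc n)" for n u
  proof -
    have n: "real (nat \<lfloor>real (Suc n) * u\<rfloor>) \<le> real (Suc n) * max 0 u"
      "real (Suc n) * max 0 u < real (nat \<lfloor>real (Suc n) * u\<rfloor>) + 1"
    proof -
      have "nat \<lfloor>real (Suc n) * u\<rfloor> = nat \<lfloor>real (Suc n) * max 0 u\<rfloor>"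
      proof (cases "0 \<le> u")
        case False
        then have "real (Suc n) * u < 0" by (intro mult_pos_neg) auto
        then show ?thesis using False by (simp add: max_def)
      qed (simp add: max_def)
      moreover have "0 \<le> real (Suc n) * max 0 u" by simp
      then have "0 \<le> \<lfloor>real (Suc n) * max 0 u\<rfloor>" by (simp only: zero_le_floor)
      ultimately show "real (nat \<lfloor>real (Suc n) * u\<rfloor>) \<le> real (Suc n) * max 0 u"
        "real (Suc n) * max 0 u < real (nat \<lfloor>real (Suc n) * u\<rfloor>) + 1"
        by (simp_all only: of_nat_nat of_int_floor_le real_of_int_floor_add_one_gt)
    qed
    show "max 0 u < d n u" using n(2) by (simp only: d_def pos_less_divide_eq of_nat_0_less_iff zero_less_Suc mult.commute)
    have "(real (nat \<lfloor>real (Suc n) * u\<rfloor>) + 1) / real (Suc n) \<le> (real (Suc n) * max 0 u + 1) / real (Suc n)"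
      using n(1) by (intro divide_right_mono) auto
    then show "d n u \<le> max 0 u + 1 / real (Suc n)" by (simp add: d_def add_divide_distrib)
  qed
  show ?thesis
  proof (rule borel_measurable_LIMSEQ_real[OF _ appr])
    fix p :: "(real \<Rightarrow> (real^'d) \<times> 'm) \<times> real"
    assume "p \<in> space (path_algebra \<Otimes>\<^sub>M borel)"
    then have \<omega>: "fst p \<in> skorohod_paths" by (auto simp: space_pair_measure)
    have "filterlim (\<lambda>n. d n (snd p)) (at_right (max 0 (snd p))) sequentially"
      unfolding filterlim_at
    proof
      show "\<forall>\<^sub>F n in sequentially. d n (snd p) \<in> {max 0 (snd p)<..} \<and> d n (snd p) \<noteq> max 0 (snd p)"
        using d(1) by (auto intro!: always_eventually simp: less_imp_neq[symmetric])
      show "(\<lambda>n. d n (snd p)) \<longlonglongrightarrow> max 0 (snd p)"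
      proof (rule tendsto_sandwich)
        show "\<forall>\<^sub>F n in sequentially. max 0 (snd p) \<le> d n (snd p)"
          using d(1) by (auto intro!: always_eventually less_imp_le)
        show "\<forall>\<^sub>F n in sequentially. d n (snd p) \<le> max 0 (snd p) + 1 / real (Suc n)"
          using d(2) by (intro always_eventually allI)
        show "(\<lambda>n. max 0 (snd p) + 1 / real (Suc n)) \<longlonglongrightarrow> max 0 (snd p)"
          using tendsto_add[OF tendsto_const LIMSEQ_Suc[OF lim_1_over_n], of "max 0 (snd p)"] by simp
      qed simp
    qed
    then show "(\<lambda>n. ?Z (d n (snd p)) (fst p)) \<longlonglongrightarrow> ?Z (max 0 (snd p)) (fst p)"
      by (rule filterlim_compose[OF state_function_right_continuous[where f=f, OF \<omega> max.cobounded1 f]])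
  qed
qed

text \<open>The infimum need not be attained, so at the hitting time the path may be on the boundary
  and only a closed superset is certain. Were the state outside \<open>C\<close>, right-continuity
  would keep the path off \<open>D\<close> for some time longer.\<close>

lemma hitting_state_in_closed:
  assumes \<omega>: "\<omega> \<in> skorohod_paths" and fin: "hitting_time (D \<times> UNIV) \<omega> < \<infinity>"
    and C: "closed C" "D \<subseteq> C"
  shows "fst (\<omega> (enn2real (hitting_time (D \<times> UNIV) \<omega>))) \<in> C"
proof (rule ccontr)
  define t where "t = enn2real (hitting_time (D \<times> UNIV) \<omega>)"
  have t: "hitting_time (D \<times> UNIV) \<omega> = ennreal t" "0 \<le> t" using fin by (simp_all add: t_def)
  assume "\<not> ?thesis"
  then have nin: "\<omega> t \<in> (- C) \<times> UNIV" by (cases "\<omega> t") (auto simp: t_def)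
  have "\<forall>\<^sub>F u in at_right t. \<omega> u \<in> (- C) \<times> UNIV"
    by (rule eventually_right_in_open[OF \<omega> t(2) _ nin]) (use C in \<open>auto intro: slice_open_Times\<close>)
  then obtain c where c: "t < c" "\<And>u. t < u \<Longrightarrow> u < c \<Longrightarrow> \<omega> u \<in> (- C) \<times> UNIV"
    by (auto simp: eventually_at_right_field)
  then have "hitting_time (D \<times> UNIV) \<omega> < ennreal c" using t by (simp add: ennreal_less_iff)
  then obtain s where s: "0 \<le> s" "s < c" "\<omega> s \<in> D \<times> UNIV" by (auto simp: hitting_time_less_ennreal)
  then have "hitting_time (D \<times> UNIV) \<omega> \<le> ennreal s"
    unfolding hitting_time_def by (intro INF_lower) auto
  then have "t \<le> s" using t s by (simp add: ennreal_le_iff)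
  then have "\<omega> s \<in> (- C) \<times> UNIV" using c(2)[of s] s nin by (cases "s = t") auto
  then show False using s C by auto
qed

section \<open>Dynkin's formula under the laws \<open>P\<close>\<close>

locale regime_switching_process = regime_switching_jump_diffusion b \<sigma> \<pi> Q
  for b :: "real^'d::finite \<Rightarrow> 'm::finite \<Rightarrow> real^'d"
    and \<sigma> :: "real^'d \<Rightarrow> 'm \<Rightarrow> real^'d^'d"
    and \<pi> :: "'m \<Rightarrow> real^'d \<Rightarrow> (real^'d) measure"
    and Q :: "real^'d \<Rightarrow> real^'m^'m" +
  fixes P :: "(real^'d) \<times> 'm \<Rightarrow> (real \<Rightarrow> (real^'d) \<times> 'm) measure"
  assumes solution: "\<And>start. martingale_problem_solution b \<sigma> \<pi> Q start (P start)"
    and markov: "strong_markov P"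
    and irreducible: "\<And>G. bounded_domain G \<Longrightarrow> strictly_irreducible Q G"
begin

lemma prob_space_P: "prob_space (P x)"
  and sets_P [measurable_cong, simp]: "sets (P x) = sets path_algebra"
  using solution[of x] by (auto simp: martingale_problem_solution_def)

lemma space_P [simp]: "space (P x) = skorohod_paths"
  using sets_eq_imp_space_eq[OF sets_P] by simp

definition path_fun :: "('m \<Rightarrow> real^'d \<Rightarrow> real) \<Rightarrow> real \<Rightarrow> (real \<Rightarrow> (real^'d) \<times> 'm) \<Rightarrow> real" where
  "path_fun f t \<omega> = f (snd (\<omega> t)) (fst (\<omega> t))"

definition path_gen :: "('m \<Rightarrow> real^'d \<Rightarrow> real) \<Rightarrow> (real \<Rightarrow> (real^'d) \<times> 'm) \<Rightarrow> real \<Rightarrow> real" where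
  "path_gen f \<omega> s = generator b \<sigma> \<pi> Q f (fst (\<omega> s)) (snd (\<omega> s))"

definition path_int :: "('m \<Rightarrow> real^'d \<Rightarrow> real) \<Rightarrow> real \<Rightarrow> (real \<Rightarrow> (real^'d) \<times> 'm) \<Rightarrow> real" where
  "path_int f t \<omega> = (LINT s:{0..t}|lborel. path_gen f \<omega> s)"

lemma path_gen_integrable:
  assumes "\<And>j. C2c (f j)"
  shows "AE \<omega> in P x. \<forall>t\<ge>0. set_integrable lborel {0..t} (path_gen f \<omega>)"
  using solution[of x] C2c_imp_C2b[OF assms]
  by (simp add: martingale_problem_solution_def path_gen_def[abs_def])

lemma path_fun_measurable:
  assumes "\<And>j. C2c (f j)" "0 \<le> t"
  shows "path_fun f t \<in> borel_measurable path_algebra"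
proof -
  have "continuous_on UNIV (f j)" for j using assms C2_continuous by (auto simp: C2c_def)
  from measurable_compose[OF coordinate_measurable_path[OF assms(2)] measurable_state_function[OF this]]
  show ?thesis by (simp add: path_fun_def[abs_def])
qed

lemma C2c_family_bounded:
  assumes "\<And>j. C2c (f j)"
  obtains S where "\<And>(j::'m) x. \<bar>f j x :: real\<bar> \<le> S"
proof -
  have "\<exists>S. \<forall>x. \<bar>f i x\<bar> \<le> S" for i
    using C2c_imp_C2b[OF assms, of i] by (auto simp: C2b_def bounded_iff)
  then obtain S where S: "\<And>i x. \<bar>f i x\<bar> \<le> S i" by metis
  show thesis
  proof (rule that[of "\<Sum>i\<in>UNIV. \<bar>S i\<bar>"])
    fix i x
    have "\<bar>S i\<bar> \<le> (\<Sum>i\<in>UNIV. \<bar>S i\<bar>)" by (rule member_le_sum) auto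
    then show "\<bar>f i x\<bar> \<le> (\<Sum>i\<in>UNIV. \<bar>S i\<bar>)" using S[of i x] by linarith
  qed
qed

lemma path_fun_integrable:
  assumes "\<And>j. C2c (f j)" "0 \<le> t"
  shows "integrable (P x) (path_fun f t)"
proof -
  interpret prob_space "P x" by (rule prob_space_P)
  obtain S where S: "\<And>j x. \<bar>f j x\<bar> \<le> S"
    by (rule C2c_family_bounded[OF assms(1)]) (rule that)
  show ?thesis
    by (rule integrable_const_bound[where B=S])
       (use S path_fun_measurable[OF assms] in \<open>auto simp: path_fun_def cong: measurable_cong_sets\<close>)
qed

lemma
  assumes f: "\<And>j. C2c (f j)" and st: "0 \<le> s" "s \<le> t" and A: "A \<in> sets (history s)"
  shows path_int_integrable: "integrable (P x) (path_int f t)"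
    and dynkin: "(LINT \<omega>|P x. indicator A \<omega> * (path_fun f t \<omega> - path_fun f s \<omega>)) =
      (LINT \<omega>|P x. indicator A \<omega> * (path_int f t \<omega> - path_int f s \<omega>))"
proof -
  interpret prob_space "P x" by (rule prob_space_P)
  interpret finite_measure_subalgebra "P x" "history s"
    by unfold_locales (use history_subset_path_algebra in \<open>auto simp: subalgebra_def\<close>)
  define N where "N = (\<lambda>t \<omega>. path_fun f t \<omega> - path_fun f 0 \<omega> - path_int f t \<omega>)"
  have mart: "martingale (P x) history N"
    using solution[of x] C2c_imp_C2b[OF f]
    by (simp add: martingale_problem_solution_def N_def path_fun_def path_int_def path_gen_def)
  have Ni: "integrable (P x) (N t)" "integrable (P x) (N s)"
    and Nc: "AE \<omega> in P x. real_cond_exp (P x) (history s) (N t) \<omega> = N s \<omega>"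
    using mart st by (auto simp: martingale_def)
  have I: "integrable (P x) (path_int f u)" if "0 \<le> u" "integrable (P x) (N u)" for u
  proof -
    have "integrable (P x) (\<lambda>\<omega>. path_fun f u \<omega> - path_fun f 0 \<omega> - N u \<omega>)"
      using that by (intro Bochner_Integration.integrable_diff path_fun_integrable f) auto
    then show ?thesis by (simp add: N_def)
  qed
  show It: "integrable (P x) (path_int f t)" using I Ni st by auto
  have Is: "integrable (P x) (path_int f s)" using I Ni st by auto
  have AP: "A \<in> sets (P x)" using A history_subset_path_algebra by auto
  have "(LINT \<omega>:A|P x. N t \<omega>) = (LINT \<omega>:A|P x. real_cond_exp (P x) (history s) (N t) \<omega>)"
    by (rule real_cond_exp_intA[OF Ni(1) A])
  also have "\<dots> = (LINT \<omega>:A|P x. N s \<omega>)"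
    unfolding set_lebesgue_integral_def
    by (rule integral_cong_AE) (use Nc AP Ni(2) in auto)
  finally have eq: "(LINT \<omega>|P x. indicator A \<omega> * N t \<omega>) = (LINT \<omega>|P x. indicator A \<omega> * N s \<omega>)"
    by (simp add: set_lebesgue_integral_def)
  have iA: "integrable (P x) (\<lambda>\<omega>. indicator A \<omega> * g \<omega>)" if "integrable (P x) g" for g :: "_ \<Rightarrow> real"
    using integrable_mult_indicator[OF AP that] by simp
  have Z: "integrable (P x) (path_fun f t)" "integrable (P x) (path_fun f s)"
    using st by (auto intro!: path_fun_integrable f)
  have "(LINT \<omega>|P x. indicator A \<omega> * (path_fun f t \<omega> - path_fun f s \<omega>)) -
      (LINT \<omega>|P x. indicator A \<omega> * (path_int f t \<omega> - path_int f s \<omega>)) =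
      (LINT \<omega>|P x. indicator A \<omega> * (path_fun f t \<omega> - path_fun f s \<omega>) - indicator A \<omega> * (path_int f t \<omega> - path_int f s \<omega>))"
    by (rule Bochner_Integration.integral_diff[symmetric])
       (intro iA Bochner_Integration.integrable_diff Z It Is)+
  also have "\<dots> = (LINT \<omega>|P x. indicator A \<omega> * N t \<omega> - indicator A \<omega> * N s \<omega>)"
    by (rule Bochner_Integration.integral_cong) (auto simp: N_def algebra_simps)
  also have "\<dots> = (LINT \<omega>|P x. indicator A \<omega> * N t \<omega>) - (LINT \<omega>|P x. indicator A \<omega> * N s \<omega>)"
    by (rule Bochner_Integration.integral_diff) (intro iA Ni)+
  finally show "(LINT \<omega>|P x. indicator A \<omega> * (path_fun f t \<omega> - path_fun f s \<omega>)) =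
      (LINT \<omega>|P x. indicator A \<omega> * (path_int f t \<omega> - path_int f s \<omega>))"
    using eq by simp
qed

lemma start_AE: "AE \<omega> in P x. \<omega> 0 = x"
proof -
  interpret prob_space "P x" by (rule prob_space_P)
  have m: "measure (P x) {\<omega> \<in> space (P x). \<omega> 0 = x} = 1"
    using solution[of x] by (simp add: martingale_problem_solution_def)
  \<comment> \<open>\<open>measure\<close> is 0 by default outside the sigma-algebra, so the value 1
    forces measurability.\<close>
  then have "{\<omega> \<in> space (P x). \<omega> 0 = x} \<in> sets (P x)"
    by (metis (no_types, lifting) measure_notin_sets zero_neq_one)
  then show ?thesis using m by (subst prob_Collect_eq_1[symmetric]) auto
qed

lemma expectation_start:
  assumes "\<And>j. C2c (f j)"
  shows "(LINT \<omega>|P x. path_fun f 0 \<omega>) = f (snd x) (fst x)"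
proof -
  interpret prob_space "P x" by (rule prob_space_P)
  have "(LINT \<omega>|P x. path_fun f 0 \<omega>) = (LINT \<omega>|P x. f (snd x) (fst x))"
  proof (rule integral_cong_AE)
    show "AE \<omega> in P x. path_fun f 0 \<omega> = f (snd x) (fst x)"
      using start_AE[of x] by eventually_elim (simp add: path_fun_def)
  qed (use path_fun_integrable[OF assms, of 0 x] in auto)
  then show ?thesis using prob_space[unfolded space_P] by simp
qed

lemma expectation_dynkin:
  assumes f: "\<And>j. C2c (f j)" and "0 \<le> t"
  shows "(LINT \<omega>|P x. path_fun f t \<omega>) = f (snd x) (fst x) + (LINT \<omega>|P x. path_int f t \<omega>)"
proof -
  have A: "skorohod_paths \<in> sets (history 0)" using sets.top[of "history 0"] by simp
  have 0: "path_int f 0 \<omega> = 0" for \<omega>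
  proof -
    have "AE s in lborel. indicator {0..0} s *\<^sub>R path_gen f \<omega> s = 0"
      using AE_lborel_singleton[of 0] by eventually_elim auto
    then show ?thesis
      unfolding path_int_def set_lebesgue_integral_def by (rule integral_eq_zero_AE)
  qed
  have "(LINT \<omega>|P x. indicator skorohod_paths \<omega> * (path_fun f t \<omega> - path_fun f 0 \<omega>)) =
    (LINT \<omega>|P x. path_fun f t \<omega> - path_fun f 0 \<omega>)"
    by (rule Bochner_Integration.integral_cong) auto
  moreover have "\<dots> = (LINT \<omega>|P x. path_fun f t \<omega>) - (LINT \<omega>|P x. path_fun f 0 \<omega>)"
    using assms by (intro Bochner_Integration.integral_diff path_fun_integrable) auto
  moreover have "(LINT \<omega>|P x. indicator skorohod_paths \<omega> * (path_int f t \<omega> - path_int f 0 \<omega>)) = (LINT \<omega>|P x. path_int f t \<omega>)"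
    by (rule Bochner_Integration.integral_cong) (auto simp: 0)
  ultimately show ?thesis
    using dynkin[OF f order_refl assms(2) A, of x] expectation_start[OF f, of x] by simp
qed

text \<open>Fubini turns a lower bound on the mean of \<open>f\<close> along the path at each time
  into one on the mean of its time integral.\<close>

lemma expectation_time_integral:
  assumes f: "\<And>j. C2c (f j)" and T: "0 \<le> T"
    and low: "\<And>u. 0 \<le> u \<Longrightarrow> u \<le> T \<Longrightarrow> c \<le> (LINT \<omega>|P x. path_fun f u \<omega>)"
  shows "integrable (P x) (\<lambda>\<omega>. LINT u:{0..T}|lborel. path_fun f u \<omega>)"
    and "c * T \<le> (LINT \<omega>|P x. (LINT u:{0..T}|lborel. path_fun f u \<omega>))"
    and "\<And>\<omega>. \<omega> \<in> skorohod_paths \<Longrightarrow> set_integrable lborel {0..T} (\<lambda>u. path_fun f u \<omega>)"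
proof -
  interpret P: prob_space "P x" by (rule prob_space_P)
  define L where "L = restrict_space lborel {0..T}"
  have sL: "space L = {0..T}" by (simp add: L_def space_restrict_space)
  interpret L: finite_measure L
    by (rule finite_measureI) (use T in \<open>simp add: L_def space_restrict_space emeasure_restrict_space\<close>)
  interpret PL: pair_sigma_finite "P x" L ..
  interpret PF: finite_measure "P x \<Otimes>\<^sub>M L"
    by (rule finite_measure_pair_measure) (rule L.finite_measure_axioms P.finite_measure_axioms)+
  obtain S where S: "\<And>j x. \<bar>f j x\<bar> \<le> S"
    by (rule C2c_family_bounded[OF f]) (rule that)
  define h where "h = (\<lambda>p. path_fun f (max 0 (snd p)) (fst p))"
  have "continuous_on UNIV (f j)" for j using f C2_continuous by (auto simp: C2c_def)
  from path_function_jointly_measurable[OF this]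
  have h: "h \<in> borel_measurable (path_algebra \<Otimes>\<^sub>M borel)"
    by (simp add: h_def path_fun_def)
  have idL: "(\<lambda>p. (fst p, snd p)) \<in> P x \<Otimes>\<^sub>M L \<rightarrow>\<^sub>M path_algebra \<Otimes>\<^sub>M borel"
  proof (rule measurable_Pair)
    show "fst \<in> P x \<Otimes>\<^sub>M L \<rightarrow>\<^sub>M path_algebra"
      using measurable_fst[of "P x" L] by (simp cong: measurable_cong_sets)
    have "(\<lambda>u. u) \<in> L \<rightarrow>\<^sub>M borel" unfolding L_def by (rule measurable_restrict_space1) simp
    then show "snd \<in> P x \<Otimes>\<^sub>M L \<rightarrow>\<^sub>M borel" by (rule measurable_compose[OF measurable_snd])
  qed
  have hm: "h \<in> borel_measurable (P x \<Otimes>\<^sub>M L)"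
    using measurable_compose[OF idL h] by simp
  have hS: "norm (h p) \<le> S" for p using S by (simp add: h_def path_fun_def)
  have "integrable (P x \<Otimes>\<^sub>M L) h"
    by (rule PF.integrable_const_bound[where B=S]) (intro AE_I2 hS hm)+
  then have hi: "integrable (P x \<Otimes>\<^sub>M L) (\<lambda>(\<omega>, u). h (\<omega>, u))" by simp
  have eqL: "(LINT u|L. h (\<omega>, u)) = (LINT u:{0..T}|lborel. path_fun f u \<omega>)" for \<omega>
  proof -
    have "(LINT u|L. h (\<omega>, u)) = (LINT u:{0..T}|lborel. h (\<omega>, u))"
      unfolding L_def set_lebesgue_integral_def by (rule integral_restrict_space) simp
    also have "\<dots> = (LINT u:{0..T}|lborel. path_fun f u \<omega>)"
      by (rule set_lebesgue_integral_cong) (auto simp: h_def)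
    finally show ?thesis .
  qed
  show "integrable (P x) (\<lambda>\<omega>. LINT u:{0..T}|lborel. path_fun f u \<omega>)"
    using PL.integrable_fst[OF hi] by (simp add: eqL)
  have "c * T = (LINT u|L. c)"
    using T by (simp add: L_def measure_restrict_space space_restrict_space)
  also have "\<dots> \<le> (LINT u|L. (LINT \<omega>|P x. h (\<omega>, u)))"
  proof (rule integral_mono)
    show "integrable L (\<lambda>u. LINT \<omega>|P x. h (\<omega>, u))" using PL.integrable_snd[OF hi] by simp
    show "c \<le> (LINT \<omega>|P x. h (\<omega>, u))" if "u \<in> space L" for u
      using that low[of u] by (simp add: sL h_def)
  qed simp
  also have "\<dots> = (LINT \<omega>|P x. (LINT u|L. h (\<omega>, u)))"
    by (rule PL.Fubini_integral[OF hi])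
  finally show "c * T \<le> (LINT \<omega>|P x. (LINT u:{0..T}|lborel. path_fun f u \<omega>))"
    by (simp add: eqL)
  show "set_integrable lborel {0..T} (\<lambda>u. path_fun f u \<omega>)" if "\<omega> \<in> skorohod_paths" for \<omega>
  proof -
    have "(\<lambda>u. (\<omega>, u)) \<in> borel \<rightarrow>\<^sub>M path_algebra \<Otimes>\<^sub>M borel"
      by (rule measurable_Pair1') (use that in simp)
    from measurable_compose[OF this h] have "(\<lambda>u. h (\<omega>, u)) \<in> borel_measurable lborel" by simp
    then have "set_integrable lborel {0..T} (\<lambda>u. h (\<omega>, u))"
      unfolding set_integrable_def
      by (rule integrableI_bounded_set_indicator[where B=S, rotated]) (use hS T in auto)
    moreover have "set_integrable lborel {0..T} (\<lambda>u. h (\<omega>, u)) = set_integrable lborel {0..T} (\<lambda>u. path_fun f u \<omega>)"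
      by (rule set_integrable_cong) (auto simp: h_def)
    ultimately show ?thesis by simp
  qed
qed

subsection \<open>Uniform hitting bounds and recurrence\<close>

text \<open>If the target were hit with tiny probability before time \<open>T\<close>, the mean of the subsolution along
  the path would grow linearly in \<open>T\<close> and exceed its supremum.\<close>

lemma uniform_hitting:
  assumes r: "0 < r"
  obtains T \<epsilon> where "0 < \<epsilon>" "\<And>x i. x \<in> cball y R \<Longrightarrow>
    \<epsilon> \<le> measure (P (x, i)) {\<omega> \<in> skorohod_paths. hitting_time (ball y r \<times> {l}) \<omega> < ennreal T}"
proof -
  obtain f K m0 where f: "\<And>j. C2c (f j)" and f0: "\<And>j x. 0 \<le> f j x" and K: "0 \<le> K"
    and on: "\<And>x i. f i x - K \<le> generator b \<sigma> \<pi> Q f x i"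
    and off: "\<And>x i. (x, i) \<notin> ball y r \<times> {l} \<Longrightarrow> f i x \<le> generator b \<sigma> \<pi> Q f x i"
    and m0: "0 < m0" "\<And>x i. x \<in> cball y R \<Longrightarrow> m0 \<le> f i x"
    by (rule test_function[OF irreducible r, where l=l and y=y and R=R]) (assumption, rule that)
  obtain S0 where S0: "\<And>j x. \<bar>f j x\<bar> \<le> S0"
    by (rule C2c_family_bounded[OF f]) (rule that)
  define S where "S = max S0 m0"
  have S: "f j x \<le> S" "m0 \<le> S" "0 < S" for j x using S0[of j x] m0 by (auto simp: S_def)
  \<comment> \<open>Long enough for growth at rate m0 / 2 to add up to the supremum bound
    \<open>S\<close>.\<close>
  define T where "T = 2 * S / m0"
  have T: "0 < T" "T * m0 = 2 * S" using S m0 by (auto simp: T_def)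
  \<comment> \<open>Makes the possible loss K T p at most m0 / 2; K + 1 in place of K avoids
    division by 0.\<close>
  define \<epsilon> where "\<epsilon> = m0 / (2 * ((K + 1) * T))"
  have \<epsilon>: "0 < \<epsilon>" using m0 K T by (simp add: \<epsilon>_def)
  let ?U = "ball y r \<times> {l}"
  let ?H = "{\<omega> \<in> skorohod_paths. hitting_time ?U \<omega> < ennreal T}"
  show thesis
  proof (rule that[OF \<epsilon>, of T], rule ccontr)
    fix x i assume x: "x \<in> cball y R"
    interpret prob_space "P (x, i)" by (rule prob_space_P)
    define p where "p = measure (P (x, i)) ?H"
    assume "\<not> \<epsilon> \<le> measure (P (x, i)) ?H"
    then have "p < \<epsilon>" by (simp add: p_def)
    then have "K * T * p \<le> (K + 1) * T * \<epsilon>"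
      using K T by (intro mult_mono) (auto simp: p_def)
    also have "\<dots> = m0 / 2"
    proof -
      have "c * (m0 / (2 * c)) = m0 / 2" if "c \<noteq> 0" for c :: real using that by simp
      from this[of "(K + 1) * T"] show ?thesis using K T(1) by (simp only: \<epsilon>_def) simp
    qed
    finally have KTp: "K * T * p \<le> m0 / 2" .
    have Hm: "?H \<in> sets (P (x, i))"
      using hit_before_path_measurable[OF slice_open_Times[OF open_ball]] by simp
    have Hi: "integrable (P (x, i)) (\<lambda>\<omega>. K * T * indicator ?H \<omega>)" 
      by (intro integrable_mult_right integrable_real_indicator Hm) (simp add: emeasure_eq_measure)
    have EH: "(LINT \<omega>|P (x, i). K * T * indicator ?H \<omega>) = K * T * p"
      using Hm sets.sets_into_space[OF Hm] by (simp add: p_def Int_absorb2)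
    have gen_low: "path_fun f u \<omega> - K * indicator ?H \<omega> \<le> path_gen f \<omega> u"
      if \<omega>: "\<omega> \<in> skorohod_paths" and u: "0 \<le> u" "u < T" for \<omega> u
    proof (cases "\<omega> \<in> ?H")
      case True
      then show ?thesis using on by (simp add: path_fun_def path_gen_def)
    next
      case False
      then have "\<omega> u \<notin> ?U" using \<omega> u by (auto simp: hitting_time_less_ennreal)
      then have "(fst (\<omega> u), snd (\<omega> u)) \<notin> ?U" by simp
      from off[OF this] show ?thesis using False by (simp add: path_fun_def path_gen_def)
    qed
    have int0: "(LINT s:{0..0}|lborel. g s) = 0" for g :: "real \<Rightarrow> real"
    proof -
      have "AE s in lborel. indicator {0..0} s *\<^sub>R g s = 0"
        using AE_lborel_singleton[of 0] by eventually_elim auto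
      then show ?thesis unfolding set_lebesgue_integral_def by (rule integral_eq_zero_AE)
    qed
    \<comment> \<open>First pass: \<open>f \<ge> 0\<close> is dropped from the lower bound on the
      generator, so the mean of \<open>f\<close> starts at no less than m0 and loses at most K T p
      up to time T.\<close>
    have low: "m0 / 2 \<le> (LINT \<omega>|P (x, i). path_fun f u \<omega>)" if u: "0 \<le> u" "u \<le> T" for u
    proof -
      have "AE \<omega> in P (x, i). - (K * T * indicator ?H \<omega>) \<le> path_int f u \<omega>"
        using path_gen_integrable[where f=f and x="(x, i)", OF f] AE_space
      proof eventually_elim
        case (elim \<omega>)
        have "(LINT s:{0..u}|lborel. - path_gen f \<omega> s) - (LINT s:{0..0}|lborel. - path_gen f \<omega> s)
          \<le> K * indicator ?H \<omega> * (u - 0)"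
        proof (rule time_integral_increment_le)
          show "set_integrable lborel {0..u} (\<lambda>s. - path_gen f \<omega> s)"
            using elim u by (auto simp: set_integrable_def)
          fix s assume "0 \<le> s" "s < u"
          then show "- path_gen f \<omega> s \<le> K * indicator ?H \<omega>"
            using gen_low[of \<omega> s] f0[of "snd (\<omega> s)" "fst (\<omega> s)"] elim u by (simp add: path_fun_def)
        qed (use u in auto)
        also have "\<dots> \<le> K * indicator ?H \<omega> * T" using u K by (intro mult_left_mono) auto
        finally show ?case unfolding int0 by (simp add: path_int_def set_lebesgue_integral_def algebra_simps)
      qed
      then have "(LINT \<omega>|P (x, i). - (K * T * indicator ?H \<omega>)) \<le> (LINT \<omega>|P (x, i). path_int f u \<omega>)"
        by (intro integral_mono_AE Bochner_Integration.integrable_minus Hi path_int_integrable[where f=f, OF f u(1) order_refl sets.top])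
      then have "- (K * T * p) \<le> (LINT \<omega>|P (x, i). path_int f u \<omega>)"
        by (simp only: Bochner_Integration.integral_minus EH)
      then show ?thesis
        using expectation_dynkin[where f=f and x="(x, i)", OF f u(1)] m0(2)[OF x, of i] KTp
        unfolding fst_conv snd_conv by linarith
    qed
    note Zi = expectation_time_integral[where f=f, OF f less_imp_le[OF T(1)] low]
    \<comment> \<open>Second pass: now \<open>f\<close> is kept. Its mean is at least m0 / 2 at all
      times up to T, so the integral adds S and the mean at time T is at least m0 + S - m0 / 2, more
      than S.\<close>
    have "AE \<omega> in P (x, i). (LINT u:{0..T}|lborel. path_fun f u \<omega>) - K * T * indicator ?H \<omega> \<le> path_int f T \<omega>"
      using path_gen_integrable[where f=f and x="(x, i)", OF f] AE_space
    proof eventually_elim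
      case (elim \<omega>)
      have zi: "set_integrable lborel {0..T} (\<lambda>u. path_fun f u \<omega>)" using elim by (intro Zi) auto
      have gi: "set_integrable lborel {0..T} (path_gen f \<omega>)" using elim T by auto
      have "(LINT s:{0..T}|lborel. path_fun f s \<omega> - path_gen f \<omega> s) -
        (LINT s:{0..0}|lborel. path_fun f s \<omega> - path_gen f \<omega> s) \<le> K * indicator ?H \<omega> * (T - 0)"
      proof (rule time_integral_increment_le)
        show "set_integrable lborel {0..T} (\<lambda>s. path_fun f s \<omega> - path_gen f \<omega> s)"
          by (rule set_integral_diff(1)[OF zi gi])
        fix s assume "0 \<le> s" "s < T"
        then show "path_fun f s \<omega> - path_gen f \<omega> s \<le> K * indicator ?H \<omega>"
          using gen_low[of \<omega> s] elim by simp
      qed (use T in auto)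
      then show ?case unfolding int0 set_integral_diff(2)[OF zi gi] by (simp add: path_int_def algebra_simps)
    qed
    then have "(LINT \<omega>|P (x, i). (LINT u:{0..T}|lborel. path_fun f u \<omega>) - K * T * indicator ?H \<omega>)
       \<le> (LINT \<omega>|P (x, i). path_int f T \<omega>)"
      using T by (intro integral_mono_AE Bochner_Integration.integrable_diff Hi Zi(1)
          path_int_integrable[where f=f, OF f _ order_refl sets.top]) auto
    also have "(LINT \<omega>|P (x, i). (LINT u:{0..T}|lborel. path_fun f u \<omega>) - K * T * indicator ?H \<omega>) =
      (LINT \<omega>|P (x, i). (LINT u:{0..T}|lborel. path_fun f u \<omega>)) - K * T * p"
      unfolding EH[symmetric] by (rule Bochner_Integration.integral_diff[OF Zi(1) Hi])
    finally have "m0 / 2 * T - K * T * p \<le> (LINT \<omega>|P (x, i). path_int f T \<omega>)"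
      using Zi(2) by linarith
    moreover have "(LINT \<omega>|P (x, i). path_fun f T \<omega>) \<le> S"
      using S T by (intro integral_le_const path_fun_integrable f) (auto simp: path_fun_def)
    ultimately show False
      using expectation_dynkin[where f=f and t=T and x="(x, i)", OF f] m0(2)[OF x, of i] KTp T m0(1) by (simp add: mult.commute)
  qed
qed

section \<open>Transfer of recurrence by the strong Markov property\<close>

lemma constant_time_optional: "optional_time (\<lambda>\<omega> :: real \<Rightarrow> (real^'d) \<times> 'm. ennreal s)"
  unfolding optional_time_def
proof (intro allI impI)
  fix t
  show "{\<omega> :: real \<Rightarrow> (real^'d) \<times> 'm. \<omega> \<in> skorohod_paths \<and> ennreal s < ennreal t} \<in> sets (history t)"
  proof (cases "ennreal s < ennreal t")
    case True
    then show ?thesis using sets.top[of "history t"] by (simp only: True simp_thms Collect_mem_eq space_history)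
  next
    case False
    then show ?thesis by (simp only: False simp_thms Collect_empty_eq sets.empty_sets) simp
  qed
qed

lemma hitting_time_optional: "slice_open U \<Longrightarrow> optional_time (hitting_time U)"
  by (simp add: optional_time_def hit_before_measurable)

lemma hit_event_measurable:
  fixes U :: "((real^'d) \<times> 'm) set"
  assumes "slice_open U"
  shows "{\<omega> \<in> skorohod_paths. hitting_time U \<omega> < \<infinity>} \<in> sets path_algebra"
  using measurable_sets[OF hitting_time_measurable[OF assms], of "{..<\<infinity>}"]
  by (simp add: vimage_def Int_def conj_commute)

lemma shift_hit:
  assumes "shift_path s \<omega> \<in> {\<omega> \<in> skorohod_paths. hitting_time U \<omega> < \<infinity>}" "0 \<le> s"
  shows "\<exists>u\<ge>s. \<omega> u \<in> U"
proof -
  obtain u where "0 \<le> u" "shift_path s \<omega> u \<in> U" using assms by (auto simp: hitting_time_finite)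
  then show ?thesis using assms(2) by (intro exI[of _ "s + u"]) (auto simp: shift_path_def)
qed

lemma events_before_constant:
  assumes "A \<in> sets path_algebra" "\<And>t. s \<le> t \<Longrightarrow> A \<in> sets (history t)"
  shows "A \<in> events_before (\<lambda>\<omega>. ennreal s)"
proof -
  have "{\<omega> \<in> A. ennreal s < ennreal t} \<in> sets (history t)" for t
  proof (cases "ennreal s < ennreal t")
    case True
    have "s \<le> t"
    proof (rule ccontr)
      assume "\<not> s \<le> t"
      then have "ennreal t \<le> ennreal s" by (intro ennreal_leI) simp
      with True show False by (simp add: not_less[symmetric])
    qed
    moreover have "{\<omega> \<in> A. ennreal s < ennreal t} = A" using True by blast
    ultimately show ?thesis using assms(2)[of t] by (simp only:)
  next
    case False
    then have "{\<omega> \<in> A. ennreal s < ennreal t} = {}" by blast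
    then show ?thesis by (simp only: sets.empty_sets)
  qed
  then show ?thesis using assms(1) unfolding events_before_def by blast
qed

lemma strong_markovD:
  assumes "optional_time \<tau>" "A \<in> events_before \<tau>" "B \<in> sets path_algebra"
  shows "emeasure (P z) {\<omega> \<in> A. \<tau> \<omega> < \<infinity> \<and> shift_path (enn2real (\<tau> \<omega>)) \<omega> \<in> B} =
     (\<integral>\<^sup>+\<omega>\<in>{\<omega> \<in> A. \<tau> \<omega> < \<infinity>}. emeasure (P (\<omega> (enn2real (\<tau> \<omega>)))) B \<partial>P z)"
  by (rule markov[unfolded strong_markov_def, THEN conjunct2, rule_format, OF assms])

text \<open>By the Markov property at a fixed time, a hitting probability bounded away from \<open>0\<close> is \<open>1\<close>.\<close>

lemma zero_one_hitting:
  assumes U: "slice_open U" and \<epsilon>: "0 < \<epsilon>"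
    and low: "\<And>z. ennreal \<epsilon> \<le> emeasure (P z) {\<omega> \<in> skorohod_paths. hitting_time U \<omega> < \<infinity>}"
  shows "measure (P x) {\<omega> \<in> skorohod_paths. hitting_time U \<omega> < \<infinity>} = 1"
proof -
  interpret prob_space "P x" by (rule prob_space_P)
  let ?H = "{\<omega> \<in> skorohod_paths. hitting_time U \<omega> < \<infinity>}"
  let ?B = "\<lambda>n::nat. {\<omega> \<in> skorohod_paths. hitting_time U \<omega> < ennreal n}"
  have H: "?H \<in> sets (P x)" using hit_event_measurable[OF U] by simp
  have B: "?B n \<in> sets (P x)" for n using hit_before_path_measurable[OF U] by simp
  \<comment> \<open>On the event of no hit before time n the process restarts and still hits with
    probability at least \<epsilon>. As n grows the right side tends to 0 and the left side to
    \<epsilon> times the probability of never hitting.\<close>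
  have le: "\<epsilon> * (1 - prob (?B n)) \<le> prob ?H - prob (?B n)" for n
  proof -
    let ?A = "skorohod_paths - ?B n"
    have A: "?A \<in> sets (history t)" if "real n \<le> t" for t
      using sets.Diff[OF sets.top hit_before_measurable[OF U that]] by simp
    have AP: "?A \<in> sets path_algebra" using A[OF order_refl] history_subset_path_algebra by blast
    have "?A \<in> events_before (\<lambda>\<omega>. ennreal n)"
      by (rule events_before_constant[OF AP A]) simp
    from strong_markovD[OF constant_time_optional this hit_event_measurable[OF U], of x]
    have "emeasure (P x) {\<omega> \<in> ?A. ennreal n < \<infinity> \<and> shift_path (enn2real (ennreal n)) \<omega> \<in> ?H} =
        (\<integral>\<^sup>+\<omega>\<in>{\<omega> \<in> ?A. ennreal n < \<infinity>}. emeasure (P (\<omega> (enn2real (ennreal n)))) ?H \<partial>P x)"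
      .
    then have "(\<integral>\<^sup>+\<omega>\<in>?A. emeasure (P (\<omega> n)) ?H \<partial>P x) =
      emeasure (P x) {\<omega> \<in> ?A. shift_path n \<omega> \<in> ?H}"
      by (simp only: ennreal_less_top infinity_ennreal_def simp_thms enn2real_ennreal[OF of_nat_0_le_iff] Collect_mem_eq)
    also have "\<dots> \<le> emeasure (P x) (?H - ?B n)"
    proof (rule emeasure_mono)
      show "{\<omega> \<in> ?A. shift_path n \<omega> \<in> ?H} \<subseteq> ?H - ?B n"
      proof
        fix \<omega> assume "\<omega> \<in> {\<omega> \<in> ?A. shift_path n \<omega> \<in> ?H}"
        then have \<omega>: "\<omega> \<in> ?A" "shift_path n \<omega> \<in> ?H" by auto
        obtain u where "real n \<le> u" "\<omega> u \<in> U" using shift_hit[OF \<omega>(2)] by auto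
        then have "hitting_time U \<omega> < \<infinity>" unfolding hitting_time_finite by (intro exI[of _ u]) auto
        then show "\<omega> \<in> ?H - ?B n" using \<omega>(1) by auto
      qed
    qed (use H B in auto)
    finally have "(\<integral>\<^sup>+\<omega>\<in>?A. emeasure (P (\<omega> n)) ?H \<partial>P x) \<le> emeasure (P x) (?H - ?B n)" .
    moreover have "ennreal \<epsilon> * emeasure (P x) ?A \<le> (\<integral>\<^sup>+\<omega>\<in>?A. emeasure (P (\<omega> n)) ?H \<partial>P x)"
    proof -
      have "ennreal \<epsilon> * emeasure (P x) ?A = (\<integral>\<^sup>+\<omega>\<in>?A. ennreal \<epsilon> \<partial>P x)"
        using AP by (simp add: nn_integral_cmult_indicator)
      also have "\<dots> \<le> (\<integral>\<^sup>+\<omega>\<in>?A. emeasure (P (\<omega> n)) ?H \<partial>P x)"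
        by (intro nn_integral_mono mult_right_mono low) auto
      finally show ?thesis .
    qed
    ultimately have "ennreal \<epsilon> * emeasure (P x) ?A \<le> emeasure (P x) (?H - ?B n)"
      by (rule order_trans[rotated])
    then have "\<epsilon> * prob ?A \<le> prob (?H - ?B n)"
      using \<epsilon> by (simp add: emeasure_eq_measure ennreal_mult[symmetric])
    moreover have "prob ?A = 1 - prob (?B n)" using prob_compl[OF B, of n] by simp
    moreover have "?B n \<subseteq> ?H" by (auto simp: hitting_time_finite hitting_time_less_ennreal)
    then have "prob (?H - ?B n) = prob ?H - prob (?B n)" by (intro finite_measure_Diff H B)
    ultimately show ?thesis by simp
  qed
  have "(\<lambda>n. prob (?B n)) \<longlonglongrightarrow> prob (\<Union>n. ?B n)"
  proof (rule finite_Lim_measure_incseq)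
    show "incseq ?B"
      by (rule monoI) (auto simp: hitting_time_less_ennreal intro: order.strict_trans2)
  qed (use B in auto)
  moreover have "(\<Union>n. ?B n) = ?H"
    unfolding hitting_time_finite hitting_time_less_ennreal using reals_Archimedean2 by blast
  ultimately have lim: "(\<lambda>n. prob (?B n)) \<longlonglongrightarrow> prob ?H" by simp
  have "\<epsilon> * (1 - prob ?H) \<le> prob ?H - prob ?H"
    by (rule LIMSEQ_le[OF tendsto_mult[OF tendsto_const tendsto_diff[OF tendsto_const lim]]
          tendsto_diff[OF tendsto_const lim]]) (use le in auto)
  then have "1 \<le> prob ?H" using \<epsilon> by (simp add: mult_le_0_iff)
  then show ?thesis using prob_le_1[of ?H] by linarith
qed

lemma recurrent_transfer:
  assumes D: "bounded_domain D" and E: "bounded_domain E" and rec: "recurrent P (D \<times> UNIV)"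
  shows "recurrent P (E \<times> {l})"
proof -
  let ?U = "E \<times> {l}" and ?D = "D \<times> (UNIV :: 'm set)"
  let ?H = "{\<omega> \<in> skorohod_paths. hitting_time ?U \<omega> < \<infinity>}"
  have oU: "slice_open ?U" and oD: "slice_open ?D"
    using D E by (simp_all add: bounded_domain_def slice_open_Times)
  have Hm: "?H \<in> sets (P z)" for z using hit_event_measurable[OF oU] by simp
  obtain y where "y \<in> E" using E by (auto simp: bounded_domain_def)
  moreover have "open E" using E by (simp add: bounded_domain_def)
  ultimately obtain r where r: "0 < r" "ball y r \<subseteq> E" by (auto simp: open_contains_ball)
  have "bounded D" using D by (simp add: bounded_domain_def)
  then obtain R where "\<And>x. x \<in> D \<Longrightarrow> dist y x \<le> R" using bounded_any_center[of D y] by auto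
  \<comment> \<open>A closed ball, because the state at the hitting time of \<open>D\<close> is only
    known to lie in closed supersets of \<open>D\<close>.\<close>
  then have R: "D \<subseteq> cball y R" by auto
  obtain T \<epsilon> where \<epsilon>: "0 < \<epsilon>" and hit: "\<And>x i. x \<in> cball y R \<Longrightarrow>
    \<epsilon> \<le> measure (P (x, i)) {\<omega> \<in> skorohod_paths. hitting_time (ball y r \<times> {l}) \<omega> < ennreal T}"
    by (rule uniform_hitting[OF r(1)]) (rule that)
  have near: "ennreal \<epsilon> \<le> emeasure (P z) ?H" if "fst z \<in> cball y R" for z
  proof -
    interpret prob_space "P z" by (rule prob_space_P)
    let ?B = "{\<omega> \<in> skorohod_paths. hitting_time (ball y r \<times> {l}) \<omega> < ennreal T}"
    have "ennreal \<epsilon> \<le> emeasure (P z) ?B"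
      using hit[OF that, of "snd z"] by (simp add: emeasure_eq_measure)
    also have "\<dots> \<le> emeasure (P z) ?H"
    proof (rule emeasure_mono[OF _ Hm])
      show "?B \<subseteq> ?H"
      proof
        fix \<omega> assume "\<omega> \<in> ?B"
        then obtain s where s: "\<omega> \<in> skorohod_paths" "0 \<le> s" "\<omega> s \<in> ball y r \<times> {l}"
          by (auto simp: hitting_time_less_ennreal)
        then have "\<omega> s \<in> ?U" using r(2) by (cases "\<omega> s") auto
        then show "\<omega> \<in> ?H" using s by (auto simp: hitting_time_finite)
      qed
    qed
    finally show ?thesis .
  qed
  \<comment> \<open>Every state is included, not only those off the target: the restart at a
    deterministic time may find the process anywhere.\<close>
  have all: "ennreal \<epsilon> \<le> emeasure (P z) ?H" for z
  proof (cases "z \<in> ?D")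
    case True
    then show ?thesis using R by (intro near) auto
  next
    case False
    interpret prob_space "P z" by (rule prob_space_P)
    let ?\<tau> = "hitting_time ?D"
    let ?A = "{\<omega> \<in> skorohod_paths. ?\<tau> \<omega> < \<infinity>}"
    from False have "z \<in> - ?D" by (simp only: Compl_iff not_False_eq_True)
    with rec have "measure (P z) ?A = 1" unfolding recurrent_def space_P by (rule bspec)
    then have A1: "emeasure (P z) ?A = 1" by (simp add: emeasure_eq_measure)
    have Am: "?A \<in> sets (P z)" using hit_event_measurable[OF oD] by simp
    have "skorohod_paths \<in> events_before ?\<tau>"
      using sets.top[of path_algebra] hit_before_measurable[OF oD order_refl] by (simp add: events_before_def)
    from strong_markovD[OF hitting_time_optional[OF oD] this hit_event_measurable[OF oU], of z]
    have sm: "emeasure (P z) {\<omega> \<in> skorohod_paths. ?\<tau> \<omega> < \<infinity> \<and> shift_path (enn2real (?\<tau> \<omega>)) \<omega> \<in> ?H} =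
        (\<integral>\<^sup>+\<omega>\<in>?A. emeasure (P (\<omega> (enn2real (?\<tau> \<omega>)))) ?H \<partial>P z)"
      .
    have up: "emeasure (P z) {\<omega> \<in> skorohod_paths. ?\<tau> \<omega> < \<infinity> \<and> shift_path (enn2real (?\<tau> \<omega>)) \<omega> \<in> ?H}
        \<le> emeasure (P z) ?H"
    proof (rule emeasure_mono[OF _ Hm], rule subsetI)
      fix \<omega> assume \<omega>: "\<omega> \<in> {\<omega> \<in> skorohod_paths. ?\<tau> \<omega> < \<infinity> \<and> shift_path (enn2real (?\<tau> \<omega>)) \<omega> \<in> ?H}"
      then obtain u where u: "enn2real (?\<tau> \<omega>) \<le> u" "\<omega> u \<in> ?U"
        using shift_hit[of "enn2real (?\<tau> \<omega>)" \<omega> ?U] by auto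
      have "0 \<le> u" by (rule order_trans[OF enn2real_nonneg u(1)])
      with u(2) have "hitting_time ?U \<omega> < \<infinity>"
        unfolding hitting_time_finite by (intro exI[of _ u] conjI)
      then show "\<omega> \<in> ?H" using \<omega> by auto
    qed
    have "ennreal \<epsilon> \<le> (\<integral>\<^sup>+\<omega>\<in>?A. emeasure (P (\<omega> (enn2real (?\<tau> \<omega>)))) ?H \<partial>P z)"
    proof -
      have "ennreal \<epsilon> = (\<integral>\<^sup>+\<omega>\<in>?A. ennreal \<epsilon> \<partial>P z)"
        using Am A1 by (simp add: nn_integral_cmult_indicator)
      also have "\<dots> \<le> (\<integral>\<^sup>+\<omega>\<in>?A. emeasure (P (\<omega> (enn2real (?\<tau> \<omega>)))) ?H \<partial>P z)"
      proof (rule nn_integral_mono)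
        fix \<omega>
        show "ennreal \<epsilon> * indicator ?A \<omega> \<le> emeasure (P (\<omega> (enn2real (?\<tau> \<omega>)))) ?H * indicator ?A \<omega>"
        proof (cases "\<omega> \<in> ?A")
          case True
          then have "fst (\<omega> (enn2real (?\<tau> \<omega>))) \<in> cball y R"
            using R by (intro hitting_state_in_closed) auto
          from near[OF this] show ?thesis using True by simp
        qed simp
      qed
      finally show ?thesis .
    qed
    then show ?thesis unfolding sm[symmetric] using up by (rule order_trans)
  qed
  show ?thesis
    unfolding recurrent_def space_P by (intro ballI zero_one_hitting[OF oU \<epsilon> all])
qed

lemma recurrent_superset:
  assumes "recurrent P U" "U \<subseteq> V" "slice_open V"
  shows "recurrent P V"
  unfolding recurrent_def
proof
  fix z assume "z \<in> - V"
  interpret prob_space "P z" by (rule prob_space_P)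
  have "prob {\<omega> \<in> space (P z). hitting_time U \<omega> < \<infinity>} = 1"
  proof (rule bspec[OF assms(1)[unfolded recurrent_def]])
    show "z \<in> - U" using assms(2) \<open>z \<in> - V\<close> by blast
  qed
  moreover have "prob {\<omega> \<in> space (P z). hitting_time U \<omega> < \<infinity>} \<le> prob {\<omega> \<in> space (P z). hitting_time V \<omega> < \<infinity>}"
  proof (rule finite_measure_mono)
    show "{\<omega> \<in> space (P z). hitting_time U \<omega> < \<infinity>} \<subseteq> {\<omega> \<in> space (P z). hitting_time V \<omega> < \<infinity>}"
      using assms(2) by (auto simp: hitting_time_finite)
  qed (use hit_event_measurable[OF assms(3)] in simp)
  ultimately show "prob {\<omega> \<in> space (P z). hitting_time V \<omega> < \<infinity>} = 1"
    using prob_le_1[of "{\<omega> \<in> space (P z). hitting_time V \<omega> < \<infinity>}"] by linarith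
qed

end

subsection \<open>Lyapunov functions and mean hitting times\<close>

lemma ennreal_le_by_truncation:
  fixes x y :: ennreal and a :: "nat \<Rightarrow> real"
  assumes "\<And>n. min x (ennreal (a n)) \<le> y" "\<And>r. \<exists>n. r < a n"
  shows "x \<le> y"
proof (cases y)
  case (real r)
  obtain n where n: "r < a n" using assms(2) by blast
  then have "y < ennreal (a n)" using real by (simp add: ennreal_lessI ennreal_less_iff)
  then have "\<not> ennreal (a n) \<le> y" by simp
  then show ?thesis using assms(1)[of n] by (simp add: min_le_iff_disj)
qed simp

context regime_switching_jump_diffusion
begin

text \<open>\<open>jump_density\<close> with radius 1/2 compares starting points at distance less
  than 1/2; each such step costs a factor \<open>\<alpha>\<close>. By convexity the segment from
  \<open>x\<close> to \<open>y\<close> stays in the ball of radius \<open>n\<close>, and landing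
  points of norm at least \<open>n + 1\<close> keep their distance from all of it.\<close>

lemma density_chain:
  obtains p :: "'m \<Rightarrow> real^'d \<Rightarrow> real^'d \<Rightarrow> real" and \<alpha>
  where "\<And>i x. p i x \<in> borel_measurable borel" "\<And>i x z. 0 \<le> p i x z"
    "\<And>i x. \<pi> i x = density lborel (\<lambda>z. ennreal (p i x z))" "1 < \<alpha>"
    "\<And>i x y z n k. norm x < n \<Longrightarrow> norm y < n \<Longrightarrow> dist x y < real (Suc k) / 2 \<Longrightarrow> n + 1 \<le> norm z \<Longrightarrow>
      p i x (z - x) \<le> \<alpha> ^ Suc k * p i y (z - y)"
proof -
  from jump_density obtain p and \<kappa>\<^sub>2 \<beta> :: real where p: "\<forall>i x. p i x \<in> borel_measurable borel \<and> (\<forall>z. p i x z \<ge> 0) \<and>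
               \<pi> i x = density lborel (\<lambda>z. ennreal (p i x z))"
    and ex: "\<forall>r. 0 < r \<and> r < 1 \<longrightarrow>
          (\<exists>\<alpha>. 1 < \<alpha> \<and> \<alpha> < \<kappa>\<^sub>2 * r powr (-\<beta>) \<and>
            (\<forall>i x\<^sub>0. \<forall>x\<in>ball x\<^sub>0 (r/2). \<forall>y\<in>ball x\<^sub>0 (r/2). \<forall>z\<in>- ball x\<^sub>0 r.
               p i x (z - x) \<le> \<alpha> * p i y (z - y)))"
    by (elim exE conjE)
  from ex[rule_format, of "1/2"] obtain \<alpha> where \<alpha>: "1 < \<alpha>"
    and har: "\<And>i x0 x y z. x \<in> ball x0 (1/2/2) \<Longrightarrow> y \<in> ball x0 (1/2/2) \<Longrightarrow> z \<in> - ball x0 (1/2) \<Longrightarrow>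
               p i x (z - x) \<le> \<alpha> * p i y (z - y)" by auto
  have step: "p i x (z - x) \<le> \<alpha> * p i y (z - y)"
    if "norm x < n" "norm y < n" "dist x y < 1/2" "n + 1 \<le> norm z" for i x y z n
  proof (rule har)
    \<comment> \<open>The midpoint serves as centre: both points are then within half of 1/2 of
      it.\<close>
    show "x \<in> ball (midpoint x y) (1/2/2)" "y \<in> ball (midpoint x y) (1/2/2)"
      using that by (simp_all add: dist_midpoint)
    have "norm (midpoint x y) = norm (x + y) / 2" by (simp add: midpoint_def)
    then have "norm (midpoint x y) < n" using that norm_triangle_ineq[of x y] by linarith
    then show "z \<in> - ball (midpoint x y) (1/2)"
      using that norm_triangle_sub[of z "midpoint x y"] by (simp add: dist_norm norm_minus_commute)
  qed
  have chain: "p i x (z - x) \<le> \<alpha> ^ Suc k * p i y (z - y)"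
    if "norm x < n" "norm y < n" "dist x y < real (Suc k) / 2" "n + 1 \<le> norm z" for i x y z n k
    using that
  proof (induction k arbitrary: x)
    case 0
    then show ?case using step[of x n y z i] by simp
  next
    case (Suc k)
    \<comment> \<open>One of k + 2 equal pieces: the first is shorter than 1/2, and the rest is
      shorter than (k + 1) / 2, as the induction hypothesis demands.\<close>
    define t where "t = 1 / real (Suc (Suc k))"
    have t: "0 \<le> t" "t \<le> 1" by (auto simp: t_def)
    define w where "w = (1 - t) *\<^sub>R x + t *\<^sub>R y"
    have "w \<in> ball 0 n"
      unfolding w_def using Suc.prems t by (intro convexD[OF convex_ball]) auto
    then have w: "norm w < n" by simp
    have "x - w = t *\<^sub>R (x - y)" "w - y = (1 - t) *\<^sub>R (x - y)" by (simp_all add: w_def algebra_simps)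
    then have d: "dist x w = t * dist x y" "dist w y = (1 - t) * dist x y" using t by (simp_all add: dist_norm)
    have "t * dist x y < t * (real (Suc (Suc k)) / 2)"
      using Suc.prems by (intro mult_strict_left_mono) (auto simp: t_def)
    also have "\<dots> = 1 / 2" by (simp add: t_def)
    finally have 1: "dist x w < 1 / 2" using d by simp
    have "(1 - t) * dist x y < (1 - t) * (real (Suc (Suc k)) / 2)"
      using Suc.prems by (intro mult_strict_left_mono) (auto simp: t_def)
    also have "\<dots> = real (Suc k) / 2" by (simp add: t_def field_simps)
    finally have 2: "dist w y < real (Suc k) / 2" using d by simp
    have "p i x (z - x) \<le> \<alpha> * p i w (z - w)" using Suc.prems w 1 by (intro step[of x n w z i]) auto
    also have "\<dots> \<le> \<alpha> * (\<alpha> ^ Suc k * p i y (z - y))"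
      using \<alpha> Suc.prems w 2 by (intro mult_left_mono Suc.IH) auto
    finally show ?case by (simp add: mult.assoc)
  qed
  show thesis by (rule that[of p \<alpha>]) (use p \<alpha> chain in auto)
qed

text \<open>Substituting the landing point u = x + z puts integrals from different starting points
  over the same variable, so that their densities can be compared pointwise.\<close>

lemma nn_integral_translate_density:
  fixes x :: "real^'d"
  assumes p: "p \<in> borel_measurable borel" "\<And>z. 0 \<le> p z" and g: "g \<in> borel_measurable borel"
  shows "(\<integral>\<^sup>+z. g (x + z) \<partial>density lborel (\<lambda>z. ennreal (p z))) = (\<integral>\<^sup>+u. g u * ennreal (p (u - x)) \<partial>lborel)"
proof -
  have "(\<integral>\<^sup>+u. g u * ennreal (p (u - x)) \<partial>lborel) = (\<integral>\<^sup>+u. g u * ennreal (p (u - x)) \<partial>distr lborel borel ((+) x))"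
    by (simp only: lborel_distr_plus)
  also have "\<dots> = (\<integral>\<^sup>+z. g (x + z) * ennreal (p z) \<partial>lborel)"
    using p g by (subst nn_integral_distr) auto
  also have "\<dots> = (\<integral>\<^sup>+z. g (x + z) \<partial>density lborel (\<lambda>z. ennreal (p z)))"
    using p g by (subst nn_integral_density) (auto simp: mult.commute)
  finally show ?thesis ..
qed

text \<open>The comparison of jump densities carries the integrability of \<open>V\<close> with respect to the large jumps
  from a single point outside \<open>D\<close> to all points, locally uniformly.\<close>

lemma lyapunov_large_jumps:
  assumes D: "bounded D" and V: "lyapunov_function b \<sigma> \<pi> Q D V"
  obtains C where "\<And>x i. norm x < \<rho> \<Longrightarrow>
    (\<integral>\<^sup>+z. ennreal (V i (x + z) * indicator {z. 1 \<le> norm z} z) \<partial>\<pi> i x) \<le> ennreal C"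
proof -
  obtain p \<alpha> where p: "\<And>i x. p i x \<in> borel_measurable borel" "\<And>i x z. 0 \<le> p i x z"
    and dens: "\<And>i x. \<pi> i x = density lborel (\<lambda>z. ennreal (p i x z))" and \<alpha>: "1 < \<alpha>"
    and chain: "\<And>i x y z n k. norm x < n \<Longrightarrow> norm y < n \<Longrightarrow> dist x y < real (Suc k) / 2 \<Longrightarrow> n + 1 \<le> norm z \<Longrightarrow>
      p i x (z - x) \<le> \<alpha> ^ Suc k * p i y (z - y)"
    by (rule density_chain) (rule that)
  have V2: "C2 (V i)" and V0: "0 \<le> V i x" for i x using V by (auto simp: lyapunov_function_def)
  have Vm [measurable]: "V i \<in> borel_measurable borel" for i
    using C2_continuous[OF V2] by (rule borel_measurable_continuous_onI)
  have "D \<noteq> UNIV" using D by auto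
  then obtain y where y: "y \<notin> D" by auto
  define n where "n = max \<rho> (norm y + 1)"
  have "norm y + 1 \<le> n" by (simp add: n_def)
  then have n: "norm y < n" "\<rho> \<le> n" "0 < n" using norm_ge_zero[of y] by (linarith, simp add: n_def, linarith)
  \<comment> \<open>Two points of norm below n are less than 2 n \<le> k / 2 apart, so k + 1
    comparison steps suffice uniformly.\<close>
  obtain k :: nat where k: "4 * n \<le> real k" using real_arch_simple by blast
  define T where "T = (SUP x. SUP i. emeasure (\<pi> i x) (- ball 0 1))"
  have T: "T < \<infinity>" using big_jumps by (simp add: T_def)
  have Tx: "emeasure (\<pi> i x) (- ball 0 1) \<le> T" for i x
    unfolding T_def by (rule SUP_upper2[OF UNIV_I], rule SUP_upper2[OF UNIV_I]) (rule order_refl)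
  have big: "{z::real^'d. 1 \<le> norm z} = - ball 0 1" by auto
  have bigm [measurable]: "{z::real^'d. 1 \<le> norm z} \<in> sets borel" unfolding big by simp
  have far: "{z::real^'d. n + 1 \<le> norm z} = - ball 0 (n + 1)" by auto
  have farm [measurable]: "{z::real^'d. n + 1 \<le> norm z} \<in> sets borel" unfolding far by simp
  have "\<exists>C<\<infinity>. \<forall>x. norm x < \<rho> \<longrightarrow>
    (\<integral>\<^sup>+z. ennreal (V i (x + z) * indicator {z. 1 \<le> norm z} z) \<partial>\<pi> i x) \<le> C" for i
  proof -
    have "compact (V i ` cball 0 (n + 1))"
      by (intro compact_continuous_image continuous_on_subset[OF C2_continuous[OF V2]]) auto
    then obtain S where S: "\<And>u. norm u \<le> n + 1 \<Longrightarrow> \<bar>V i u\<bar> \<le> S"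
      using compact_imp_bounded by (fastforce simp: bounded_iff)
    have S0: "0 \<le> S" using S[of 0] n by auto
    \<comment> \<open>Only landing points of norm at least n + 1 need the density comparison; nearer
      ones are handled by the maximum \<open>S\<close> of \<open>V i\<close> on a ball and the total
      mass \<open>T\<close> of large jumps.\<close>
    define g where "g u = ennreal (V i u * indicator {z. n + 1 \<le> norm z} u)" for u
    have gm: "g \<in> borel_measurable borel" unfolding g_def by measurable
    define I where "I = (\<integral>\<^sup>+z. g (y + z) \<partial>\<pi> i y)"
    \<comment> \<open>From \<open>y\<close>, a landing point beyond n + 1 requires a jump of length
      at least 1, where the increment has no compensator: there \<open>V i (y + z)\<close> is the
      increment plus \<open>V i y\<close>, both integrable over large jumps.\<close>
    have I: "I < \<infinity>"
    proof -
      have ji: "integrable (\<pi> i y) (jump_increment (V i) y)"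
        using V y by (auto simp: lyapunov_function_def)
      have "I \<le> (\<integral>\<^sup>+z. ennreal \<bar>jump_increment (V i) y z\<bar> + ennreal (V i y) * indicator {z. 1 \<le> norm z} z \<partial>\<pi> i y)"
        unfolding I_def
      proof (rule nn_integral_mono)
        fix z
        show "g (y + z) \<le> ennreal \<bar>jump_increment (V i) y z\<bar> + ennreal (V i y) * indicator {z. 1 \<le> norm z} z"
        proof (cases "n + 1 \<le> norm (y + z)")
          case True
          then have z: "1 \<le> norm z" using norm_triangle_ineq[of y z] n by linarith
          then have "V i (y + z) \<le> \<bar>jump_increment (V i) y z\<bar> + V i y"
            by (simp add: jump_increment_def)
          then have "ennreal (V i (y + z)) \<le> ennreal (\<bar>jump_increment (V i) y z\<bar> + V i y)"
            by (rule ennreal_leI)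
          then show ?thesis using z True V0 by (simp add: g_def ennreal_plus)
        qed (simp add: g_def)
      qed
      also have "\<dots> = (\<integral>\<^sup>+z. ennreal \<bar>jump_increment (V i) y z\<bar> \<partial>\<pi> i y) + ennreal (V i y) * emeasure (\<pi> i y) {z. 1 \<le> norm z}"
        using jump_increment_measurable[OF V2, of i y]
        by (subst nn_integral_add) (auto simp: nn_integral_cmult_indicator cong: measurable_cong_sets)
      also have "\<dots> < \<infinity>"
      proof -
        have "(\<integral>\<^sup>+z. ennreal \<bar>jump_increment (V i) y z\<bar> \<partial>\<pi> i y) < \<infinity>"
          using ji by (simp add: integrable_iff_bounded)
        moreover have "emeasure (\<pi> i y) {z. 1 \<le> norm z} < \<infinity>"
          unfolding big using Tx T by (rule order.strict_trans1)
        ultimately show ?thesis by (simp add: ennreal_mult_less_top)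
      qed
      finally show ?thesis .
    qed
    show ?thesis
    proof (intro exI[of _ "ennreal S * T + ennreal (\<alpha> ^ Suc k) * I"] conjI allI impI)
      show "ennreal S * T + ennreal (\<alpha> ^ Suc k) * I < \<infinity>"
        using T I by (simp add: ennreal_mult_less_top)
      fix x :: "real^'d" assume x: "norm x < \<rho>"
      have "(\<integral>\<^sup>+z. ennreal (V i (x + z) * indicator {z. 1 \<le> norm z} z) \<partial>\<pi> i x)
        \<le> (\<integral>\<^sup>+z. ennreal S * indicator {z. 1 \<le> norm z} z + g (x + z) \<partial>\<pi> i x)"
      proof (rule nn_integral_mono)
        fix z
        show "ennreal (V i (x + z) * indicator {z. 1 \<le> norm z} z) \<le> ennreal S * indicator {z. 1 \<le> norm z} z + g (x + z)"
        proof (cases "n + 1 \<le> norm (x + z)")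
          case True
          have "ennreal (V i (x + z) * indicator {z. 1 \<le> norm z} z) \<le> ennreal (V i (x + z))"
            using V0 by (intro ennreal_leI) (auto simp: indicator_def)
          also have "\<dots> = g (x + z)" using True by (simp add: g_def)
          finally show ?thesis by (rule order_trans) simp
        next
          case False
          then have "V i (x + z) \<le> S" using S[of "x + z"] by simp
          then have "ennreal (V i (x + z)) \<le> ennreal S" by (rule ennreal_leI)
          then show ?thesis by (auto simp: indicator_def intro: order_trans)
        qed
      qed
      also have "\<dots> = ennreal S * emeasure (\<pi> i x) {z. 1 \<le> norm z} + (\<integral>\<^sup>+z. g (x + z) \<partial>\<pi> i x)"
        using gm by (subst nn_integral_add) (auto simp: nn_integral_cmult_indicator)
      also have "\<dots> \<le> ennreal S * T + ennreal (\<alpha> ^ Suc k) * I"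
      proof (intro add_mono mult_left_mono)
        show "emeasure (\<pi> i x) {z. 1 \<le> norm z} \<le> T" unfolding big by (rule Tx)
        have "(\<integral>\<^sup>+z. g (x + z) \<partial>\<pi> i x) = (\<integral>\<^sup>+u. g u * ennreal (p i x (u - x)) \<partial>lborel)"
          unfolding dens by (rule nn_integral_translate_density[OF p gm])
        also have "\<dots> \<le> (\<integral>\<^sup>+u. ennreal (\<alpha> ^ Suc k) * (g u * ennreal (p i y (u - y))) \<partial>lborel)"
        proof (rule nn_integral_mono)
          fix u
          show "g u * ennreal (p i x (u - x)) \<le> ennreal (\<alpha> ^ Suc k) * (g u * ennreal (p i y (u - y)))"
          proof (cases "n + 1 \<le> norm u")
            case True
            have "dist x y \<le> norm x + norm y" by (simp add: dist_norm norm_triangle_ineq4)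
            then have "dist x y < real (Suc k) / 2" using x n k by simp
            then have "p i x (u - x) \<le> \<alpha> ^ Suc k * p i y (u - y)" using x n True by (intro chain) auto
            then have "ennreal (p i x (u - x)) \<le> ennreal (\<alpha> ^ Suc k * p i y (u - y))" by (rule ennreal_leI)
            also have "\<dots> = ennreal (\<alpha> ^ Suc k) * ennreal (p i y (u - y))"
              using \<alpha> p(2) by (intro ennreal_mult) auto
            finally have "g u * ennreal (p i x (u - x)) \<le> g u * (ennreal (\<alpha> ^ Suc k) * ennreal (p i y (u - y)))"
              by (rule mult_left_mono) simp
            then show ?thesis by (simp only: mult.left_commute)
          qed (simp add: g_def)
        qed
        also have "\<dots> = ennreal (\<alpha> ^ Suc k) * (\<integral>\<^sup>+u. g u * ennreal (p i y (u - y)) \<partial>lborel)"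
        proof (rule nn_integral_cmult)
          have "(\<lambda>u. p i y (u - y)) \<in> borel_measurable borel"
            by (rule measurable_compose[OF _ p(1)]) simp
          then show "(\<lambda>u. g u * ennreal (p i y (u - y))) \<in> borel_measurable lborel"
            using gm by simp
        qed
        also have "(\<integral>\<^sup>+u. g u * ennreal (p i y (u - y)) \<partial>lborel) = I"
          unfolding I_def dens by (rule nn_integral_translate_density[OF p gm, symmetric])
        finally show "(\<integral>\<^sup>+z. g (x + z) \<partial>\<pi> i x) \<le> ennreal (\<alpha> ^ Suc k) * I" .
      qed simp
      finally show "(\<integral>\<^sup>+z. ennreal (V i (x + z) * indicator {z. 1 \<le> norm z} z) \<partial>\<pi> i x)
        \<le> ennreal S * T + ennreal (\<alpha> ^ Suc k) * I" .
    qed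
  qed
  then obtain C where C: "\<And>i. C i < \<infinity>" "\<And>i x. norm x < \<rho> \<Longrightarrow>
    (\<integral>\<^sup>+z. ennreal (V i (x + z) * indicator {z. 1 \<le> norm z} z) \<partial>\<pi> i x) \<le> C i" by metis
  define C' where "C' = (\<Sum>i\<in>UNIV. C i)"
  have "C i \<le> C'" for i unfolding C'_def by (rule member_le_sum) auto
  moreover have "C' < \<infinity>" unfolding C'_def using C(1) by simp
  ultimately show thesis
    using C(2) by (intro that[of "enn2real C'"]) (auto intro: order_trans)
qed

text \<open>Near a point of norm at most n the truncation agrees with \<open>V\<close>, so the local
  and switching parts are unchanged and jumps can only lose. The bound on \<open>D\<close> must be
  uniform in n: \<open>W n\<close> is compared with \<open>W 0\<close>, whose generator is bounded,
  and the difference is invisible except to jumps of length at least 1.\<close>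

lemma truncated_lyapunov:
  assumes D: "bounded D" and V: "lyapunov_function b \<sigma> \<pi> Q D V"
  obtains W :: "nat \<Rightarrow> 'm \<Rightarrow> real^'d \<Rightarrow> real" and C where "\<And>n i. C2c (W n i)" "\<And>n i x. 0 \<le> W n i x"
    "\<And>n i x. W n i x \<le> V i x" "0 \<le> C"
    "\<And>n x i. x \<notin> D \<Longrightarrow> norm x \<le> real n \<Longrightarrow> generator b \<sigma> \<pi> Q (W n) x i \<le> -1"
    "\<And>n x i. x \<in> D \<Longrightarrow> generator b \<sigma> \<pi> Q (W n) x i \<le> C"
proof -
  have V2: "C2 (V i)" and V0: "0 \<le> V i x" for i x using V by (auto simp: lyapunov_function_def)
  obtain \<rho>0 where "\<And>x. x \<in> D \<Longrightarrow> norm x \<le> \<rho>0" using D by (auto simp: bounded_iff)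
  define \<rho> where "\<rho> = max 0 \<rho>0 + 1"
  have \<rho>: "0 < \<rho>" "\<And>x. x \<in> D \<Longrightarrow> norm x < \<rho>"
    using \<open>\<And>x. x \<in> D \<Longrightarrow> norm x \<le> \<rho>0\<close> by (fastforce simp: \<rho>_def)+
  define W where "W = (\<lambda>n i x. V i x * cutoff (\<rho> + 1 + real n) x)"
  have W2: "C2c (W n i)" for n i
    unfolding W_def using \<rho> by (intro C2c_mult V2 cutoff_C2c) auto
  have W0: "0 \<le> W n i x" for n i x by (simp add: W_def V0 cutoff_nonneg)
  have WV: "W n i x \<le> V i x" for n i x
    unfolding W_def using mult_left_mono[OF cutoff_le_1 V0, of i x] by simp
  have Weq: "W n i x = V i x" if "norm x \<le> \<rho> + 1 + real n" for n i x
    using that by (simp add: W_def cutoff_one)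
  have off: "generator b \<sigma> \<pi> Q (W n) x i \<le> -1" if x: "x \<notin> D" "norm x \<le> real n" for n x i
  proof -
    let ?B = "ball (0::real^'d) (\<rho> + 1 + real n)"
    have B: "x \<in> ?B" "open ?B" using x \<rho> by auto
    have eq: "W n j u = V j u" if "u \<in> ?B" for j u using that by (intro Weq) simp
    have d1: "partial_deriv k (W n i) x = partial_deriv k (V i) x" for k
      by (rule partial_deriv_cong_open[OF B(2,1) eq])
    have d2: "partial_deriv k (partial_deriv l (W n i)) x = partial_deriv k (partial_deriv l (V i)) x" for k l
      by (rule partial_deriv2_cong_open[OF B(2,1) eq])
    have "(LINT z|\<pi> i x. jump_increment (W n i) x z) \<le> (LINT z|\<pi> i x. jump_increment (V i) x z)"
    proof (rule integral_mono)
      show "integrable (\<pi> i x) (jump_increment (V i) x)" using V x by (auto simp: lyapunov_function_def)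
      show "jump_increment (W n i) x z \<le> jump_increment (V i) x z" for z
        using WV[of n i "x + z"] by (simp add: jump_increment_def grad_inner d1 eq[OF B(1)])
    qed (rule C2c_jump_integrable[OF W2])
    then have "generator b \<sigma> \<pi> Q (W n) x i \<le> generator b \<sigma> \<pi> Q V x i"
      unfolding generator_split local_op_def d1 d2 eq[OF B(1)] by simp
    also have "\<dots> \<le> -1" using V x by (auto simp: lyapunov_function_def)
    finally show ?thesis .
  qed
  obtain C0 where C0: "\<And>x i. \<bar>generator b \<sigma> \<pi> Q (W 0) x i\<bar> \<le> C0"
    by (rule C2c_generator_bounded[of "W 0", OF W2]) (rule that)
  obtain C1 where C1: "\<And>x i. norm x < \<rho> \<Longrightarrow>
    (\<integral>\<^sup>+z. ennreal (V i (x + z) * indicator {z. 1 \<le> norm z} z) \<partial>\<pi> i x) \<le> ennreal C1"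
    by (rule lyapunov_large_jumps[OF D V, of \<rho>]) (rule that)
  have C00: "0 \<le> C0" using C0[of undefined undefined] by linarith
  have on: "generator b \<sigma> \<pi> Q (W n) x i \<le> C0 + max 0 C1" if x: "x \<in> D" for n x i
  proof -
    \<comment> \<open>Vanishes up to radius \<rho> + 1 and lies between 0 and \<open>V\<close>. At
      points of \<open>D\<close> its generator thus reduces to a jump integral, bounded by that of
      \<open>V\<close> over large jumps.\<close>
    define g where "g = (\<lambda>i x. 1 * W n i x + (-1) * W 0 i x)"
    have g2: "C2c (g i)" for i unfolding g_def by (intro C2c_lincomb W2)
    have g0: "g j u = 0" if "norm u \<le> \<rho> + 1" for j u
      using that by (simp add: g_def Weq)
    have gp: "0 \<le> g j u" for j u
    proof -
      have "W 0 j u \<le> W n j u"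
        unfolding W_def using \<rho> by (intro mult_left_mono cutoff_mono V0) auto
      then show ?thesis by (simp add: g_def)
    qed
    have gV: "g j u \<le> V j u" for j u using WV[of n j u] W0[of 0 j u] by (simp add: g_def)
    let ?B = "ball (0::real^'d) (\<rho> + 1)"
    have B: "x \<in> ?B" "open ?B" using \<rho>(2)[OF x] by auto
    have z: "g j u = 0" if "u \<in> ?B" for j u using that by (intro g0) simp
    have d1: "partial_deriv k (g i) x = 0" for k
      using partial_deriv_cong_open[OF B(2,1) z, where k=k] by (simp add: partial_deriv_zero)
    have d2: "partial_deriv k (partial_deriv l (g i)) x = 0" for k l
      using partial_deriv2_cong_open[OF B(2,1) z, where k=l and l=k] by (simp add: partial_deriv_zero)
    have ji: "jump_increment (g i) x u = g i (x + u)" for u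
      by (simp add: jump_increment_def grad_inner d1 z[OF B(1)])
    have "(LINT u|\<pi> i x. jump_increment (g i) x u) \<le> max 0 C1"
    proof (rule integral_real_bounded)
      have "(\<integral>\<^sup>+u. ennreal (jump_increment (g i) x u) \<partial>\<pi> i x)
        \<le> (\<integral>\<^sup>+u. ennreal (V i (x + u) * indicator {z. 1 \<le> norm z} u) \<partial>\<pi> i x)"
      proof (rule nn_integral_mono)
        fix u
        show "ennreal (jump_increment (g i) x u) \<le> ennreal (V i (x + u) * indicator {z. 1 \<le> norm z} u)"
        proof (cases "1 \<le> norm u")
          case True
          then show ?thesis using gV[of i "x + u"] by (simp add: ji ennreal_leI)
        next
          case False
          then have "norm (x + u) \<le> \<rho> + 1" using \<rho>(2)[OF x] norm_triangle_ineq[of x u] by simp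
          then show ?thesis using False by (simp add: ji g0)
        qed
      qed
      also have "\<dots> \<le> ennreal C1" by (rule C1[OF \<rho>(2)[OF x]])
      also have "\<dots> \<le> ennreal (max 0 C1)" by (rule ennreal_leI) simp
      finally show "(\<integral>\<^sup>+u. ennreal (jump_increment (g i) x u) \<partial>\<pi> i x) \<le> ennreal (max 0 C1)" .
    qed simp
    then have "generator b \<sigma> \<pi> Q g x i \<le> max 0 C1"
      unfolding generator_split local_op_def d1 d2 z[OF B(1)] by simp
    moreover have "generator b \<sigma> \<pi> Q g x i = 1 * generator b \<sigma> \<pi> Q (W n) x i + (-1) * generator b \<sigma> \<pi> Q (W 0) x i"
      unfolding g_def by (rule generator_lincomb[OF W2 W2])
    ultimately show ?thesis using C0[of x i] by linarith
  qed
  show thesis by (rule that[OF W2 W0 WV _ off on]) (use C00 in auto)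
qed

end

text \<open>A tail sum on a grid of mesh \<open>h\<close>, the leading \<open>h\<close> covering the
  first interval. The induction treats truncations, so an infinite hitting time is included.\<close>

lemma hitting_time_discretised:
  fixes h :: real
  assumes "0 < h"
  shows "hitting_time U \<omega> \<le> ennreal h + (\<Sum>k. ennreal h * indicator {\<omega>. \<not> hitting_time U \<omega> < ennreal (real (Suc k) * h)} \<omega>)"
proof (rule ennreal_le_by_truncation[where a="\<lambda>n. real (Suc n) * h"])
  let ?i = "\<lambda>k. ennreal h * indicator {\<omega>. \<not> hitting_time U \<omega> < ennreal (real (Suc k) * h)} \<omega>"
  have fin: "min (hitting_time U \<omega>) (ennreal (real (Suc n) * h)) \<le> ennreal h + (\<Sum>k<n. ?i k)" for n
  proof (induction n)
    case 0
    then show ?case by simp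
  next
    case (Suc n)
    show ?case
    proof (cases "hitting_time U \<omega> < ennreal (real (Suc n) * h)")
      case True
      have "min (hitting_time U \<omega>) (ennreal (real (Suc (Suc n)) * h)) \<le> hitting_time U \<omega>" by simp
      also have "\<dots> = min (hitting_time U \<omega>) (ennreal (real (Suc n) * h))"
        using True by (simp only: min_absorb1 less_imp_le)
      also have "\<dots> \<le> ennreal h + (\<Sum>k<n. ?i k)" by (rule Suc.IH)
      also have "\<dots> \<le> ennreal h + (\<Sum>k<Suc n. ?i k)" by (intro add_left_mono sum_mono2) auto
      finally show ?thesis .
    next
      case False
      have "real (Suc (Suc n)) * h = real (Suc n) * h + h" by (simp add: algebra_simps)
      then have "ennreal (real (Suc (Suc n)) * h) = ennreal (real (Suc n) * h) + ennreal h"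
        using assms by (simp only: ennreal_plus mult_nonneg_nonneg of_nat_0_le_iff less_imp_le)
      then have "min (hitting_time U \<omega>) (ennreal (real (Suc (Suc n)) * h)) \<le> ennreal (real (Suc n) * h) + ennreal h"
        by (simp only: min.cobounded2)
      also have "ennreal (real (Suc n) * h) = min (hitting_time U \<omega>) (ennreal (real (Suc n) * h))"
        using False by (simp only: min_absorb2 not_less)
      also have "\<dots> + ennreal h \<le> (ennreal h + (\<Sum>k<n. ?i k)) + ennreal h"
        by (rule add_right_mono[OF Suc.IH])
      also have "\<dots> = ennreal h + (\<Sum>k<Suc n. ?i k)" using False by (simp add: add.assoc)
      finally show ?thesis .
    qed
  qed
  show "min (hitting_time U \<omega>) (ennreal (real (Suc n) * h)) \<le> ennreal h + (\<Sum>k. ?i k)" for n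
    by (rule order_trans[OF fin]) (intro add_left_mono sum_le_suminf, auto)
  show "\<exists>n. r < real (Suc n) * h" for r
  proof -
    obtain n where "r < real n * h" using reals_Archimedean3[OF assms] by blast
    also have "\<dots> \<le> real (Suc n) * h" using assms by (intro mult_right_mono) auto
    finally show ?thesis by blast
  qed
qed

text \<open>Infinite lifetime enters here: a path is bounded on compact time intervals, so the exit times from
  balls exhaust the time axis.\<close>

lemma hitting_time_localised:
  fixes U :: "((real^'d::finite) \<times> 'm::finite) set"
  assumes \<omega>: "\<omega> \<in> skorohod_paths"
  shows "hitting_time U \<omega> \<le> (SUP n. hitting_time (U \<union> {x. real n < norm x} \<times> UNIV) \<omega>)"
proof (rule dense_le)
  fix c assume c: "c < hitting_time U \<omega>"
  then obtain r where r: "c = ennreal r" "0 \<le> r" by (cases c) auto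
  obtain B where B: "\<And>s. 0 \<le> s \<Longrightarrow> s \<le> r \<Longrightarrow> norm (fst (\<omega> s)) \<le> B"
    by (rule path_bounded[OF \<omega>]) (rule that)
  obtain n where n: "B \<le> real n" using real_arch_simple by blast
  have "c \<le> hitting_time (U \<union> {x. real n < norm x} \<times> UNIV) \<omega>"
    unfolding hitting_time_def
  proof (rule INF_greatest)
    fix s assume s: "s \<in> {t. 0 \<le> t \<and> \<omega> t \<in> U \<union> {x. real n < norm x} \<times> UNIV}"
    show "c \<le> ennreal s"
    proof (rule ccontr)
      assume "\<not> c \<le> ennreal s"
      then have sr: "ennreal s < c" "s < r" using r s by (auto simp: ennreal_le_iff2 not_le ennreal_less_iff)
      have "norm (fst (\<omega> s)) \<le> real n" using B[of s] n s sr by auto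
      then have "\<omega> s \<in> U" using s by (cases "\<omega> s") auto
      then have "hitting_time U \<omega> \<le> ennreal s" unfolding hitting_time_def using s by (intro INF_lower) auto
      with sr(1) c show False by (meson leD order.strict_trans)
    qed
  qed
  then show "c \<le> (SUP n. hitting_time (U \<union> {x. real n < norm x} \<times> UNIV) \<omega>)"
    by (rule SUP_upper2[OF UNIV_I])
qed

section \<open>Mean hitting times under a Lyapunov function\<close>

context regime_switching_process
begin

text \<open>Dynkin's formula along the grid \<open>{k h}\<close>. The last grid interval, on which the target may already have
  been hit, costs at most \<open>C h\<close>; it becomes negligible for small \<open>h\<close>, so that no optional stopping
  theorem is needed.\<close>

lemma mean_hitting_time_bound:
  assumes H: "slice_open H" and f: "\<And>j. C2c (f j)" and low: "\<And>j x. - c \<le> f j x" and c: "0 \<le> c"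
    and gen: "\<And>x i. (x, i) \<notin> H \<Longrightarrow> generator b \<sigma> \<pi> Q f x i \<le> -1"
  shows "(\<integral>\<^sup>+\<omega>. hitting_time H \<omega> \<partial>P z) \<le> ennreal (f (snd z) (fst z) + c + 1)"
proof -
  interpret prob_space "P z" by (rule prob_space_P)
  obtain C where C: "\<And>x i. \<bar>generator b \<sigma> \<pi> Q f x i\<bar> \<le> C"
    by (rule C2c_generator_bounded[of f, OF f]) (rule that)
  have C0: "0 \<le> C" using C[of undefined undefined] by linarith
  \<comment> \<open>With this mesh h + C h = 1, which is the 1 in the bound: h from discretising and
    C h from the grid interval of the hit.\<close>
  define h where "h = 1 / (1 + C)"
  have "1 + C \<noteq> 0" using C0 by simp
  then have "(1 + C) * h = 1" by (simp add: h_def)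
  moreover have "0 < h" using C0 by (simp add: h_def)
  ultimately have h: "0 < h" "h + C * h = 1" by (simp_all add: distrib_right)
  define A where "A = (\<lambda>k::nat. skorohod_paths - {\<omega> \<in> skorohod_paths. hitting_time H \<omega> < ennreal (real k * h)})"
  have Ah: "A k \<in> sets (history (real k * h))" for k
    unfolding A_def using sets.Diff[OF sets.top hit_before_measurable[OF H order_refl]] by simp
  have Am: "A k \<in> sets (P z)" for k using Ah history_subset_path_algebra by auto
  have Amono: "A (Suc k) \<subseteq> A k" for k
  proof -
    have "real k * h \<le> real (Suc k) * h" using h by (intro mult_right_mono) auto
    then show ?thesis unfolding A_def by (auto simp: hitting_time_less_ennreal intro: order.strict_trans2)
  qed
  have A_off: "\<omega> u \<notin> H" if "\<omega> \<in> A k" "0 \<le> u" "u < real k * h" for \<omega> k u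
    using that by (auto simp: A_def hitting_time_less_ennreal)
  have t0: "0 \<le> real k * h" for k using h by simp
  have tS: "real k * h \<le> real (Suc k) * h" for k using h by (intro mult_right_mono) auto
  define Z where "Z = (\<lambda>k. path_fun f (real k * h))"
  define I where "I = (\<lambda>k. path_int f (real k * h))"
  have Zi: "integrable (P z) (Z k)" for k unfolding Z_def by (intro path_fun_integrable f t0)
  have Ii: "integrable (P z) (I k)" for k
    unfolding I_def by (rule path_int_integrable[where f=f, OF f t0 order_refl sets.top])
  have iA: "integrable (P z) (\<lambda>\<omega>. indicator (A k) \<omega> * g \<omega>)" if "integrable (P z) g" for g :: "_ \<Rightarrow> real" and k
    using integrable_mult_indicator[OF Am that] by simp
  have ind: "integrable (P z) (\<lambda>\<omega>. indicat_real (A k) \<omega>)" for k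
    using Am by (intro integrable_real_indicator) (auto simp: emeasure_eq_measure)
  \<comment> \<open>The shift by \<open>c\<close> makes the integrand nonnegative, so passing from
    \<open>A k\<close> to the smaller \<open>A (Suc k)\<close> can only lower the mean.\<close>
  define Y where "Y k = (LINT \<omega>|P z. indicator (A k) \<omega> * (Z k \<omega> + c))" for k
  have Zc: "0 \<le> Z k \<omega> + c" for k \<omega>
    using low[of "snd (\<omega> (real k * h))" "fst (\<omega> (real k * h))"]
    unfolding Z_def path_fun_def by linarith
  have Y0: "0 \<le> Y k" for k
    unfolding Y_def using Zc by (intro integral_nonneg_AE AE_I2 mult_nonneg_nonneg) auto
  \<comment> \<open>On \<open>A (Suc k)\<close> the whole interval is spent off the target and gains
    h; on the rest of \<open>A k\<close> the generator is only bounded by C. These costs telescope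
    to at most C h in total.\<close>
  have step: "Y (Suc k) + h * prob (A (Suc k)) \<le> Y k + C * h * (prob (A k) - prob (A (Suc k)))" for k
  proof -
    have "Y (Suc k) \<le> (LINT \<omega>|P z. indicator (A k) \<omega> * (Z (Suc k) \<omega> + c))"
      unfolding Y_def
    proof (rule integral_mono)
      fix \<omega>
      have "indicat_real (A (Suc k)) \<omega> \<le> indicator (A k) \<omega>"
        using Amono[of k] by (auto simp: indicator_def)
      then show "indicator (A (Suc k)) \<omega> * (Z (Suc k) \<omega> + c) \<le> indicator (A k) \<omega> * (Z (Suc k) \<omega> + c)"
        using Zc by (rule mult_right_mono)
    qed (intro iA Bochner_Integration.integrable_add Zi integrable_const)+
    also have "\<dots> = (LINT \<omega>|P z. indicator (A k) \<omega> * (Z k \<omega> + c) + indicator (A k) \<omega> * (Z (Suc k) \<omega> - Z k \<omega>))"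
      by (rule Bochner_Integration.integral_cong) (auto simp: algebra_simps)
    also have "\<dots> = Y k + (LINT \<omega>|P z. indicator (A k) \<omega> * (Z (Suc k) \<omega> - Z k \<omega>))"
      unfolding Y_def
      by (rule Bochner_Integration.integral_add)
         (intro iA Bochner_Integration.integrable_add Bochner_Integration.integrable_diff Zi integrable_const)+
    also have "(LINT \<omega>|P z. indicator (A k) \<omega> * (Z (Suc k) \<omega> - Z k \<omega>)) =
        (LINT \<omega>|P z. indicator (A k) \<omega> * (I (Suc k) \<omega> - I k \<omega>))"
      unfolding Z_def I_def by (rule dynkin[where f=f, OF f t0 tS Ah])
    also have "\<dots> \<le> (LINT \<omega>|P z. C * h * (indicator (A k) \<omega> - indicator (A (Suc k)) \<omega>) - h * indicator (A (Suc k)) \<omega>)"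
    proof (rule integral_mono_AE)
      show "AE \<omega> in P z. indicator (A k) \<omega> * (I (Suc k) \<omega> - I k \<omega>) \<le>
        C * h * (indicator (A k) \<omega> - indicator (A (Suc k)) \<omega>) - h * indicator (A (Suc k)) \<omega>"
        using path_gen_integrable[where f=f and x=z, OF f]
      proof eventually_elim
        case (elim \<omega>)
        have gi: "set_integrable lborel {0..real (Suc k) * h} (path_gen f \<omega>)" using elim t0 by blast
        have len: "real (Suc k) * h - real k * h = h" by (simp add: algebra_simps)
        have inc: "I (Suc k) \<omega> - I k \<omega> \<le> a * h"
          if "\<And>u. real k * h \<le> u \<Longrightarrow> u < real (Suc k) * h \<Longrightarrow> path_gen f \<omega> u \<le> a" for a
          using time_integral_increment_le[OF gi t0 tS that] unfolding I_def path_int_def len .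
        consider "\<omega> \<in> A (Suc k)" "\<omega> \<in> A k" | "\<omega> \<notin> A (Suc k)" "\<omega> \<in> A k" | "\<omega> \<notin> A (Suc k)" "\<omega> \<notin> A k"
          using Amono[of k] by blast
        then show ?case
        proof cases
          case 1
          have "path_gen f \<omega> u \<le> -1" if "real k * h \<le> u" "u < real (Suc k) * h" for u
          proof -
            have "0 \<le> u" using t0[of k] that(1) by linarith
            then have "(fst (\<omega> u), snd (\<omega> u)) \<notin> H" using A_off[OF 1(1) _ that(2)] by simp
            then show ?thesis unfolding path_gen_def by (rule gen)
          qed
          from inc[OF this] show ?thesis using 1 by simp
        next
          case 2
          have "path_gen f \<omega> u \<le> C" for u
            unfolding path_gen_def using C[of "fst (\<omega> u)" "snd (\<omega> u)"] by linarith
          from inc[OF this] show ?thesis using 2 by simp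
        next
          case 3
          then show ?thesis by simp
        qed
      qed
    qed (intro iA Bochner_Integration.integrable_diff integrable_mult_right Ii ind)+
    also have "\<dots> = C * h * (prob (A k) - prob (A (Suc k))) - h * prob (A (Suc k))"
    proof -
      have e: "(LINT \<omega>|P z. indicat_real (A k) \<omega>) = prob (A k)" for k
        using Am[of k] sets.sets_into_space[OF Am[of k]] by (simp add: Int_absorb2)
      show ?thesis
        by (simp only: Bochner_Integration.integral_diff Bochner_Integration.integrable_diff integrable_mult_right ind
            integral_mult_right_zero e)
    qed
    finally show ?thesis by linarith
  qed
  have sum: "Y n + h * (\<Sum>k<n. prob (A (Suc k))) \<le> Y 0 + C * h * (prob (A 0) - prob (A n))" for n
  proof (induction n)
    case (Suc n)
    then show ?case using step[of n] by (simp add: algebra_simps)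
  qed simp
  have "A 0 = skorohod_paths" by (auto simp: A_def hitting_time_less_ennreal)
  then have "Y 0 = (LINT \<omega>|P z. Z 0 \<omega> + c)"
    unfolding Y_def by (intro Bochner_Integration.integral_cong) auto
  also have "\<dots> = (LINT \<omega>|P z. Z 0 \<omega>) + c"
    using Zi[of 0] prob_space[unfolded space_P] by simp
  also have "(LINT \<omega>|P z. Z 0 \<omega>) = f (snd z) (fst z)"
    using expectation_start[where f=f and x=z, OF f] by (simp add: Z_def)
  finally have Y00: "Y 0 = f (snd z) (fst z) + c" .
  have partial: "h + h * (\<Sum>k<n. prob (A (Suc k))) \<le> f (snd z) (fst z) + c + 1" for n
  proof -
    have "prob (A 0) - prob (A n) \<le> 1"
      using prob_le_1[of "A 0"] measure_nonneg[of "P z" "A n"] by linarith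
    then have "C * h * (prob (A 0) - prob (A n)) \<le> C * h * 1"
      using C0 h by (intro mult_left_mono) auto
    then show ?thesis using sum[of n] Y0[of n] Y00 h by simp
  qed
  have "(\<integral>\<^sup>+\<omega>. hitting_time H \<omega> \<partial>P z) \<le> (\<integral>\<^sup>+\<omega>. ennreal h + (\<Sum>k. ennreal h * indicator (A (Suc k)) \<omega>) \<partial>P z)"
  proof (rule nn_integral_mono)
    fix \<omega> assume "\<omega> \<in> space (P z)"
    then have "indicator (A (Suc k)) \<omega> = (indicator {\<omega>. \<not> hitting_time H \<omega> < ennreal (real (Suc k) * h)} \<omega> :: ennreal)" for k
      unfolding A_def space_P by (simp add: indicator_def)
    then show "hitting_time H \<omega> \<le> ennreal h + (\<Sum>k. ennreal h * indicator (A (Suc k)) \<omega>)"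
      using hitting_time_discretised[OF h(1), of H \<omega>] by (simp only:)
  qed
  also have "\<dots> = ennreal h + (\<Sum>k. \<integral>\<^sup>+\<omega>. ennreal h * indicator (A (Suc k)) \<omega> \<partial>P z)"
  proof -
    have m: "(\<lambda>\<omega>. ennreal h * indicator (A (Suc k)) \<omega>) \<in> borel_measurable (P z)" for k
      using Am by (intro borel_measurable_times_ennreal borel_measurable_const borel_measurable_indicator)
    have "(\<integral>\<^sup>+\<omega>. ennreal h + (\<Sum>k. ennreal h * indicator (A (Suc k)) \<omega>) \<partial>P z) =
        (\<integral>\<^sup>+\<omega>. ennreal h \<partial>P z) + (\<integral>\<^sup>+\<omega>. (\<Sum>k. ennreal h * indicator (A (Suc k)) \<omega>) \<partial>P z)"
      by (rule nn_integral_add) (intro borel_measurable_const borel_measurable_suminf_order m)+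
    also have "(\<integral>\<^sup>+\<omega>. ennreal h \<partial>P z) = ennreal h"
      using emeasure_space_1[unfolded space_P] by simp
    finally show ?thesis unfolding nn_integral_suminf[OF m] .
  qed
  also have "(\<lambda>k. \<integral>\<^sup>+\<omega>. ennreal h * indicator (A (Suc k)) \<omega> \<partial>P z) = (\<lambda>k. ennreal (h * prob (A (Suc k))))"
    using Am h by (intro ext) (simp add: nn_integral_cmult_indicator emeasure_eq_measure ennreal_mult)
  also have "ennreal h + (\<Sum>k. ennreal (h * prob (A (Suc k)))) \<le> ennreal (f (snd z) (fst z) + c + 1)"
  proof -
    have "(\<Sum>k. ennreal (h * prob (A (Suc k)))) \<le> ennreal (f (snd z) (fst z) + c + 1 - h)"
      unfolding suminf_eq_SUP
    proof (rule SUP_least)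
      fix n
      have "(\<Sum>k<n. ennreal (h * prob (A (Suc k)))) = ennreal (\<Sum>k<n. h * prob (A (Suc k)))"
        using h by (intro sum_ennreal) auto
      also have "\<dots> \<le> ennreal (f (snd z) (fst z) + c + 1 - h)"
        using partial[of n] by (intro ennreal_leI) (simp add: sum_distrib_left)
      finally show "(\<Sum>k<n. ennreal (h * prob (A (Suc k)))) \<le> ennreal (f (snd z) (fst z) + c + 1 - h)" .
    qed
    then have "ennreal h + (\<Sum>k. ennreal (h * prob (A (Suc k)))) \<le> ennreal h + ennreal (f (snd z) (fst z) + c + 1 - h)"
      by (rule add_left_mono)
    also have "\<dots> = ennreal (f (snd z) (fst z) + c + 1)"
      using h partial[of 0] by (subst ennreal_plus[symmetric]) auto
    finally show ?thesis .
  qed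
  finally show ?thesis .
qed

lemma mean_hitting_time_finite:
  assumes D: "bounded_domain D" and E: "bounded_domain E" and V: "lyapunov_function b \<sigma> \<pi> Q D V"
  shows "(\<integral>\<^sup>+\<omega>. hitting_time (E \<times> {l}) \<omega> \<partial>P z) < \<infinity>"
proof -
  have bD: "bounded D" using D by (simp add: bounded_domain_def)
  obtain y where "y \<in> E" using E by (auto simp: bounded_domain_def)
  moreover have "open E" using E by (simp add: bounded_domain_def)
  ultimately obtain r where r: "0 < r" "ball y r \<subseteq> E" by (auto simp: open_contains_ball)
  obtain R where "\<And>x. x \<in> D \<Longrightarrow> dist y x \<le> R" using bounded_any_center[of D y] bD by auto
  then have R: "\<And>x. x \<in> D \<Longrightarrow> x \<in> cball y R" by auto
  let ?U = "ball y r \<times> {l}"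
  obtain f K m0 where f: "\<And>j. C2c (f j)" and f0: "\<And>j x. 0 \<le> f j x" and K: "0 \<le> K"
    and on: "\<And>x i. f i x - K \<le> generator b \<sigma> \<pi> Q f x i"
    and off: "\<And>x i. (x, i) \<notin> ball y r \<times> {l} \<Longrightarrow> f i x \<le> generator b \<sigma> \<pi> Q f x i"
    and m0: "0 < m0" "\<And>x i. x \<in> cball y R \<Longrightarrow> m0 \<le> f i x"
    by (rule test_function[OF irreducible r(1), where l=l and y=y and R=R]) (assumption, rule that)
  obtain S where S: "\<And>j x. \<bar>f j x\<bar> \<le> S"
    by (rule C2c_family_bounded[OF f]) (rule that)
  have S0: "0 \<le> S" using S[of undefined undefined] by linarith
  obtain W C where W: "\<And>n i. C2c (W n i)" and W0: "\<And>n i x. 0 \<le> W n i x"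
    and WV: "\<And>n i x. W n i x \<le> V i x" and C: "0 \<le> C"
    and Woff: "\<And>n x i. x \<notin> D \<Longrightarrow> norm x \<le> real n \<Longrightarrow> generator b \<sigma> \<pi> Q (W n) x i \<le> -1"
    and Won: "\<And>n x i. x \<in> D \<Longrightarrow> generator b \<sigma> \<pi> Q (W n) x i \<le> C"
    by (rule truncated_lyapunov[OF bD V]) (rule that)
  \<comment> \<open>On \<open>D\<close> the generator of \<open>W n\<close> is at most C, while that
    of A f is at least A f \<ge> A m0 = C + 1, so the difference is at most -1. Off \<open>D\<close>
    the nonnegative A f only helps.\<close>
  define A where "A = (C + 1) / m0"
  have A: "0 \<le> A" "A * m0 = C + 1" using C m0 by (auto simp: A_def)
  define F where "F = (\<lambda>n i x. 1 * W n i x + (-A) * f i x)"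
  \<comment> \<open>The target is enlarged by the exterior of the ball of radius n, where the
    truncation is not controlled. The resulting bound does not depend on n, which permits monotone
    convergence.\<close>
  define N where "N = (\<lambda>n. ?U \<union> {x. real n < norm x} \<times> UNIV)"
  have oN: "slice_open (N n)" for n
    unfolding N_def by (intro slice_open_Un slice_open_Times open_ball open_Collect_less continuous_intros)
  have F2: "C2c (F n j)" for n j unfolding F_def by (intro C2c_lincomb W f)
  have Flow: "- (A * S) \<le> F n j x" for n j x
  proof -
    have "A * f j x \<le> A * S" using S[of j x] A by (intro mult_left_mono) auto
    then show ?thesis using W0[of n j x] by (simp add: F_def)
  qed
  have Fgen: "generator b \<sigma> \<pi> Q (F n) x i \<le> -1" if xi: "(x, i) \<notin> N n" for n x i
  proof -
    have x: "(x, i) \<notin> ?U" "norm x \<le> real n" using xi by (auto simp: N_def not_less)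
    have eq: "generator b \<sigma> \<pi> Q (F n) x i = 1 * generator b \<sigma> \<pi> Q (W n) x i + (-A) * generator b \<sigma> \<pi> Q f x i"
      unfolding F_def by (rule generator_lincomb[OF W f])
    have Af: "A * f i x \<le> A * generator b \<sigma> \<pi> Q f x i" using off[OF x(1)] A by (intro mult_left_mono) auto
    show ?thesis
    proof (cases "x \<in> D")
      case True
      have "A * m0 \<le> A * f i x" using m0(2)[OF R[OF True], of i] A by (intro mult_left_mono) auto
      then show ?thesis using Won[OF True, of n i] Af eq A by linarith
    next
      case False
      have "0 \<le> A * f i x" using A f0 by simp
      then show ?thesis using Woff[OF False x(2), of i] Af eq by linarith
    qed
  qed
  have bound: "(\<integral>\<^sup>+\<omega>. hitting_time (N n) \<omega> \<partial>P z) \<le> ennreal (V (snd z) (fst z) + A * S + 1)" for n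
  proof -
    have "(\<integral>\<^sup>+\<omega>. hitting_time (N n) \<omega> \<partial>P z) \<le> ennreal (F n (snd z) (fst z) + A * S + 1)"
      by (rule mean_hitting_time_bound[where f="F n", OF oN F2 Flow _ Fgen]) (use A S0 in auto)
    also have "\<dots> \<le> ennreal (V (snd z) (fst z) + A * S + 1)"
    proof (rule ennreal_leI)
      have "0 \<le> A * f (snd z) (fst z)" using A f0 by simp
      then show "F n (snd z) (fst z) + A * S + 1 \<le> V (snd z) (fst z) + A * S + 1"
        using WV[of n "snd z" "fst z"] by (simp add: F_def)
    qed
    finally show ?thesis .
  qed
  have "(\<integral>\<^sup>+\<omega>. hitting_time (E \<times> {l}) \<omega> \<partial>P z) \<le> (\<integral>\<^sup>+\<omega>. hitting_time ?U \<omega> \<partial>P z)"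
    using r by (intro nn_integral_mono hitting_time_antimono) auto
  also have "\<dots> \<le> (\<integral>\<^sup>+\<omega>. (SUP n. hitting_time (N n) \<omega>) \<partial>P z)"
    unfolding N_def by (intro nn_integral_mono hitting_time_localised) simp
  also have "\<dots> = (SUP n. \<integral>\<^sup>+\<omega>. hitting_time (N n) \<omega> \<partial>P z)"
  proof (rule nn_integral_monotone_convergence_SUP)
    show "incseq (\<lambda>n. hitting_time (N n))"
    proof (intro incseq_SucI le_funI hitting_time_antimono)
      show "N (Suc n) \<subseteq> N n" for n by (auto simp: N_def)
    qed
    show "hitting_time (N n) \<in> borel_measurable (P z)" for n
      using hitting_time_measurable[OF oN, of n] by (simp cong: measurable_cong_sets)
  qed
  also have "\<dots> \<le> ennreal (V (snd z) (fst z) + A * S + 1)" by (rule SUP_least) (rule bound)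
  also have "\<dots> < \<infinity>" by simp
  finally show ?thesis .
qed

text \<open>A finite mean forces the hitting time to be finite almost surely, so recurrence comes
  with the mean bound.\<close>

lemma lyapunov_positive_recurrent:
  assumes "bounded_domain D" "bounded_domain E" "lyapunov_function b \<sigma> \<pi> Q D V"
  shows "positive_recurrent P (E \<times> {l})"
proof -
  have oU: "slice_open (E \<times> {l})" using assms(2) by (simp add: bounded_domain_def slice_open_Times)
  have "measure (P z) {\<omega> \<in> space (P z). hitting_time (E \<times> {l}) \<omega> < \<infinity>} = 1" for z
  proof -
    interpret prob_space "P z" by (rule prob_space_P)
    have "hitting_time (E \<times> {l}) \<in> borel_measurable (P z)"
      using hitting_time_measurable[OF oU] by (simp cong: measurable_cong_sets)
    moreover have "(\<integral>\<^sup>+\<omega>. hitting_time (E \<times> {l}) \<omega> \<partial>P z) \<noteq> \<infinity>"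
      using mean_hitting_time_finite[OF assms, where l=l and z=z] by simp
    ultimately have "AE \<omega> in P z. hitting_time (E \<times> {l}) \<omega> \<noteq> \<infinity>" by (rule nn_integral_PInf_AE)
    then have "AE \<omega> in P z. hitting_time (E \<times> {l}) \<omega> < \<infinity>" by eventually_elim (simp add: less_top)
    moreover have "{\<omega> \<in> space (P z). hitting_time (E \<times> {l}) \<omega> < \<infinity>} \<in> sets (P z)"
      using hit_event_measurable[OF oU] by simp
    ultimately show ?thesis by (subst prob_Collect_eq_1)
  qed
  then show ?thesis
    using mean_hitting_time_finite[OF assms] by (simp add: positive_recurrent_def recurrent_def)
qed

lemma positive_recurrent_superset:
  assumes "positive_recurrent P U" "U \<subseteq> V" "slice_open V"
  shows "positive_recurrent P V"
  unfolding positive_recurrent_def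
proof (intro conjI ballI)
  show "recurrent P V"
    using assms(1) by (intro recurrent_superset[OF _ assms(2,3)]) (simp add: positive_recurrent_def)
  fix z assume "z \<in> - V"
  then have z: "z \<in> - U" using assms(2) by blast
  have "(\<integral>\<^sup>+\<omega>. hitting_time V \<omega> \<partial>P z) \<le> (\<integral>\<^sup>+\<omega>. hitting_time U \<omega> \<partial>P z)"
    by (intro nn_integral_mono hitting_time_antimono assms)
  also have "\<dots> < \<infinity>" using bspec[OF assms(1)[unfolded positive_recurrent_def, THEN conjunct2] z] .
  finally show "(\<integral>\<^sup>+\<omega>. hitting_time V \<omega> \<partial>P z) < \<infinity>" .
qed

end

theorem theorem3p12:
  fixes b :: "real^'d::finite \<Rightarrow> 'm::finite \<Rightarrow> real^'d"
    and \<sigma> :: "real^'d \<Rightarrow> 'm \<Rightarrow> real^'d^'d"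
    and \<pi> :: "'m \<Rightarrow> real^'d \<Rightarrow> (real^'d) measure"
    and Q :: "real^'d \<Rightarrow> real^'m^'m"
    and P :: "(real^'d) \<times> 'm \<Rightarrow> (real \<Rightarrow> (real^'d) \<times> 'm) measure"
    and D E :: "(real^'d) set"
    and l :: 'm
  assumes coeffs: "regime_switching_jump_diffusion b \<sigma> \<pi> Q"
    and solution: "\<And>start. martingale_problem_solution b \<sigma> \<pi> Q start (P start)"
    and uniqueness: "\<And>start P'. martingale_problem_solution b \<sigma> \<pi> Q start P' \<Longrightarrow> P' = P start"
    and markov: "strong_markov P"
    and irreducible: "\<And>G. bounded_domain G \<Longrightarrow> strictly_irreducible Q G"
    and D: "bounded_domain D"
    and E: "bounded_domain E"
  shows "(recurrent P (D \<times> UNIV) \<longleftrightarrow> recurrent P (E \<times> UNIV)) \<and>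
         (recurrent P (E \<times> UNIV) \<longleftrightarrow> recurrent P (E \<times> {l})) \<and>
         ((\<exists>V. lyapunov_function b \<sigma> \<pi> Q D V) \<longrightarrow>
            (positive_recurrent P (D \<times> UNIV) \<longleftrightarrow> positive_recurrent P (E \<times> UNIV)) \<and>
            (positive_recurrent P (E \<times> UNIV) \<longleftrightarrow> positive_recurrent P (E \<times> {l})))"
proof -
  interpret regime_switching_jump_diffusion b \<sigma> \<pi> Q by (rule coeffs)
  interpret regime_switching_process b \<sigma> \<pi> Q P
    by unfold_locales (rule solution markov irreducible, assumption?)+
  have o: "slice_open (G \<times> J)" if "bounded_domain G" for G :: "(real^'d) set" and J :: "'m set"
    using that by (simp add: bounded_domain_def slice_open_Times)
  have up: "recurrent P (G \<times> {l}) \<Longrightarrow> recurrent P (G \<times> UNIV)" if "bounded_domain G" for G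
    by (rule recurrent_superset[OF _ _ o[OF that]]) auto
  \<comment> \<open>Under the Lyapunov condition all the positive recurrence statements hold
    outright, which settles the equivalences of (ii).\<close>
  have "positive_recurrent P (G \<times> {l})" "positive_recurrent P (G \<times> UNIV)"
    if "lyapunov_function b \<sigma> \<pi> Q D V" "bounded_domain G" for V G
  proof -
    show pr: "positive_recurrent P (G \<times> {l})" by (rule lyapunov_positive_recurrent[OF D that(2,1)])
    show "positive_recurrent P (G \<times> UNIV)" by (rule positive_recurrent_superset[OF pr _ o[OF that(2)]]) auto
  qed
  \<comment> \<open>For (i), transfer leads from one domain with all regimes to the other domain
    with the single regime \<open>l\<close>, and enlarging the target returns to all
    regimes.\<close>
  then show ?thesis
    using recurrent_transfer[OF D E] recurrent_transfer[OF E D] recurrent_transfer[OF E E]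
      up[OF D] up[OF E] D E by blast
qed

end
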